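(* In the language of second-order arithmetic, let $\exists X\,\forall Y\,\Psi(X,Y)$ be a $\Sigma^1_2$ sentence such that $\Psi(X,Y)$ is a $\Pi^0_3$ formula. If $\mathrm{RCA}_0 + \exists X\,\forall Y\,\Psi(X,Y)$ is consistent, then $\mathrm{RCA}_0 + \exists X\,\forall Y\,\Psi(X,Y)$ does not prove $\mathrm{B}\Sigma^0_2$.
   Context: $\mathrm{RCA}_0$ is the standard base system of reverse mathematics (basic arithmetic axioms, $\Delta^0_1$ comprehension, and $\Sigma^0_1$ induction). For a $\Sigma^0_k$ formula $\Phi$ (possibly with free number and set variables), $\mathrm{B}\Sigma^0_k$ ($\Sigma^0_k$ bounding) is the scheme consisting of the universal closures of $(\forall i\,\exists j\,\Phi(i,j))\Rightarrow\forall m\,\exists n\,(\forall i<m)\,(\exists j<n)\,\Phi(i,j)$. *)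

theory Defs
  imports Main
begin

section \<open>The language of second-order arithmetic\<close>

text \<open>
  Variables are de Bruijn indices, counted separately for the two sorts: in \<^term>\<open>AllN p\<close> number
  variable 0 of \<^term>\<open>p\<close> is bound, in \<^term>\<open>AllS p\<close> set variable 0 of \<^term>\<open>p\<close> is bound. The only
  terms of set sort are variables, and equality is primitive for numbers only (equality of sets is
  defined by extensionality), as in Simpson's book on subsystems of second-order arithmetic.
\<close>

datatype trm = Var nat | Zero | One | Add trm trm | Mul trm trm

datatype fml =
    Eq trm trm
  | Lt trm trm
  | Mem trm nat
  | Fls
  | Imp fml fml
  | AllN fml
  | AllS fml

abbreviation Neg :: "fml \<Rightarrow> fml" where "Neg p \<equiv> Imp p Fls"
abbreviation Con :: "fml \<Rightarrow> fml \<Rightarrow> fml" where "Con p q \<equiv> Neg (Imp p (Neg q))"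
abbreviation Dis :: "fml \<Rightarrow> fml \<Rightarrow> fml" where "Dis p q \<equiv> Imp (Neg p) q"
abbreviation Iff :: "fml \<Rightarrow> fml \<Rightarrow> fml" where "Iff p q \<equiv> Con (Imp p q) (Imp q p)"
abbreviation ExN :: "fml \<Rightarrow> fml" where "ExN p \<equiv> Neg (AllN (Neg p))"
abbreviation ExS :: "fml \<Rightarrow> fml" where "ExS p \<equiv> Neg (AllS (Neg p))"

text \<open>Simultaneous capture-avoiding substitution of terms for the free number variables and of
  set variables for the free set variables.\<close>

primrec subst_trm :: "(nat \<Rightarrow> trm) \<Rightarrow> trm \<Rightarrow> trm" where
  "subst_trm f (Var i) = f i"
| "subst_trm f Zero = Zero"
| "subst_trm f One = One"
| "subst_trm f (Add s t) = Add (subst_trm f s) (subst_trm f t)"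
| "subst_trm f (Mul s t) = Mul (subst_trm f s) (subst_trm f t)"

abbreviation lift_trm :: "trm \<Rightarrow> trm" where
  "lift_trm \<equiv> subst_trm (\<lambda>i. Var (Suc i))"

primrec subst_fml :: "(nat \<Rightarrow> trm) \<Rightarrow> (nat \<Rightarrow> nat) \<Rightarrow> fml \<Rightarrow> fml" where
  "subst_fml f g (Eq s t) = Eq (subst_trm f s) (subst_trm f t)"
| "subst_fml f g (Lt s t) = Lt (subst_trm f s) (subst_trm f t)"
| "subst_fml f g (Mem t k) = Mem (subst_trm f t) (g k)"
| "subst_fml f g Fls = Fls"
| "subst_fml f g (Imp p q) = Imp (subst_fml f g p) (subst_fml f g q)"
| "subst_fml f g (AllN p) = AllN (subst_fml (case_nat (Var 0) (\<lambda>i. lift_trm (f i))) g p)"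
| "subst_fml f g (AllS p) = AllS (subst_fml f (case_nat 0 (\<lambda>k. Suc (g k))) p)"

definition liftN :: "fml \<Rightarrow> fml" where
  "liftN p = subst_fml (\<lambda>i. Var (Suc i)) (\<lambda>k. k) p"

definition liftS :: "fml \<Rightarrow> fml" where
  "liftS p = subst_fml Var Suc p"

definition instN :: "trm \<Rightarrow> fml \<Rightarrow> fml" where
  "instN t p = subst_fml (case_nat t Var) (\<lambda>k. k) p"

definition instS :: "nat \<Rightarrow> fml \<Rightarrow> fml" where
  "instS m p = subst_fml Var (case_nat m (\<lambda>k. k)) p"

text \<open>\<open>boundN p\<close> (\<open>boundS p\<close>) is the least \<open>n\<close> such that every free number (set) variable of \<open>p\<close>
  is less than \<open>n\<close>.\<close>

primrec boundN_trm :: "trm \<Rightarrow> nat" where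
  "boundN_trm (Var i) = Suc i"
| "boundN_trm Zero = 0"
| "boundN_trm One = 0"
| "boundN_trm (Add s t) = max (boundN_trm s) (boundN_trm t)"
| "boundN_trm (Mul s t) = max (boundN_trm s) (boundN_trm t)"

primrec boundN :: "fml \<Rightarrow> nat" where
  "boundN (Eq s t) = max (boundN_trm s) (boundN_trm t)"
| "boundN (Lt s t) = max (boundN_trm s) (boundN_trm t)"
| "boundN (Mem t k) = boundN_trm t"
| "boundN Fls = 0"
| "boundN (Imp p q) = max (boundN p) (boundN q)"
| "boundN (AllN p) = boundN p - 1"
| "boundN (AllS p) = boundN p"

primrec boundS :: "fml \<Rightarrow> nat" where
  "boundS (Eq s t) = 0"
| "boundS (Lt s t) = 0"
| "boundS (Mem t k) = Suc k"
| "boundS Fls = 0"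
| "boundS (Imp p q) = max (boundS p) (boundS q)"
| "boundS (AllN p) = boundS p"
| "boundS (AllS p) = boundS p - 1"

definition is_sentence :: "fml \<Rightarrow> bool" where
  "is_sentence p \<longleftrightarrow> boundN p = 0 \<and> boundS p = 0"

definition univ_closure :: "fml \<Rightarrow> fml" where
  "univ_closure p = (AllN ^^ boundN p) ((AllS ^^ boundS p) p)"


section \<open>Provability\<close>

text \<open>Natural deduction for two-sorted classical first-order logic with equality on the number
  sort. Lifting the assumptions in the introduction rules for the quantifiers is the eigenvariable
  condition.\<close>

inductive derives :: "fml set \<Rightarrow> fml \<Rightarrow> bool" (infix \<open>\<turnstile>\<close> 50) where
  Assm: "p \<in> T \<Longrightarrow> T \<turnstile> p"
| ImpI: "insert p T \<turnstile> q \<Longrightarrow> T \<turnstile> Imp p q"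
| ImpE: "T \<turnstile> Imp p q \<Longrightarrow> T \<turnstile> p \<Longrightarrow> T \<turnstile> q"
| Contr: "insert (Neg p) T \<turnstile> Fls \<Longrightarrow> T \<turnstile> p"
| AllNI: "liftN ` T \<turnstile> p \<Longrightarrow> T \<turnstile> AllN p"
| AllNE: "T \<turnstile> AllN p \<Longrightarrow> T \<turnstile> instN t p"
| AllSI: "liftS ` T \<turnstile> p \<Longrightarrow> T \<turnstile> AllS p"
| AllSE: "T \<turnstile> AllS p \<Longrightarrow> T \<turnstile> instS m p"
| EqRefl: "T \<turnstile> Eq t t"
| EqSubst: "T \<turnstile> Eq s t \<Longrightarrow> T \<turnstile> instN s p \<Longrightarrow> T \<turnstile> instN t p"

definition is_consistent :: "fml set \<Rightarrow> bool" where
  "is_consistent T \<longleftrightarrow> \<not> T \<turnstile> Fls"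

definition proves_scheme :: "fml set \<Rightarrow> fml set \<Rightarrow> bool" where
  "proves_scheme T S \<longleftrightarrow> (\<forall>p\<in>S. T \<turnstile> p)"


section \<open>The arithmetical hierarchy\<close>

abbreviation BAll :: "trm \<Rightarrow> fml \<Rightarrow> fml" where
  "BAll t p \<equiv> AllN (Imp (Lt (Var 0) (lift_trm t)) p)"

abbreviation BEx :: "trm \<Rightarrow> fml \<Rightarrow> fml" where
  "BEx t p \<equiv> ExN (Con (Lt (Var 0) (lift_trm t)) p)"

inductive is_Delta00 :: "fml \<Rightarrow> bool" where
  "is_Delta00 (Eq s t)"
| "is_Delta00 (Lt s t)"
| "is_Delta00 (Mem t k)"
| "is_Delta00 Fls"
| "is_Delta00 p \<Longrightarrow> is_Delta00 q \<Longrightarrow> is_Delta00 (Imp p q)"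
| "is_Delta00 p \<Longrightarrow> is_Delta00 (BAll t p)"
| "is_Delta00 p \<Longrightarrow> is_Delta00 (BEx t p)"

inductive is_Sigma0 :: "nat \<Rightarrow> fml \<Rightarrow> bool" and is_Pi0 :: "nat \<Rightarrow> fml \<Rightarrow> bool" where
  "is_Delta00 p \<Longrightarrow> is_Sigma0 0 p"
| "is_Delta00 p \<Longrightarrow> is_Pi0 0 p"
| "is_Pi0 k p \<Longrightarrow> is_Sigma0 (Suc k) (ExN p)"
| "is_Sigma0 k p \<Longrightarrow> is_Pi0 (Suc k) (AllN p)"


section \<open>Axioms and schemes\<close>

definition basic_axioms :: "fml set" where
  "basic_axioms = univ_closure `
    {Neg (Eq (Add (Var 0) One) Zero),
     Imp (Eq (Add (Var 0) One) (Add (Var 1) One)) (Eq (Var 0) (Var 1)),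
     Eq (Add (Var 0) Zero) (Var 0),
     Eq (Add (Var 0) (Add (Var 1) One)) (Add (Add (Var 0) (Var 1)) One),
     Eq (Mul (Var 0) Zero) Zero,
     Eq (Mul (Var 0) (Add (Var 1) One)) (Add (Mul (Var 0) (Var 1)) (Var 0)),
     Neg (Lt (Var 0) Zero),
     Iff (Lt (Var 0) (Add (Var 1) One)) (Dis (Lt (Var 0) (Var 1)) (Eq (Var 0) (Var 1)))}"

text \<open>In \<open>induction_fml p\<close> the induction variable is number variable 0 of \<open>p\<close>.\<close>

definition induction_fml :: "fml \<Rightarrow> fml" where
  "induction_fml p =
     Imp (Con (instN Zero p)
              (AllN (Imp p (subst_fml (case_nat (Add (Var 0) One) (\<lambda>i. Var (Suc i))) (\<lambda>k. k) p))))
         (AllN p)"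

text \<open>\<open>comprehension_fml p q\<close> is
  \<open>\<forall>n (p(n) \<longleftrightarrow> q(n)) \<longrightarrow> \<exists>X \<forall>n (n \<in> X \<longleftrightarrow> p(n))\<close>, with \<open>n\<close> number variable 0 of \<open>p\<close> and \<open>q\<close>. The
  lifting of \<open>p\<close> expresses that \<open>X\<close> is not free in \<open>p\<close>.\<close>

definition comprehension_fml :: "fml \<Rightarrow> fml \<Rightarrow> fml" where
  "comprehension_fml p q =
     Imp (AllN (Iff p q)) (ExS (AllN (Iff (Mem (Var 0) 0) (liftS p))))"

definition RCA0 :: "fml set" where
  "RCA0 = basic_axioms
     \<union> {univ_closure (induction_fml p) | p. is_Sigma0 1 p}
     \<union> {univ_closure (comprehension_fml p q) | p q. is_Sigma0 1 p \<and> is_Pi0 1 q}"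

text \<open>\<open>bounding_fml p\<close> is
  \<open>(\<forall>i \<exists>j p(i,j)) \<longrightarrow> (\<forall>m \<exists>n (\<forall>i<m) (\<exists>j<n) p(i,j))\<close>, where \<open>j\<close> and \<open>i\<close> are the number variables
  0 and 1 of \<open>p\<close>. In the conclusion the variables 0, 1, 2, 3 of the matrix are \<open>j\<close>, \<open>i\<close>, \<open>n\<close>, \<open>m\<close>,
  so the parameters of \<open>p\<close> move up by 2.\<close>

definition bounding_fml :: "fml \<Rightarrow> fml" where
  "bounding_fml p =
     Imp (AllN (ExN p))
         (AllN (ExN (BAll (Var 1) (BEx (Var 1)
           (subst_fml (\<lambda>i. Var (if i < 2 then i else i + 2)) (\<lambda>k. k) p)))))"

definition BSigma0 :: "nat \<Rightarrow> fml set" where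
  "BSigma0 k = {univ_closure (bounding_fml p) | p. is_Sigma0 k p}"

end

theory Submission
  imports Defs "HOL-Library.Countable"
begin

text \<open>
  By completeness there are a model \<open>(D, S)\<close> of \<open>RCA\<^sub>0\<close>, a set \<open>A \<in> S\<close> with \<open>\<Psi>(A, Y)\<close> for all
  \<open>Y \<in> S\<close>, a nonstandard \<open>c \<in> D\<close>, and a set \<open>T \<in> S\<close> such that every \<open>\<Pi>\<^sup>0\<^sub>1(A, T; c)\<close> class is
  \<open>{t. \<forall>s \<langle>n,t,s\<rangle> \<in> T}\<close> for some standard \<open>n\<close>. For finitely many of these classes such a \<open>T\<close> is
  defined by recursion, which avoids an arithmetized truth definition. Let \<open>K\<close> be the set of first
  components of least elements of non-empty \<open>\<Pi>\<^sup>0\<^sub>1(A, T; c)\<close> classes, and equip it with the sets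
  of \<open>S\<close> that are \<open>\<Delta>\<^sup>0\<^sub>1(A, T)\<close> with parameters from \<open>K\<close>. Then \<open>K\<close> is \<open>\<Sigma>\<^sup>0\<^sub>2\<close>-elementary in \<open>D\<close>,
  so it inherits \<open>RCA\<^sub>0\<close> and the \<open>\<Pi>\<^sup>0\<^sub>3\<close> statements \<open>\<Psi>(A, Y)\<close>. Every element of \<open>K\<close> has an index
  below \<open>c\<close>, and an index determines at most one element; this gives a \<open>\<Sigma>\<^sup>0\<^sub>2\<close> partial function
  from the numbers below \<open>c\<close> onto \<open>K\<close>. Under \<open>B\<Sigma>\<^sup>0\<^sub>2\<close> the witnesses for the indices of all codes
  of subsets of \<open>{i. i < c}\<close> would be bounded, and then the set of the \<open>i < c\<close> that are not in the
  set coded by the element with index \<open>i\<close> would have a code, which is contradictory.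
\<close>

instance trm :: countable by countable_datatype
instance fml :: countable by countable_datatype

section \<open>Environments\<close>

abbreviation cons_env :: "'a \<Rightarrow> (nat \<Rightarrow> 'a) \<Rightarrow> nat \<Rightarrow> 'a" (infixr \<open>##\<close> 65) where
  "x ## e \<equiv> case_nat x e"

lemma cons_env_eta [simp]: "e 0 ## (\<lambda>i. e (Suc i)) = e"
  by (auto simp: fun_eq_iff split: nat.split)

lemma range_cons_env [simp]: "range (x ## e) = insert x (range e)"
  by (force simp: image_iff split: nat.splits)

lemma all_envs_cons:
  "(\<forall>e. range e \<subseteq> D \<longrightarrow> (\<forall>x\<in>D. P (x ## e))) \<longleftrightarrow> (\<forall>e. range e \<subseteq> D \<longrightarrow> P e)"
proof (intro iffI allI impI)
  fix e :: "nat \<Rightarrow> 'a" assume "\<forall>e. range e \<subseteq> D \<longrightarrow> (\<forall>x\<in>D. P (x ## e))" and e: "range e \<subseteq> D"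
  moreover have "range (\<lambda>i. e (Suc i)) \<subseteq> D" "e 0 \<in> D" using e by auto
  ultimately have "P (e 0 ## (\<lambda>i. e (Suc i)))" by blast
  then show "P e" by simp
qed simp

text \<open>Interleaving two environments turns parameters into further variables.\<close>

definition join :: "(nat \<Rightarrow> 'a) \<Rightarrow> (nat \<Rightarrow> 'a) \<Rightarrow> nat \<Rightarrow> 'a" where
  "join e f i = case_sum e f (sum_decode i)"

abbreviation left :: "nat \<Rightarrow> nat" where "left i \<equiv> sum_encode (Inl i)"
abbreviation right :: "nat \<Rightarrow> nat" where "right i \<equiv> sum_encode (Inr i)"

lemma join_left [simp]: "join e f (left i) = e i"
  and join_right [simp]: "join e f (right i) = f i"
  by (simp_all add: join_def)

lemma comp_join: "(\<lambda>i. h (join e f i)) = join (\<lambda>i. h (e i)) (\<lambda>i. h (f i))"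
  by (auto simp: fun_eq_iff join_def split: sum.split)

lemma range_join [simp]: "range (join e f) = range e \<union> range f"
proof
  show "range e \<union> range f \<subseteq> range (join e f)"
    by (metis Un_least image_subsetI join_left join_right rangeI)
qed (auto simp: join_def split: sum.split)

section \<open>Substitution\<close>

lemma subst_trm_comp: "subst_trm f (subst_trm h t) = subst_trm (\<lambda>i. subst_trm f (h i)) t"
  by (induction t) auto

lemma subst_trm_Var [simp]: "subst_trm Var t = t"
  by (induction t) auto

lemma subst_trm_cong: "(\<And>i. i < boundN_trm t \<Longrightarrow> f i = h i) \<Longrightarrow> subst_trm f t = subst_trm h t"
  by (induction t) auto

lemma subst_trm_cons_lift [simp]: "subst_trm (t ## f) (lift_trm s) = subst_trm f s"
  by (simp add: subst_trm_comp)

lemma subst_fml_cong: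
  "(\<And>i. i < boundN p \<Longrightarrow> f i = f' i) \<Longrightarrow> (\<And>k. k < boundS p \<Longrightarrow> g k = g' k)
   \<Longrightarrow> subst_fml f g p = subst_fml f' g' p"
proof (induction p arbitrary: f f' g g')
  case (AllN p)
  show ?case
    by (simp, rule AllN.IH) (use AllN.prems in \<open>auto split: nat.split\<close>)
next
  case (AllS p)
  show ?case
    by (simp, rule AllS.IH) (use AllS.prems in \<open>auto split: nat.split\<close>)
next
  case (Imp p q)
  have "subst_fml f g p = subst_fml f' g' p" "subst_fml f g q = subst_fml f' g' q"
    by (rule Imp.IH; use Imp.prems in auto)+
  then show ?case by simp
qed (auto intro: subst_trm_cong)

lemma subst_fml_comp:
  "subst_fml f g (subst_fml f' g' p) = subst_fml (\<lambda>i. subst_trm f (f' i)) (\<lambda>k. g (g' k)) p"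
proof (induction p arbitrary: f f' g g')
  case (AllN p)
  have "(\<lambda>i. subst_trm (Var 0 ## (\<lambda>i. lift_trm (f i))) ((Var 0 ## (\<lambda>i. lift_trm (f' i))) i))
     = Var 0 ## (\<lambda>i. lift_trm (subst_trm f (f' i)))"
    by (auto simp: fun_eq_iff subst_trm_comp split: nat.split)
  then show ?case by (simp add: AllN.IH)
next
  case (AllS p)
  have "(\<lambda>k. (0 ## (\<lambda>k. Suc (g k))) ((0 ## (\<lambda>k. Suc (g' k))) k))
     = 0 ## (\<lambda>k. Suc (g (g' k)))"
    by (auto simp: fun_eq_iff split: nat.split)
  then show ?case by (simp add: AllS.IH)
qed (auto simp: subst_trm_comp)

lemma subst_fml_Var [simp]: "subst_fml Var (\<lambda>k. k) p = p"
proof (induction p)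
  case (AllN p)
  have "Var 0 ## (\<lambda>i. lift_trm (Var i)) = Var"
    by (auto simp: fun_eq_iff split: nat.split)
  then show ?case using AllN by simp
next
  case (AllS p)
  have "0 ## (\<lambda>k. Suc k) = (\<lambda>k. k)"
    by (auto simp: fun_eq_iff split: nat.split)
  then show ?case using AllS by simp
qed auto

lemma size_subst_fml: "size (subst_fml f g p) = size p"
  by (induction p arbitrary: f g) auto

lemma subst_liftN:
  "subst_fml (Var 0 ## (\<lambda>i. lift_trm (f i))) g (liftN p) = liftN (subst_fml f g p)"
  by (simp add: liftN_def subst_fml_comp)

lemma subst_liftS:
  "subst_fml f (0 ## (\<lambda>k. Suc (g k))) (liftS p) = liftS (subst_fml f g p)"
  by (simp add: liftS_def subst_fml_comp)

lemma subst_instN: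
  "subst_fml f g (instN t p)
   = instN (subst_trm f t) (subst_fml (Var 0 ## (\<lambda>i. lift_trm (f i))) g p)"
proof -
  have "(\<lambda>i. subst_trm f ((t ## Var) i))
    = (\<lambda>i. subst_trm (subst_trm f t ## Var) ((Var 0 ## (\<lambda>i. lift_trm (f i))) i))"
    by (auto simp: fun_eq_iff split: nat.split)
  then show ?thesis by (simp add: instN_def subst_fml_comp)
qed

lemma subst_instS:
  "subst_fml f g (instS m p)
   = instS (g m) (subst_fml f (0 ## (\<lambda>k. Suc (g k))) p)"
proof -
  have "(\<lambda>k. g ((m ## (\<lambda>k. k)) k))
    = (\<lambda>k. (g m ## (\<lambda>k. k)) ((0 ## (\<lambda>k. Suc (g k))) k))"
    by (auto simp: fun_eq_iff split: nat.split)
  then show ?thesis by (simp add: instS_def subst_fml_comp)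
qed

lemma boundN_AllN_power: "boundN ((AllN ^^ n) p) = boundN p - n"
  and boundS_AllN_power: "boundS ((AllN ^^ n) p) = boundS p"
  by (induction n) auto

lemma boundN_AllS_power: "boundN ((AllS ^^ n) p) = boundN p"
  and boundS_AllS_power: "boundS ((AllS ^^ n) p) = boundS p - n"
  by (induction n) auto

lemma is_sentence_univ_closure: "is_sentence (univ_closure p)"
  by (simp add: is_sentence_def univ_closure_def boundN_AllN_power boundN_AllS_power
      boundS_AllN_power boundS_AllS_power)

section \<open>Derivations\<close>

lemma derives_subst: "T \<turnstile> p \<Longrightarrow> subst_fml f g ` T \<turnstile> subst_fml f g p"
proof (induction arbitrary: f g rule: derives.induct)
  case (AllNI T p)
  have "liftN ` subst_fml f g ` T = subst_fml (Var 0 ## (\<lambda>i. lift_trm (f i))) g ` liftN ` T"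
    by (simp add: image_image subst_liftN)
  then show ?case using AllNI.IH by (simp add: derives.AllNI)
next
  case (AllSI T p)
  have "liftS ` subst_fml f g ` T = subst_fml f (0 ## (\<lambda>k. Suc (g k))) ` liftS ` T"
    by (simp add: image_image subst_liftS)
  then show ?case using AllSI.IH by (simp add: derives.AllSI)
next
  case (EqSubst T s t p)
  show ?case
    using EqSubst.IH[of f g] unfolding subst_instN subst_fml.simps(1) by (rule derives.EqSubst)
next
  case (ImpE T p q)
  show ?case using ImpE.IH[of f g] unfolding subst_fml.simps(5) by (rule derives.ImpE)
next
  case (AllNE T p t)
  then show ?case by (simp add: subst_instN derives.AllNE)
next
  case (AllSE T p m)
  then show ?case by (simp add: subst_instS derives.AllSE)
qed (simp_all add: derives.Assm derives.ImpI derives.Contr derives.EqRefl)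

lemma derives_mono: "T \<turnstile> p \<Longrightarrow> T \<subseteq> T' \<Longrightarrow> T' \<turnstile> p"
proof (induction arbitrary: T' rule: derives.induct)
  case (ImpI p T q)
  then show ?case by (meson derives.ImpI insert_mono)
next
  case (Contr p T)
  then show ?case by (meson derives.Contr insert_mono)
next
  case (AllNI T p)
  then show ?case by (meson derives.AllNI image_mono)
next
  case (AllSI T p)
  then show ?case by (meson derives.AllSI image_mono)
next
  case (ImpE T p q)
  then show ?case by (meson derives.ImpE)
next
  case (EqSubst T s t p)
  then show ?case by (meson derives.EqSubst)
qed (auto intro: derives.Assm derives.AllNE derives.AllSE derives.EqRefl)

lemma derives_finite: "T \<turnstile> p \<Longrightarrow> \<exists>F. finite F \<and> F \<subseteq> T \<and> F \<turnstile> p"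
proof (induction rule: derives.induct)
  case (Assm p T)
  then show ?case by (intro exI[of _ "{p}"]) (auto intro: derives.Assm)
next
  case (ImpI p T q)
  then obtain F where "finite F" "F \<subseteq> insert p T" "F \<turnstile> q" by blast
  then show ?case
    by (intro exI[of _ "F - {p}"]) (auto intro!: derives.ImpI elim: derives_mono)
next
  case (ImpE T p q)
  then obtain F G where "finite F" "F \<subseteq> T" "F \<turnstile> Imp p q" "finite G" "G \<subseteq> T" "G \<turnstile> p" by blast
  then show ?case
    by (intro exI[of _ "F \<union> G"]) (auto intro!: derives.ImpE[of _ p q] elim: derives_mono)
next
  case (Contr p T)
  then obtain F where "finite F" "F \<subseteq> insert (Neg p) T" "F \<turnstile> Fls" by blast
  then show ?case
    by (intro exI[of _ "F - {Neg p}"]) (auto intro!: derives.Contr[of p] elim: derives_mono)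
next
  case (AllNI T p)
  then show ?case by (metis derives.AllNI finite_subset_image)
next
  case (AllSI T p)
  then show ?case by (metis derives.AllSI finite_subset_image)
next
  case (EqSubst T s t p)
  then obtain F G where "finite F" "F \<subseteq> T" "F \<turnstile> Eq s t" "finite G" "G \<subseteq> T" "G \<turnstile> instN s p"
    by blast
  then show ?case
    by (intro exI[of _ "F \<union> G"]) (auto intro!: derives.EqSubst[of _ s t] elim: derives_mono)
qed (blast intro: derives.intros finite.emptyI)+

lemma derives_cut: "insert q T \<turnstile> p \<Longrightarrow> T \<turnstile> q \<Longrightarrow> T \<turnstile> p"
  using derives.ImpE derives.ImpI by blast

lemma derives_AllN_fresh:
  assumes inst: "T \<turnstile> instN (Var k) p" and fresh: "\<And>q. q \<in> insert (AllN p) T \<Longrightarrow> boundN q \<le> k"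
  shows "T \<turnstile> AllN p"
proof (rule derives.AllNI)
  define f where "f i = (if i = k then Var 0 else Var (Suc i))" for i
  have "subst_fml f (\<lambda>k. k) q = liftN q" if "q \<in> T" for q
    unfolding liftN_def using fresh[of q] that by (intro subst_fml_cong) (auto simp: f_def)
  moreover have "subst_fml f (\<lambda>k. k) (instN (Var k) p) = subst_fml Var (\<lambda>k. k) p"
    unfolding instN_def subst_fml_comp
  proof (rule subst_fml_cong)
    fix i assume "i < boundN p"
    then show "subst_trm f ((Var k ## Var) i) = Var i"
      using fresh[of "AllN p"] by (cases i) (auto simp: f_def)
  qed simp
  ultimately show "liftN ` T \<turnstile> p"
    using derives_subst[OF inst, of f "\<lambda>k. k"] by (simp cong: image_cong)
qed

lemma derives_AllS_fresh:
  assumes inst: "T \<turnstile> instS k p" and fresh: "\<And>q. q \<in> insert (AllS p) T \<Longrightarrow> boundS q \<le> k"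
  shows "T \<turnstile> AllS p"
proof (rule derives.AllSI)
  define g where "g i = (if i = k then 0 else Suc i)" for i
  have "subst_fml Var g q = liftS q" if "q \<in> T" for q
    unfolding liftS_def using fresh[of q] that by (intro subst_fml_cong) (auto simp: g_def)
  moreover have "subst_fml Var g (instS k p) = subst_fml Var (\<lambda>k. k) p"
    unfolding instS_def subst_fml_comp
  proof (rule subst_fml_cong)
    fix i assume "i < boundS p"
    then show "g ((k ## (\<lambda>k. k)) i) = i"
      using fresh[of "AllS p"] by (cases i) (auto simp: g_def)
  qed simp
  ultimately show "liftS ` T \<turnstile> p"
    using derives_subst[OF inst, of Var g] by (simp cong: image_cong)
qed

lemma is_consistent_insert_Neg: "\<not> T \<turnstile> p \<Longrightarrow> is_consistent (insert (Neg p) T)"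
  unfolding is_consistent_def using derives.Contr by blast

lemma is_consistent_UN_chain:
  fixes \<Gamma> :: "nat \<Rightarrow> fml set"
  assumes chain: "\<And>n. \<Gamma> n \<subseteq> \<Gamma> (Suc n)" and con: "\<And>n. is_consistent (\<Gamma> n)"
  shows "is_consistent (\<Union>n. \<Gamma> n)"
  unfolding is_consistent_def
proof
  assume "(\<Union>n. \<Gamma> n) \<turnstile> Fls"
  then obtain F where F: "finite F" "F \<subseteq> (\<Union>n. \<Gamma> n)" "F \<turnstile> Fls" using derives_finite by blast
  have "subset.chain UNIV (range \<Gamma>)"
    unfolding subset_chain_def using lift_Suc_mono_le[of \<Gamma>, OF chain] nat_le_linear by blast
  then obtain n where "F \<subseteq> \<Gamma> n" using finite_subset_Union_chain[OF F(1,2)] by blast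
  then show False using F(3) con derives_mono unfolding is_consistent_def by blast
qed

section \<open>Structures and soundness\<close>

text \<open>A structure consists of the operations fixed in the locale, a domain \<open>D\<close> and a family \<open>S\<close> of
  sets. Only the traces on \<open>D\<close> of the members of \<open>S\<close> matter, so that a substructure can reuse the
  operations and the sets of the larger structure.\<close>

locale arith_structure =
  fixes zero :: 'm (\<open>\<zero>\<close>) and one :: 'm (\<open>\<one>\<close>)
    and add :: "'m \<Rightarrow> 'm \<Rightarrow> 'm" (infixl \<open>\<oplus>\<close> 65)
    and mul :: "'m \<Rightarrow> 'm \<Rightarrow> 'm" (infixl \<open>\<odot>\<close> 70)
    and less :: "'m \<Rightarrow> 'm \<Rightarrow> bool" (infix \<open>\<prec>\<close> 50)
begin

primrec val :: "(nat \<Rightarrow> 'm) \<Rightarrow> trm \<Rightarrow> 'm" where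
  "val e (Var i) = e i"
| "val e Zero = \<zero>"
| "val e One = \<one>"
| "val e (Add s t) = val e s \<oplus> val e t"
| "val e (Mul s t) = val e s \<odot> val e t"

primrec sat :: "'m set \<Rightarrow> 'm set set \<Rightarrow> (nat \<Rightarrow> 'm) \<Rightarrow> (nat \<Rightarrow> 'm set) \<Rightarrow> fml \<Rightarrow> bool" where
  "sat D S e \<sigma> (Eq s t) \<longleftrightarrow> val e s = val e t"
| "sat D S e \<sigma> (Lt s t) \<longleftrightarrow> val e s \<prec> val e t"
| "sat D S e \<sigma> (Mem t k) \<longleftrightarrow> val e t \<in> \<sigma> k"
| "sat D S e \<sigma> Fls \<longleftrightarrow> False"
| "sat D S e \<sigma> (Imp p q) \<longleftrightarrow> (sat D S e \<sigma> p \<longrightarrow> sat D S e \<sigma> q)"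
| "sat D S e \<sigma> (AllN p) \<longleftrightarrow> (\<forall>x\<in>D. sat D S (x ## e) \<sigma> p)"
| "sat D S e \<sigma> (AllS p) \<longleftrightarrow> (\<forall>X\<in>S. sat D S e (X ## \<sigma>) p)"

definition closed_dom :: "'m set \<Rightarrow> bool" where
  "closed_dom D \<longleftrightarrow> \<zero> \<in> D \<and> \<one> \<in> D \<and> (\<forall>x\<in>D. \<forall>y\<in>D. x \<oplus> y \<in> D \<and> x \<odot> y \<in> D)"

definition satisfies ::
  "'m set \<Rightarrow> 'm set set \<Rightarrow> (nat \<Rightarrow> 'm) \<Rightarrow> (nat \<Rightarrow> 'm set) \<Rightarrow> fml set \<Rightarrow> bool" where
  "satisfies D S e \<sigma> T \<longleftrightarrow>
     closed_dom D \<and> range e \<subseteq> D \<and> range \<sigma> \<subseteq> S \<and> (\<forall>p\<in>T. sat D S e \<sigma> p)"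

definition models :: "'m set \<Rightarrow> 'm set set \<Rightarrow> fml set \<Rightarrow> bool" where
  "models D S T \<longleftrightarrow> closed_dom D \<and> S \<noteq> {}
     \<and> (\<forall>p\<in>T. \<forall>e \<sigma>. range e \<subseteq> D \<longrightarrow> range \<sigma> \<subseteq> S \<longrightarrow> sat D S e \<sigma> p)"

lemma val_subst: "val e (subst_trm f t) = val (\<lambda>i. val e (f i)) t"
  by (induction t) auto

lemma val_cons_lift [simp]: "val (x ## e) (lift_trm t) = val e t"
  by (simp add: val_subst)

lemma val_cong: "(\<And>i. i < boundN_trm t \<Longrightarrow> e i = e' i) \<Longrightarrow> val e t = val e' t"
  by (induction t) auto

lemma val_in_dom: "closed_dom D \<Longrightarrow> range e \<subseteq> D \<Longrightarrow> val e t \<in> D"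
  by (induction t) (auto simp: closed_dom_def)

lemma val_cons_trm: "(\<lambda>i. val e ((t ## f) i)) = val e t ## (\<lambda>i. val e (f i))"
  by (auto simp: fun_eq_iff split: nat.split)

lemma sat_cong:
  "(\<And>i. i < boundN p \<Longrightarrow> e i = e' i) \<Longrightarrow> (\<And>k. k < boundS p \<Longrightarrow> \<sigma> k = \<sigma>' k)
   \<Longrightarrow> sat D S e \<sigma> p = sat D S e' \<sigma>' p"
proof (induction p arbitrary: e e' \<sigma> \<sigma>')
  case (AllN p)
  have "sat D S (x ## e) \<sigma> p = sat D S (x ## e') \<sigma>' p" for x
    by (rule AllN.IH) (use AllN.prems in \<open>auto split: nat.split\<close>)
  then show ?case by simp
next
  case (AllS p)
  have "sat D S e (X ## \<sigma>) p = sat D S e' (X ## \<sigma>') p" for X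
    by (rule AllS.IH) (use AllS.prems in \<open>auto split: nat.split\<close>)
  then show ?case by simp
next
  case (Imp p q)
  have "sat D S e \<sigma> p = sat D S e' \<sigma>' p" "sat D S e \<sigma> q = sat D S e' \<sigma>' q"
    by (rule Imp.IH; use Imp.prems in auto)+
  then show ?case by simp
next
  case (Eq s t)
  then show ?case using val_cong[of s e e'] val_cong[of t e e'] by simp
next
  case (Lt s t)
  then show ?case using val_cong[of s e e'] val_cong[of t e e'] by simp
next
  case (Mem t k)
  then show ?case using val_cong[of t e e'] by simp
qed simp

lemma sat_sentence: "is_sentence p \<Longrightarrow> sat D S e \<sigma> p = sat D S e' \<sigma>' p"
  by (rule sat_cong) (simp_all add: is_sentence_def)

lemma sat_subst:
  "sat D S e \<sigma> (subst_fml f g p) = sat D S (\<lambda>i. val e (f i)) (\<lambda>k. \<sigma> (g k)) p"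
proof (induction p arbitrary: e \<sigma> f g)
  case (AllN p)
  then show ?case by (simp add: val_cons_trm)
next
  case (AllS p)
  have "(\<lambda>k. (X ## \<sigma>) ((0 ## (\<lambda>k. Suc (g k))) k)) = X ## (\<lambda>k. \<sigma> (g k))" for X
    by (auto simp: fun_eq_iff split: nat.split)
  then show ?case by (simp add: AllS.IH)
qed (auto simp: val_subst)

lemma sat_instN: "sat D S e \<sigma> (instN t p) = sat D S (val e t ## e) \<sigma> p"
  by (simp add: instN_def sat_subst val_cons_trm)

lemma sat_instS: "sat D S e \<sigma> (instS m p) = sat D S e (\<sigma> m ## \<sigma>) p"
proof -
  have "(\<lambda>k. \<sigma> ((m ## (\<lambda>k. k)) k)) = \<sigma> m ## \<sigma>"
    by (auto simp: fun_eq_iff split: nat.split)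
  then show ?thesis by (simp add: instS_def sat_subst)
qed

lemma sat_liftN: "sat D S (x ## e) \<sigma> (liftN p) = sat D S e \<sigma> p"
  by (simp add: liftN_def sat_subst)

lemma sat_liftS: "sat D S e (X ## \<sigma>) (liftS p) = sat D S e \<sigma> p"
  by (simp add: liftS_def sat_subst)

theorem soundness: "T \<turnstile> p \<Longrightarrow> satisfies D S e \<sigma> T \<Longrightarrow> sat D S e \<sigma> p"
proof (induction arbitrary: e \<sigma> rule: derives.induct)
  case (AllNI T p)
  have "sat D S (x ## e) \<sigma> p" if "x \<in> D" for x
    by (rule AllNI.IH) (use AllNI.prems that in \<open>simp add: satisfies_def sat_liftN\<close>)
  then show ?case by simp
next
  case (AllSI T p)
  have "sat D S e (X ## \<sigma>) p" if "X \<in> S" for X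
    by (rule AllSI.IH) (use AllSI.prems that in \<open>simp add: satisfies_def sat_liftS\<close>)
  then show ?case by simp
next
  case (AllNE T p t)
  then have "sat D S e \<sigma> (AllN p)" by blast
  then show ?case using AllNE.prems val_in_dom by (simp add: sat_instN satisfies_def)
next
  case (AllSE T p m)
  then have "sat D S e \<sigma> (AllS p)" by blast
  moreover have "\<sigma> m \<in> S" using AllSE.prems by (auto simp: satisfies_def)
  ultimately show ?case by (simp add: sat_instS)
next
  case (EqSubst T s t p)
  then have "sat D S e \<sigma> (Eq s t)" "sat D S e \<sigma> (instN s p)" by blast+
  then show ?case by (simp add: sat_instN)
next
  case (Contr p T)
  have "satisfies D S e \<sigma> (insert (Neg p) T)" if "\<not> sat D S e \<sigma> p"
    using Contr.prems that by (simp add: satisfies_def)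
  then show ?case using Contr.IH by auto
next
  case (ImpI p T q)
  have "satisfies D S e \<sigma> (insert p T)" if "sat D S e \<sigma> p"
    using ImpI.prems that by (simp add: satisfies_def)
  then show ?case using ImpI.IH by simp
qed (auto simp: satisfies_def)

corollary is_consistent_if_satisfies: "satisfies D S e \<sigma> T \<Longrightarrow> is_consistent T"
  using soundness[of T Fls] by (auto simp: is_consistent_def)

lemma all_envs_AllN_power:
  "(\<forall>e. range e \<subseteq> D \<longrightarrow> sat D S e \<sigma> ((AllN ^^ n) p)) \<longleftrightarrow> (\<forall>e. range e \<subseteq> D \<longrightarrow> sat D S e \<sigma> p)"
  by (induction n) (simp_all add: all_envs_cons[of D "\<lambda>e. sat D S e \<sigma> _"])

lemma all_envs_AllS_power:
  "(\<forall>\<sigma>. range \<sigma> \<subseteq> S \<longrightarrow> sat D S e \<sigma> ((AllS ^^ n) p)) \<longleftrightarrow> (\<forall>\<sigma>. range \<sigma> \<subseteq> S \<longrightarrow> sat D S e \<sigma> p)"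
  by (induction n) (simp_all add: all_envs_cons[of S "\<lambda>\<sigma>. sat D S e \<sigma> _"])

lemma sat_univ_closure:
  assumes "range e \<subseteq> D" "range \<sigma> \<subseteq> S"
  shows "sat D S e \<sigma> (univ_closure p)
    \<longleftrightarrow> (\<forall>e' \<sigma>'. range e' \<subseteq> D \<longrightarrow> range \<sigma>' \<subseteq> S \<longrightarrow> sat D S e' \<sigma>' p)"
proof -
  have "sat D S e' \<sigma>' (univ_closure p) = sat D S e \<sigma> (univ_closure p)" for e' \<sigma>'
    by (rule sat_sentence[OF is_sentence_univ_closure])
  then have "sat D S e \<sigma> (univ_closure p) \<longleftrightarrow> (\<forall>\<sigma>'. range \<sigma>' \<subseteq> S \<longrightarrow>
      (\<forall>e'. range e' \<subseteq> D \<longrightarrow> sat D S e' \<sigma>' (univ_closure p)))"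
    using assms by blast
  also have "\<dots> \<longleftrightarrow> (\<forall>e'. range e' \<subseteq> D \<longrightarrow>
      (\<forall>\<sigma>'. range \<sigma>' \<subseteq> S \<longrightarrow> sat D S e' \<sigma>' ((AllS ^^ boundS p) p)))"
    unfolding univ_closure_def all_envs_AllN_power by blast
  finally show ?thesis unfolding all_envs_AllS_power by blast
qed

lemma models_univ_closure:
  assumes "models D S T" "univ_closure p \<in> T" "range e \<subseteq> D" "range \<sigma> \<subseteq> S"
  shows "sat D S e \<sigma> p"
  using assms sat_univ_closure[of e D \<sigma> S p] unfolding models_def by blast

lemma satisfies_if_models:
  "models D S T \<Longrightarrow> range e \<subseteq> D \<Longrightarrow> range \<sigma> \<subseteq> S \<Longrightarrow> satisfies D S e \<sigma> T"
  by (simp add: models_def satisfies_def)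

lemma models_if_satisfies:
  assumes "satisfies D S e \<sigma> T" "\<And>p. p \<in> T \<Longrightarrow> is_sentence p"
  shows "models D S T"
proof -
  have "sat D S e' \<sigma>' p" if "p \<in> T" for e' \<sigma>' p
    using assms(1) sat_sentence[OF assms(2)[OF that], of D S e' \<sigma>' e \<sigma>] that
    by (simp add: satisfies_def)
  then show ?thesis using assms(1) by (auto simp: models_def satisfies_def)
qed

lemma models_if_proves_scheme:
  assumes "models D S T" "proves_scheme T T'" shows "models D S T'"
proof -
  have "sat D S e \<sigma> p" if "p \<in> T'" "range e \<subseteq> D" "range \<sigma> \<subseteq> S" for p e \<sigma>
    using soundness[OF _ satisfies_if_models[OF assms(1)]] assms(2) that
    by (simp add: proves_scheme_def)
  then show ?thesis using assms(1) by (simp add: models_def)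
qed

end

section \<open>Completeness\<close>

definition few_free_vars :: "fml set \<Rightarrow> bool" where
  "few_free_vars T \<longleftrightarrow> (\<exists>k. \<forall>p\<in>T. boundN p \<le> k \<and> boundS p \<le> k)"

lemma few_free_vars_insert [simp]: "few_free_vars (insert p T) \<longleftrightarrow> few_free_vars T"
proof
  assume "few_free_vars T"
  then obtain k where "\<forall>q\<in>T. boundN q \<le> k \<and> boundS q \<le> k" by (auto simp: few_free_vars_def)
  then have "\<forall>q\<in>insert p T. boundN q \<le> k + boundN p + boundS p \<and> boundS q \<le> k + boundN p + boundS p"
    by (auto intro: trans_le_add1)
  then show "few_free_vars (insert p T)" unfolding few_free_vars_def by blast
qed (auto simp: few_free_vars_def)

lemma few_free_vars_fresh:
  assumes "few_free_vars T" obtains k where "\<And>p. p \<in> T \<Longrightarrow> boundN p \<le> k" "\<And>p. p \<in> T \<Longrightarrow> boundS p \<le> k"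
  using assms unfolding few_free_vars_def by blast

definition decides :: "fml set \<Rightarrow> fml \<Rightarrow> bool" where
  "decides H p \<longleftrightarrow> p \<in> H \<or> Neg p \<in> H
     \<and> (\<forall>q. p = AllN q \<longrightarrow> (\<exists>t. Neg (instN t q) \<in> H)) \<and> (\<forall>q. p = AllS q \<longrightarrow> (\<exists>k. Neg (instS k q) \<in> H))"

lemma decides_mono: "decides H p \<Longrightarrow> H \<subseteq> H' \<Longrightarrow> decides H' p"
  unfolding decides_def by blast

lemma extend_to_decide:
  assumes con: "is_consistent H" and few: "few_free_vars H"
  shows "\<exists>H'. H \<subseteq> H' \<and> is_consistent H' \<and> few_free_vars H' \<and> decides H' p"
proof (cases "is_consistent (insert p H)")
  case True
  then show ?thesis using few by (intro exI[of _ "insert p H"]) (auto simp: decides_def)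
next
  case False
  define G where "G = insert (Neg p) H"
  have "H \<turnstile> Neg p" using False by (auto simp: is_consistent_def intro: derives.ImpI)
  then have G: "is_consistent G"
    using con derives_cut unfolding is_consistent_def G_def by blast
  then have not_p: "\<not> G \<turnstile> p"
    using derives.ImpE[OF derives.Assm, of p Fls G] by (auto simp: is_consistent_def G_def)
  have "few_free_vars (insert p G)" using few by (simp add: G_def)
  then obtain k where k: "\<And>q. q \<in> insert p G \<Longrightarrow> boundN q \<le> k" "\<And>q. q \<in> insert p G \<Longrightarrow> boundS q \<le> k"
    using few_free_vars_fresh by blast
  have extend: ?thesis if "\<not> G \<turnstile> r" "decides (insert (Neg r) G) p" for r
    using is_consistent_insert_Neg[OF that(1)] that(2) few
    by (intro exI[of _ "insert (Neg r) G"]) (auto simp: G_def)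
  show ?thesis
  proof (cases p)
    case (AllN q)
    have "\<not> G \<turnstile> instN (Var k) q" using not_p derives_AllN_fresh[of G k q] k(1) AllN by blast
    then show ?thesis by (rule extend) (auto simp: decides_def G_def AllN)
  next
    case (AllS q)
    have "\<not> G \<turnstile> instS k q" using not_p derives_AllS_fresh[of G k q] k(2) AllS by blast
    then show ?thesis by (rule extend) (auto simp: decides_def G_def AllS)
  qed (rule extend[OF not_p], simp add: decides_def G_def)+
qed

locale henkin_set =
  fixes H :: "fml set"
  assumes consistent: "is_consistent H" and decides: "decides H p"

lemma henkin_set_exists:
  assumes "is_consistent T" "few_free_vars T"
  obtains H where "T \<subseteq> H" "henkin_set H"
proof -
  let ?P = "\<lambda>H. T \<subseteq> H \<and> is_consistent H \<and> few_free_vars H"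
  have "\<exists>f. \<forall>n. ?P (f n) \<and> (f n \<subseteq> f (Suc n) \<and> decides (f (Suc n)) (from_nat n))"
  proof (rule dependent_nat_choice)
    fix H :: "fml set" and n :: nat assume "?P H"
    then show "\<exists>H'. ?P H' \<and> (H \<subseteq> H' \<and> decides H' (from_nat n))"
      using extend_to_decide[of H "from_nat n"] by (metis subset_trans)
  qed (use assms in blast)
  then obtain f where f: "\<And>n. ?P (f n)" "\<And>n. f n \<subseteq> f (Suc n)" "\<And>n. decides (f (Suc n)) (from_nat n)"
    by blast
  show ?thesis
  proof (rule that[of "\<Union>n. f n"])
    show "henkin_set (\<Union>n. f n)"
    proof
      show "is_consistent (\<Union>n. f n)" using f by (intro is_consistent_UN_chain) auto
      show "decides (\<Union>n. f n) p" for p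
        using decides_mono[OF f(3)[of "to_nat p"], of "\<Union>n. f n"] by auto
    qed
  qed (use f(1) in blast)
qed

context henkin_set
begin

lemma derives_iff: "H \<turnstile> p \<longleftrightarrow> p \<in> H"
proof
  assume "H \<turnstile> p"
  then show "p \<in> H"
    using decides[of p] consistent derives.Assm derives.ImpE
    unfolding decides_def is_consistent_def by blast
qed (rule derives.Assm)

lemma Fls_notin: "Fls \<notin> H"
  using consistent derives_iff by (simp add: is_consistent_def)

lemma Imp_iff: "Imp p q \<in> H \<longleftrightarrow> (p \<in> H \<longrightarrow> q \<in> H)"
proof
  show "p \<in> H \<longrightarrow> q \<in> H" if "Imp p q \<in> H" using that derives.ImpE derives_iff by metis
next
  assume imp: "p \<in> H \<longrightarrow> q \<in> H"
  have "insert p H \<turnstile> q"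
  proof (cases "p \<in> H")
    case True
    then show ?thesis using imp by (intro derives.Assm) simp
  next
    case False
    then have "insert (Neg q) (insert p H) \<turnstile> Fls"
      using decides[of p] by (intro derives.ImpE[of _ p Fls] derives.Assm) (auto simp: decides_def)
    then show ?thesis by (rule derives.Contr)
  qed
  then show "Imp p q \<in> H" using derives.ImpI derives_iff by blast
qed

lemma AllN_iff: "AllN p \<in> H \<longleftrightarrow> (\<forall>t. instN t p \<in> H)"
proof
  show "\<forall>t. instN t p \<in> H" if "AllN p \<in> H" using that derives.AllNE derives_iff by metis
  show "AllN p \<in> H" if "\<forall>t. instN t p \<in> H"
    using that decides[of "AllN p"] Imp_iff Fls_notin unfolding decides_def by blast
qed

lemma AllS_iff: "AllS p \<in> H \<longleftrightarrow> (\<forall>k. instS k p \<in> H)"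
proof
  show "\<forall>k. instS k p \<in> H" if "AllS p \<in> H" using that derives.AllSE derives_iff by metis
  show "AllS p \<in> H" if "\<forall>k. instS k p \<in> H"
    using that decides[of "AllS p"] Imp_iff Fls_notin unfolding decides_def by blast
qed

lemma Eq_refl: "Eq t t \<in> H"
  using derives.EqRefl derives_iff by blast

lemma Eq_instN: "Eq s t \<in> H \<Longrightarrow> instN s p \<in> H \<Longrightarrow> instN t p \<in> H"
  using derives.EqSubst derives_iff by metis

lemma Eq_sym: "Eq s t \<in> H \<Longrightarrow> Eq t s \<in> H"
  using Eq_instN[of s t "Eq (Var 0) (lift_trm s)"] Eq_refl by (simp add: instN_def)

lemma Eq_trans: "Eq s t \<in> H \<Longrightarrow> Eq t u \<in> H \<Longrightarrow> Eq s u \<in> H"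
  using Eq_instN[of t u "Eq (lift_trm s) (Var 0)"] by (simp add: instN_def)

lemma Eq_Add:
  assumes "Eq s s' \<in> H" "Eq t t' \<in> H" shows "Eq (Add s t) (Add s' t') \<in> H"
  using Eq_instN[OF assms(1), of "Eq (lift_trm (Add s t)) (Add (Var 0) (lift_trm t))"]
    Eq_instN[OF assms(2), of "Eq (lift_trm (Add s t)) (Add (lift_trm s') (Var 0))"]
  by (simp add: instN_def Eq_refl)

lemma Eq_Mul:
  assumes "Eq s s' \<in> H" "Eq t t' \<in> H" shows "Eq (Mul s t) (Mul s' t') \<in> H"
  using Eq_instN[OF assms(1), of "Eq (lift_trm (Mul s t)) (Mul (Var 0) (lift_trm t))"]
    Eq_instN[OF assms(2), of "Eq (lift_trm (Mul s t)) (Mul (lift_trm s') (Var 0))"]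
  by (simp add: instN_def Eq_refl)

lemma Lt_cong:
  assumes "Eq s s' \<in> H" "Eq t t' \<in> H" shows "Lt s t \<in> H \<longleftrightarrow> Lt s' t' \<in> H"
proof -
  have "Lt s t \<in> H \<Longrightarrow> Lt s' t' \<in> H" if "Eq s s' \<in> H" "Eq t t' \<in> H" for s s' t t'
    using Eq_instN[OF that(1), of "Lt (Var 0) (lift_trm t)"]
      Eq_instN[OF that(2), of "Lt (lift_trm s') (Var 0)"] by (simp add: instN_def)
  then show ?thesis using assms Eq_sym by blast
qed

lemma Mem_cong: "Eq s t \<in> H \<Longrightarrow> Mem s k \<in> H \<Longrightarrow> Mem t k \<in> H"
  using Eq_instN[of s t "Mem (Var 0) k"] by (simp add: instN_def)

definition representative :: "trm \<Rightarrow> trm" where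
  "representative t = (SOME s. Eq t s \<in> H)"

lemma Eq_representative: "Eq t (representative t) \<in> H"
  unfolding representative_def by (rule someI) (rule Eq_refl)

lemma representative_eq_iff: "representative s = representative t \<longleftrightarrow> Eq s t \<in> H"
proof
  show "Eq s t \<in> H" if "representative s = representative t"
    using that Eq_representative[of s] Eq_representative[of t] by (metis Eq_sym Eq_trans)
next
  assume "Eq s t \<in> H"
  then have "Eq s u \<in> H \<longleftrightarrow> Eq t u \<in> H" for u by (metis Eq_sym Eq_trans)
  then show "representative s = representative t" by (simp add: representative_def)
qed

abbreviation term_set :: "nat \<Rightarrow> trm set" where
  "term_set k \<equiv> {representative t |t. Mem t k \<in> H}"

sublocale term_model: arith_structure "representative Zero" "representative One"
  "\<lambda>s t. representative (Add s t)" "\<lambda>s t. representative (Mul s t)" "\<lambda>s t. Lt s t \<in> H" .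

lemma term_model_val: "term_model.val (\<lambda>i. representative (Var i)) t = representative t"
  by (induction t)
    (simp_all add: representative_eq_iff Eq_Add Eq_Mul Eq_sym[OF Eq_representative])

lemma term_model_sat:
  "term_model.sat (range representative) (range term_set) (\<lambda>i. representative (Var i)) term_set p
    \<longleftrightarrow> p \<in> H"
  (is "term_model.sat ?D ?S ?e ?\<sigma> p \<longleftrightarrow> _")
proof (induction p rule: measure_induct_rule[where f = size])
  case (less p)
  show ?case
  proof (cases p)
    case (Lt s t)
    then show ?thesis
      using Lt_cong[OF Eq_representative Eq_representative, of s t] by (simp add: term_model_val)
  next
    case (Mem t k)
    have "(\<exists>s. Eq t s \<in> H \<and> Mem s k \<in> H) \<longleftrightarrow> Mem t k \<in> H"
      using Mem_cong Eq_sym Eq_refl by metis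
    then show ?thesis by (simp add: Mem term_model_val representative_eq_iff)
  next
    case (Imp q r)
    then show ?thesis using less[of q] less[of r] by (simp add: Imp_iff)
  next
    case (AllN q)
    have "term_model.sat ?D ?S (representative t ## ?e) ?\<sigma> q \<longleftrightarrow> instN t q \<in> H" for t
      using less[of "instN t q"] AllN
      by (simp add: term_model.sat_instN term_model_val) (simp add: instN_def size_subst_fml)
    then show ?thesis using AllN by (simp add: AllN_iff)
  next
    case (AllS q)
    have "term_model.sat ?D ?S ?e (term_set k ## ?\<sigma>) q \<longleftrightarrow> instS k q \<in> H" for k
      using less[of "instS k q"] AllS
      by (simp add: term_model.sat_instS) (simp add: instS_def size_subst_fml)
    then show ?thesis using AllS by (simp add: AllS_iff)
  qed (simp_all add: term_model_val representative_eq_iff Fls_notin)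
qed

end

theorem completeness:
  assumes "is_consistent T" "few_free_vars T"
  obtains z :: trm and u a m l D S e \<sigma> where "arith_structure.satisfies z u a m l D S e \<sigma> T"
proof -
  obtain H where H: "T \<subseteq> H" "henkin_set H" using henkin_set_exists assms by blast
  interpret henkin_set H by (rule H(2))
  have "term_model.closed_dom (range representative)" by (simp add: term_model.closed_dom_def)
  then have "term_model.satisfies (range representative) (range term_set)
      (\<lambda>i. representative (Var i)) term_set T"
    using H(1) term_model_sat by (auto simp: term_model.satisfies_def)
  then show ?thesis by (rule that)
qed

section \<open>Definability\<close>

lemmas is_Delta00_induct [consumes 1, case_names Eq Lt Mem Fls Imp BAll BEx] = is_Delta00.induct

lemma subst_BAll: "subst_fml f g (BAll t p)
    = BAll (subst_trm f t) (subst_fml (Var 0 ## (\<lambda>i. lift_trm (f i))) g p)"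
  and subst_BEx: "subst_fml f g (BEx t p)
    = BEx (subst_trm f t) (subst_fml (Var 0 ## (\<lambda>i. lift_trm (f i))) g p)"
  by (simp_all add: subst_trm_comp)

lemma is_Delta00_subst: "is_Delta00 p \<Longrightarrow> is_Delta00 (subst_fml f g p)"
proof (induction arbitrary: f g rule: is_Delta00_induct)
  case (BAll p t)
  then show ?case unfolding subst_BAll by (intro is_Delta00.intros)
next
  case (BEx p t)
  then show ?case unfolding subst_BEx by (intro is_Delta00.intros)
qed (auto intro: is_Delta00.intros)

lemma is_Sigma0_subst: "is_Sigma0 k p \<Longrightarrow> is_Sigma0 k (subst_fml f g p)"
  and is_Pi0_subst: "is_Pi0 k p \<Longrightarrow> is_Pi0 k (subst_fml f g p)"
  by (induction k p and k p arbitrary: f g and f g rule: is_Sigma0_is_Pi0.inducts)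
    (auto intro: is_Sigma0_is_Pi0.intros is_Delta00_subst)

lemma is_Sigma0_0_iff [simp]: "is_Sigma0 0 p \<longleftrightarrow> is_Delta00 p"
  by (auto elim: is_Sigma0.cases intro: is_Sigma0_is_Pi0.intros)

lemma is_Pi0_0_iff [simp]: "is_Pi0 0 p \<longleftrightarrow> is_Delta00 p"
  by (auto elim: is_Pi0.cases intro: is_Sigma0_is_Pi0.intros)

lemma is_Sigma0_Suc_iff: "is_Sigma0 (Suc k) p \<longleftrightarrow> (\<exists>q. p = ExN q \<and> is_Pi0 k q)"
  by (auto elim: is_Sigma0.cases intro: is_Sigma0_is_Pi0.intros)

lemma is_Pi0_Suc_iff: "is_Pi0 (Suc k) p \<longleftrightarrow> (\<exists>q. p = AllN q \<and> is_Sigma0 k q)"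
  by (auto elim: is_Pi0.cases intro: is_Sigma0_is_Pi0.intros)

context arith_structure
begin

inductive term_fun :: "'m set \<Rightarrow> ((nat \<Rightarrow> 'm) \<Rightarrow> 'm) \<Rightarrow> bool" for C where
  term_fun_var: "term_fun C (\<lambda>e. e i)"
| term_fun_zero: "term_fun C (\<lambda>e. \<zero>)"
| term_fun_one: "term_fun C (\<lambda>e. \<one>)"
| term_fun_add: "term_fun C s \<Longrightarrow> term_fun C t \<Longrightarrow> term_fun C (\<lambda>e. s e \<oplus> t e)"
| term_fun_mul: "term_fun C s \<Longrightarrow> term_fun C t \<Longrightarrow> term_fun C (\<lambda>e. s e \<odot> t e)"
| term_fun_const: "a \<in> C \<Longrightarrow> term_fun C (\<lambda>e. a)"

text \<open>\<open>Delta0 D C U P\<close>: the predicate \<open>P\<close> on environments is defined over the domain \<open>D\<close> by a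
  \<open>\<Delta>\<^sup>0\<^sub>0\<close> formula with number parameters from \<open>C\<close> and set parameters from \<open>U\<close>.\<close>

inductive Delta0 :: "'m set \<Rightarrow> 'm set \<Rightarrow> 'm set set \<Rightarrow> ((nat \<Rightarrow> 'm) \<Rightarrow> bool) \<Rightarrow> bool" for D C U where
  Delta0_eq: "term_fun C s \<Longrightarrow> term_fun C t \<Longrightarrow> Delta0 D C U (\<lambda>e. s e = t e)"
| Delta0_less: "term_fun C s \<Longrightarrow> term_fun C t \<Longrightarrow> Delta0 D C U (\<lambda>e. s e \<prec> t e)"
| Delta0_mem: "term_fun C t \<Longrightarrow> X \<in> U \<Longrightarrow> Delta0 D C U (\<lambda>e. t e \<in> X)"
| Delta0_False: "Delta0 D C U (\<lambda>e. False)"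
| Delta0_imp: "Delta0 D C U P \<Longrightarrow> Delta0 D C U Q \<Longrightarrow> Delta0 D C U (\<lambda>e. P e \<longrightarrow> Q e)"
| Delta0_ball_env:
    "term_fun C t \<Longrightarrow> Delta0 D C U P \<Longrightarrow> Delta0 D C U (\<lambda>e. \<forall>y\<in>D. y \<prec> t e \<longrightarrow> P (y ## e))"

definition Sigma1 :: "'m set \<Rightarrow> 'm set \<Rightarrow> 'm set set \<Rightarrow> ((nat \<Rightarrow> 'm) \<Rightarrow> bool) \<Rightarrow> bool" where
  "Sigma1 D C U P \<longleftrightarrow>
     (\<exists>Q. Delta0 D C U Q \<and> (\<forall>e. range e \<subseteq> D \<longrightarrow> P e \<longleftrightarrow> (\<exists>z\<in>D. Q (z ## e))))"

definition Pi1 :: "'m set \<Rightarrow> 'm set \<Rightarrow> 'm set set \<Rightarrow> ((nat \<Rightarrow> 'm) \<Rightarrow> bool) \<Rightarrow> bool" where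
  "Pi1 D C U P \<longleftrightarrow> Sigma1 D C U (\<lambda>e. \<not> P e)"

definition Sigma2 :: "'m set \<Rightarrow> 'm set \<Rightarrow> 'm set set \<Rightarrow> ((nat \<Rightarrow> 'm) \<Rightarrow> bool) \<Rightarrow> bool" where
  "Sigma2 D C U P \<longleftrightarrow>
     (\<exists>Q. Pi1 D C U Q \<and> (\<forall>e. range e \<subseteq> D \<longrightarrow> P e \<longleftrightarrow> (\<exists>z\<in>D. Q (z ## e))))"

lemma Sigma1I:
  "Delta0 D C U Q \<Longrightarrow> (\<And>e. range e \<subseteq> D \<Longrightarrow> P e \<longleftrightarrow> (\<exists>z\<in>D. Q (z ## e))) \<Longrightarrow> Sigma1 D C U P"
  unfolding Sigma1_def by blast

lemma Sigma2I:
  "Pi1 D C U Q \<Longrightarrow> (\<And>e. range e \<subseteq> D \<Longrightarrow> P e \<longleftrightarrow> (\<exists>z\<in>D. Q (z ## e))) \<Longrightarrow> Sigma2 D C U P"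
  unfolding Sigma2_def by blast

lemma Sigma1E:
  assumes "Sigma1 D C U P"
  obtains Q where "Delta0 D C U Q" "\<And>e. range e \<subseteq> D \<Longrightarrow> P e \<longleftrightarrow> (\<exists>z\<in>D. Q (z ## e))"
  using assms unfolding Sigma1_def by blast

lemma Pi1E:
  assumes "Pi1 D C U P"
  obtains Q where "Delta0 D C U Q" "\<And>e. range e \<subseteq> D \<Longrightarrow> P e \<longleftrightarrow> (\<forall>z\<in>D. \<not> Q (z ## e))"
  using assms unfolding Pi1_def by (elim Sigma1E) blast

lemma Sigma2E:
  assumes "Sigma2 D C U P"
  obtains Q where "Pi1 D C U Q" "\<And>e. range e \<subseteq> D \<Longrightarrow> P e \<longleftrightarrow> (\<exists>z\<in>D. Q (z ## e))"
  using assms unfolding Sigma2_def by blast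

lemma Sigma1_cong: "Sigma1 D C U P \<Longrightarrow> (\<And>e. range e \<subseteq> D \<Longrightarrow> P e \<longleftrightarrow> P' e) \<Longrightarrow> Sigma1 D C U P'"
  unfolding Sigma1_def by (metis (no_types, lifting))

lemma Pi1_cong: "Pi1 D C U P \<Longrightarrow> (\<And>e. range e \<subseteq> D \<Longrightarrow> P e \<longleftrightarrow> P' e) \<Longrightarrow> Pi1 D C U P'"
  unfolding Pi1_def by (erule Sigma1_cong) simp

subsection \<open>Substitution of terms\<close>

lemma term_fun_in_dom: "term_fun C t \<Longrightarrow> closed_dom D \<Longrightarrow> C \<subseteq> D \<Longrightarrow> range e \<subseteq> D \<Longrightarrow> t e \<in> D"
  by (induction rule: term_fun.induct) (auto simp: closed_dom_def)

lemma term_fun_subst: "term_fun C t \<Longrightarrow> (\<And>i. term_fun C (\<lambda>e. g e i)) \<Longrightarrow> term_fun C (\<lambda>e. t (g e))"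
  by (induction rule: term_fun.induct) (auto intro: term_fun.intros)

lemma term_fun_shift: "term_fun C s \<Longrightarrow> term_fun C (\<lambda>e. s (\<lambda>i. e (Suc i)))"
  by (rule term_fun_subst[where g = "\<lambda>e i. e (Suc i)"]) (simp_all add: term_fun_var)

lemma term_fun_cons:
  "term_fun C s \<Longrightarrow> (\<And>i. term_fun C (\<lambda>e. g e i)) \<Longrightarrow> term_fun C (\<lambda>e. (s e ## g e) i)"
  by (cases i) simp_all

lemma term_fun_join:
  "(\<And>i. term_fun C (\<lambda>e. f e i)) \<Longrightarrow> (\<And>i. term_fun C (\<lambda>e. g e i))
   \<Longrightarrow> term_fun C (\<lambda>e. join (f e) (g e) i)"
  unfolding join_def by (cases "sum_decode i") simp_all

lemma term_fun_val: "(\<And>i. term_fun C (\<lambda>e. g e i)) \<Longrightarrow> term_fun C (\<lambda>e. val (g e) t)"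
  by (induction t) (auto intro: term_fun.intros)

lemma term_fun_mono: "term_fun C t \<Longrightarrow> C \<subseteq> C' \<Longrightarrow> term_fun C' t"
  by (induction rule: term_fun.induct) (auto intro: term_fun.intros)

lemma Delta0_mono: "Delta0 D C U P \<Longrightarrow> C \<subseteq> C' \<Longrightarrow> U \<subseteq> U' \<Longrightarrow> Delta0 D C' U' P"
  by (induction rule: Delta0.induct) (auto intro: Delta0.intros term_fun_mono)

lemma Sigma1_mono: "Sigma1 D C U P \<Longrightarrow> C \<subseteq> C' \<Longrightarrow> U \<subseteq> U' \<Longrightarrow> Sigma1 D C' U' P"
  unfolding Sigma1_def using Delta0_mono by blast

lemma Pi1_mono: "Pi1 D C U P \<Longrightarrow> C \<subseteq> C' \<Longrightarrow> U \<subseteq> U' \<Longrightarrow> Pi1 D C' U' P"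
  unfolding Pi1_def by (rule Sigma1_mono)

lemma Delta0_subst:
  "Delta0 D C U P \<Longrightarrow> (\<And>i. term_fun C (\<lambda>e. g e i)) \<Longrightarrow> Delta0 D C U (\<lambda>e. P (g e))"
proof (induction arbitrary: g rule: Delta0.induct)
  case (Delta0_ball_env t P)
  have "Delta0 D C U (\<lambda>e. P (e 0 ## g (\<lambda>j. e (Suc j))))"
    by (rule Delta0_ball_env.IH)
      (intro term_fun_cons term_fun_var term_fun_shift[OF Delta0_ball_env.prems])
  from Delta0.Delta0_ball_env
    [OF term_fun_subst[OF Delta0_ball_env.hyps(1) Delta0_ball_env.prems] this]
  show ?case by simp
next
  case (Delta0_imp P Q)
  show ?case by (rule Delta0.Delta0_imp[OF Delta0_imp.IH]) (rule Delta0_imp.prems)+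
qed (simp_all add: Delta0.Delta0_eq Delta0.Delta0_less Delta0.Delta0_mem Delta0.Delta0_False
    term_fun_subst)

lemma Sigma1_subst:
  assumes P: "Sigma1 D C U P" and g: "\<And>i. term_fun C (\<lambda>e. g e i)" and D: "closed_dom D" "C \<subseteq> D"
  shows "Sigma1 D C U (\<lambda>e. P (g e))"
proof -
  obtain Q where Q: "Delta0 D C U Q" "\<And>e. range e \<subseteq> D \<Longrightarrow> P e \<longleftrightarrow> (\<exists>z\<in>D. Q (z ## e))"
    using P by (rule Sigma1E) blast
  have "Delta0 D C U (\<lambda>e. Q (e 0 ## g (\<lambda>i. e (Suc i))))"
    by (intro Delta0_subst[OF Q(1)] term_fun_cons term_fun_var term_fun_shift[OF g])
  moreover have "range (g e) \<subseteq> D" if "range e \<subseteq> D" for e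
    using term_fun_in_dom[OF g D that] by blast
  ultimately show ?thesis
    using Q(2) by (intro Sigma1I[where Q = "\<lambda>e. Q (e 0 ## g (\<lambda>i. e (Suc i)))"]) simp_all
qed

lemma Pi1_subst:
  "Pi1 D C U P \<Longrightarrow> (\<And>i. term_fun C (\<lambda>e. g e i)) \<Longrightarrow> closed_dom D \<Longrightarrow> C \<subseteq> D
   \<Longrightarrow> Pi1 D C U (\<lambda>e. P (g e))"
  unfolding Pi1_def by (rule Sigma1_subst)

lemma Pi1_comp3:
  assumes "Pi1 D C U (\<lambda>e. P (e 0) (e 1) (e 2))" "term_fun C s" "term_fun C t" "term_fun C u"
    "closed_dom D" "C \<subseteq> D"
  shows "Pi1 D C U (\<lambda>e. P (s e) (t e) (u e))"
  using Pi1_subst[OF assms(1) _ assms(5,6), of "\<lambda>e. s e ## t e ## (\<lambda>_. u e)"] assms(2-4)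
  by (simp add: term_fun_cons numeral_2_eq_2)

lemma Sigma2_subst:
  assumes P: "Sigma2 D C U P" and g: "\<And>i. term_fun C (\<lambda>e. g e i)" and D: "closed_dom D" "C \<subseteq> D"
  shows "Sigma2 D C U (\<lambda>e. P (g e))"
proof -
  obtain Q where Q: "Pi1 D C U Q" "\<And>e. range e \<subseteq> D \<Longrightarrow> P e \<longleftrightarrow> (\<exists>z\<in>D. Q (z ## e))"
    using P by (rule Sigma2E) blast
  have "Pi1 D C U (\<lambda>e. Q (e 0 ## g (\<lambda>i. e (Suc i))))"
    by (intro Pi1_subst[OF Q(1)] D term_fun_cons term_fun_var term_fun_shift[OF g])
  moreover have "range (g e) \<subseteq> D" if "range e \<subseteq> D" for e
    using term_fun_in_dom[OF g D that] by blast
  ultimately show ?thesis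
    using Q(2) by (intro Sigma2I[where Q = "\<lambda>e. Q (e 0 ## g (\<lambda>i. e (Suc i)))"]) simp_all
qed

lemma Sigma1_comp1:
  assumes "Sigma1 D C U (\<lambda>e. P (e 0))" "term_fun C s" "closed_dom D" "C \<subseteq> D"
  shows "Sigma1 D C U (\<lambda>e. P (s e))"
  using Sigma1_subst[OF assms(1) _ assms(3,4), of "\<lambda>e _. s e"] assms(2) by simp

lemma Delta0_comp3:
  assumes "Delta0 D C U (\<lambda>e. P (e 0) (e 1) (e 2))" "term_fun C s" "term_fun C t" "term_fun C u"
  shows "Delta0 D C U (\<lambda>e. P (s e) (t e) (u e))"
  using Delta0_subst[OF assms(1), where g = "\<lambda>e. s e ## t e ## (\<lambda>_. u e)"] assms(2-4)
  by (simp add: term_fun_cons numeral_2_eq_2)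

lemma Delta0_comp2:
  "Delta0 D C U (\<lambda>e. P (e 0) (e 1)) \<Longrightarrow> term_fun C s \<Longrightarrow> term_fun C t
   \<Longrightarrow> Delta0 D C U (\<lambda>e. P (s e) (t e))"
  using Delta0_comp3[where P = "\<lambda>x y _. P x y"] by blast

subsection \<open>Closure properties of bounded predicates\<close>

lemma Delta0_not: "Delta0 D C U P \<Longrightarrow> Delta0 D C U (\<lambda>e. \<not> P e)"
  using Delta0_imp[OF _ Delta0_False] by fastforce

lemma Delta0_conj: "Delta0 D C U P \<Longrightarrow> Delta0 D C U Q \<Longrightarrow> Delta0 D C U (\<lambda>e. P e \<and> Q e)"
  using Delta0_not[OF Delta0_imp[OF _ Delta0_not]] by fastforce

lemma Delta0_disj: "Delta0 D C U P \<Longrightarrow> Delta0 D C U Q \<Longrightarrow> Delta0 D C U (\<lambda>e. P e \<or> Q e)"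
  unfolding disj_imp by (intro Delta0_imp Delta0_not)

lemma Delta0_iff: "Delta0 D C U P \<Longrightarrow> Delta0 D C U Q \<Longrightarrow> Delta0 D C U (\<lambda>e. P e \<longleftrightarrow> Q e)"
  unfolding iff_conv_conj_imp by (intro Delta0_conj Delta0_imp)

lemma Delta0_ball:
  assumes "term_fun C t" "Delta0 D C U (\<lambda>e. P (e 0) (\<lambda>i. e (Suc i)))"
  shows "Delta0 D C U (\<lambda>e. \<forall>y\<in>D. y \<prec> t e \<longrightarrow> P y e)"
  using Delta0_ball_env[OF assms] by simp

lemma Delta0_bex:
  assumes "term_fun C t" "Delta0 D C U (\<lambda>e. P (e 0) (\<lambda>i. e (Suc i)))"
  shows "Delta0 D C U (\<lambda>e. \<exists>y\<in>D. y \<prec> t e \<and> P y e)"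
proof -
  have "Delta0 D C U (\<lambda>e. \<not> (\<forall>y\<in>D. y \<prec> t e \<longrightarrow> \<not> P y e))"
    by (intro Delta0_not Delta0_ball assms)
  then show ?thesis by (simp add: Bex_def Ball_def)
qed

lemma Delta0_finite_bex:
  "finite F \<Longrightarrow> (\<And>p. p \<in> F \<Longrightarrow> Delta0 D C U (P p)) \<Longrightarrow> Delta0 D C U (\<lambda>e. \<exists>p\<in>F. P p e)"
proof (induction F rule: finite_induct)
  case (insert q F)
  then have "Delta0 D C U (\<lambda>e. P q e \<or> (\<exists>p\<in>F. P p e))" by (intro Delta0_disj) auto
  then show ?case by simp
qed (simp add: Delta0_False)

lemmas Delta0_intros = Delta0_eq Delta0_less Delta0_mem Delta0_False Delta0_not Delta0_conj
  Delta0_disj Delta0_iff Delta0_imp Delta0_ball Delta0_bex term_fun.intros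

lemma Delta0_sat: "is_Delta00 p \<Longrightarrow> range \<sigma> \<subseteq> U \<Longrightarrow> Delta0 D C U (\<lambda>e. sat D S e \<sigma> p)"
proof (induction rule: is_Delta00_induct)
  case (BAll p t)
  have "Delta0 D C U (\<lambda>e. \<forall>y\<in>D. y \<prec> val e t \<longrightarrow> sat D S (y ## e) \<sigma> p)"
    by (rule Delta0_ball_env) (use BAll in \<open>auto intro: term_fun_val term_fun_var\<close>)
  then show ?case by simp
next
  case (BEx p t)
  have "Delta0 D C U (\<lambda>e. \<exists>y\<in>D. y \<prec> val e t \<and> sat D S (y ## e) \<sigma> p)"
    by (rule Delta0_bex) (use BEx in \<open>auto intro: term_fun_val term_fun_var\<close>)
  then show ?case by simp
next
  case (Mem t k)
  then have "\<sigma> k \<in> U" by auto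
  then show ?case by (simp add: Delta0_mem term_fun_val term_fun_var)
qed (simp_all add: Delta0_eq Delta0_less Delta0_False Delta0_imp term_fun_val term_fun_var)

lemma Sigma1_sat:
  assumes "is_Sigma0 1 p" "range \<sigma> \<subseteq> U" shows "Sigma1 D C U (\<lambda>e. sat D S e \<sigma> p)"
proof -
  obtain q where "p = ExN q" "is_Delta00 q" using assms(1) by (auto simp: is_Sigma0_Suc_iff)
  then show ?thesis using Sigma1I[OF Delta0_sat[of q \<sigma> U D C S]] assms(2) by simp
qed

lemma Pi1_sat:
  assumes "is_Pi0 1 p" "range \<sigma> \<subseteq> U" shows "Pi1 D C U (\<lambda>e. sat D S e \<sigma> p)"
proof -
  obtain q where "p = AllN q" "is_Delta00 q" using assms(1) by (auto simp: is_Pi0_Suc_iff)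
  then show ?thesis
    using Sigma1I[OF Delta0_not[OF Delta0_sat[of q \<sigma> U D C S]]] assms(2) by (simp add: Pi1_def)
qed

lemma Sigma2_sat:
  assumes "is_Sigma0 2 p" "range \<sigma> \<subseteq> U" shows "Sigma2 D C U (\<lambda>e. sat D S e \<sigma> p)"
proof -
  obtain q where "p = ExN q" "is_Pi0 1 q"
    using assms(1) by (auto simp: is_Sigma0_Suc_iff numeral_2_eq_2)
  then show ?thesis using Sigma2I[OF Pi1_sat[of q \<sigma> U D C S]] assms(2) by simp
qed

subsection \<open>Representation by formulas\<close>

definition definable ::
  "(fml \<Rightarrow> bool) \<Rightarrow> 'm set \<Rightarrow> 'm set set \<Rightarrow> 'm set \<Rightarrow> 'm set set \<Rightarrow> ((nat \<Rightarrow> 'm) \<Rightarrow> bool) \<Rightarrow> bool"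
where
  "definable \<Phi> D S C U P \<longleftrightarrow> (\<exists>p \<rho> \<sigma>. \<Phi> p \<and> range \<rho> \<subseteq> C \<and> range \<sigma> \<subseteq> U
     \<and> (\<forall>e. range e \<subseteq> D \<longrightarrow> P e = sat D S (join e \<rho>) \<sigma> p))"

lemma definableI:
  "\<Phi> p \<Longrightarrow> range \<rho> \<subseteq> C \<Longrightarrow> range \<sigma> \<subseteq> U
   \<Longrightarrow> (\<And>e. range e \<subseteq> D \<Longrightarrow> P e = sat D S (join e \<rho>) \<sigma> p) \<Longrightarrow> definable \<Phi> D S C U P"
  unfolding definable_def by blast

lemma definableE:
  assumes "definable \<Phi> D S C U P"
  obtains p \<rho> \<sigma> where "\<Phi> p" "range \<rho> \<subseteq> C" "range \<sigma> \<subseteq> U"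
    "\<And>e. range e \<subseteq> D \<Longrightarrow> P e = sat D S (join e \<rho>) \<sigma> p"
  using assms unfolding definable_def by (elim exE conjE) (rule that, auto)

text \<open>Two formulas with separate parameters are given common parameters by interleaving.\<close>

abbreviation params_left :: "nat \<Rightarrow> trm" where
  "params_left \<equiv> join (\<lambda>i. Var (left i)) (\<lambda>i. Var (right (left i)))"

abbreviation params_right :: "nat \<Rightarrow> trm" where
  "params_right \<equiv> join (\<lambda>i. Var (left i)) (\<lambda>i. Var (right (right i)))"

lemma val_params_left: "val (join e (join \<rho> \<rho>')) (subst_trm params_left t) = val (join e \<rho>) t"
  and val_params_right: "val (join e (join \<rho> \<rho>')) (subst_trm params_right t) = val (join e \<rho>') t"
  by (simp_all add: val_subst comp_join[of "val _"])

lemma sat_params_left: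
    "sat D S (join e (join \<rho> \<rho>')) (join \<sigma> \<sigma>') (subst_fml params_left left p)
      = sat D S (join e \<rho>) \<sigma> p"
  and sat_params_right:
    "sat D S (join e (join \<rho> \<rho>')) (join \<sigma> \<sigma>') (subst_fml params_right right p)
      = sat D S (join e \<rho>') \<sigma>' p"
  by (simp_all add: sat_subst comp_join[of "val _"])

abbreviation shift_vars :: "nat \<Rightarrow> trm" where
  "shift_vars \<equiv> join (Var 0 ## (\<lambda>i. Var (Suc (left i)))) (\<lambda>i. Var (Suc (right i)))"

lemma sat_shift_vars:
  "sat D S (x ## join e \<rho>) \<sigma> (subst_fml shift_vars (\<lambda>k. k) p) = sat D S (join (x ## e) \<rho>) \<sigma> p"
  by (simp add: sat_subst comp_join[of "val _"] val_cons_trm)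

lemma term_fun_representable:
  "term_fun C t \<Longrightarrow> C \<noteq> {} \<Longrightarrow> \<exists>s \<rho>. range \<rho> \<subseteq> C \<and> (\<forall>e. t e = val (join e \<rho>) s)"
proof (induction rule: term_fun.induct)
  case (term_fun_add s t)
  then obtain s' \<rho> t' \<rho>' where "range \<rho> \<subseteq> C" "\<forall>e. s e = val (join e \<rho>) s'"
    "range \<rho>' \<subseteq> C" "\<forall>e. t e = val (join e \<rho>') t'" by auto
  then show ?case
    by (intro exI[of _ "Add (subst_trm params_left s') (subst_trm params_right t')"]
        exI[of _ "join \<rho> \<rho>'"])
      (simp add: val_params_left val_params_right)
next
  case (term_fun_mul s t)
  then obtain s' \<rho> t' \<rho>' where "range \<rho> \<subseteq> C" "\<forall>e. s e = val (join e \<rho>) s'"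
    "range \<rho>' \<subseteq> C" "\<forall>e. t e = val (join e \<rho>') t'" by auto
  then show ?case
    by (intro exI[of _ "Mul (subst_trm params_left s') (subst_trm params_right t')"]
        exI[of _ "join \<rho> \<rho>'"])
      (simp add: val_params_left val_params_right)
next
  case (term_fun_const a)
  then show ?case by (intro exI[of _ "Var (right 0)"] exI[of _ "\<lambda>_. a"]) auto
next
  case (term_fun_var i)
  then show ?case by (intro exI[of _ "Var (left i)"]) auto
next
  case term_fun_zero
  then show ?case by (intro exI[of _ Zero]) auto
next
  case term_fun_one
  then show ?case by (intro exI[of _ One]) auto
qed

lemma term_funs_representable:
  assumes "term_fun C s" "term_fun C t" "C \<noteq> {}"
  obtains s' t' \<rho> where "range \<rho> \<subseteq> C" "\<And>e. s e = val (join e \<rho>) s'" "\<And>e. t e = val (join e \<rho>) t'"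
proof -
  obtain s' \<rho> t' \<rho>' where "range \<rho> \<subseteq> C" "range \<rho>' \<subseteq> C"
    "\<And>e. s e = val (join e \<rho>) s'" "\<And>e. t e = val (join e \<rho>') t'"
    using assms term_fun_representable by metis
  then show ?thesis
    by (intro that[of "join \<rho> \<rho>'" "subst_trm params_left s'" "subst_trm params_right t'"])
      (simp_all add: val_params_left val_params_right)
qed

lemma definable_imp:
  assumes "definable is_Delta00 D S C U P" "definable is_Delta00 D S C U Q"
  shows "definable is_Delta00 D S C U (\<lambda>e. P e \<longrightarrow> Q e)"
proof -
  obtain p \<rho> \<sigma> where p: "is_Delta00 p" "range \<rho> \<subseteq> C" "range \<sigma> \<subseteq> U"
    "\<And>e. range e \<subseteq> D \<Longrightarrow> P e = sat D S (join e \<rho>) \<sigma> p"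
    using assms(1) by (rule definableE) blast
  obtain q \<rho>' \<sigma>' where q: "is_Delta00 q" "range \<rho>' \<subseteq> C" "range \<sigma>' \<subseteq> U"
    "\<And>e. range e \<subseteq> D \<Longrightarrow> Q e = sat D S (join e \<rho>') \<sigma>' q"
    using assms(2) by (rule definableE) blast
  show ?thesis
    using p q
    by (intro definableI[where \<rho> = "join \<rho> \<rho>'" and \<sigma> = "join \<sigma> \<sigma>'"
          and p = "Imp (subst_fml params_left left p) (subst_fml params_right right q)"])
      (simp_all add: sat_params_left sat_params_right is_Delta00.intros is_Delta00_subst)
qed

lemma definable_ball:
  assumes "definable is_Delta00 D S C U P" "term_fun C t" "C \<noteq> {}"
  shows "definable is_Delta00 D S C U (\<lambda>e. \<forall>y\<in>D. y \<prec> t e \<longrightarrow> P (y ## e))"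
proof -
  obtain p \<rho> \<sigma> where p: "is_Delta00 p" "range \<rho> \<subseteq> C" "range \<sigma> \<subseteq> U"
    "\<And>e. range e \<subseteq> D \<Longrightarrow> P e = sat D S (join e \<rho>) \<sigma> p"
    using assms(1) by (rule definableE) blast
  obtain t' \<rho>' where t': "range \<rho>' \<subseteq> C" "\<And>e. t e = val (join e \<rho>') t'"
    using term_fun_representable assms(2,3) by metis
  let ?p = "subst_fml shift_vars (\<lambda>k. k) (subst_fml params_left left p)"
  show ?thesis
    using p t'
    by (intro definableI[where \<rho> = "join \<rho> \<rho>'" and \<sigma> = "join \<sigma> \<sigma>"
          and p = "BAll (subst_trm params_right t') ?p"])
      (simp_all add: val_params_right sat_shift_vars sat_params_left is_Delta00.intros
        is_Delta00_subst)
qed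

lemma definable_if_Delta0:
  "Delta0 D C U P \<Longrightarrow> C \<noteq> {} \<Longrightarrow> U \<noteq> {} \<Longrightarrow> definable is_Delta00 D S C U P"
proof (induction rule: Delta0.induct)
  case (Delta0_eq s t)
  obtain s' t' \<rho> where "range \<rho> \<subseteq> C" "\<And>e. s e = val (join e \<rho>) s'" "\<And>e. t e = val (join e \<rho>) t'"
    using term_funs_representable Delta0_eq by metis
  then show ?case using Delta0_eq
    by (intro definableI[where p = "Eq s' t'" and \<rho> = \<rho> and \<sigma> = "\<lambda>_. SOME X. X \<in> U"])
      (simp_all add: is_Delta00.intros some_in_eq)
next
  case (Delta0_less s t)
  obtain s' t' \<rho> where "range \<rho> \<subseteq> C" "\<And>e. s e = val (join e \<rho>) s'" "\<And>e. t e = val (join e \<rho>) t'"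
    using term_funs_representable Delta0_less by metis
  then show ?case using Delta0_less
    by (intro definableI[where p = "Lt s' t'" and \<rho> = \<rho> and \<sigma> = "\<lambda>_. SOME X. X \<in> U"])
      (simp_all add: is_Delta00.intros some_in_eq)
next
  case (Delta0_mem t X)
  obtain t' \<rho> where "range \<rho> \<subseteq> C" "\<And>e. t e = val (join e \<rho>) t'"
    using term_fun_representable Delta0_mem by metis
  then show ?case using Delta0_mem
    by (intro definableI[where p = "Mem t' 0" and \<rho> = \<rho> and \<sigma> = "\<lambda>_. X"])
      (auto intro: is_Delta00.intros)
next
  case Delta0_False
  then show ?case
    by (intro definableI[where p = Fls and \<rho> = "\<lambda>_. SOME a. a \<in> C" and \<sigma> = "\<lambda>_. SOME X. X \<in> U"])
      (simp_all add: is_Delta00.intros some_in_eq)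
qed (simp_all add: definable_imp definable_ball)

lemma definable_ExN:
  assumes "definable (is_Pi0 k) D S C U Q" "\<And>e. range e \<subseteq> D \<Longrightarrow> P e \<longleftrightarrow> (\<exists>z\<in>D. Q (z ## e))"
  shows "definable (is_Sigma0 (Suc k)) D S C U P"
proof -
  obtain p \<rho> \<sigma> where p: "is_Pi0 k p" "range \<rho> \<subseteq> C" "range \<sigma> \<subseteq> U"
    "\<And>e. range e \<subseteq> D \<Longrightarrow> Q e = sat D S (join e \<rho>) \<sigma> p"
    using assms(1) by (rule definableE) blast
  then show ?thesis using assms(2)
    by (intro definableI[where p = "ExN (subst_fml shift_vars (\<lambda>k. k) p)" and \<rho> = \<rho> and \<sigma> = \<sigma>])
      (simp_all add: sat_shift_vars is_Sigma0_Suc_iff is_Pi0_subst)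
qed

lemma definable_AllN:
  assumes "definable (is_Sigma0 k) D S C U Q" "\<And>e. range e \<subseteq> D \<Longrightarrow> P e \<longleftrightarrow> (\<forall>z\<in>D. Q (z ## e))"
  shows "definable (is_Pi0 (Suc k)) D S C U P"
proof -
  obtain p \<rho> \<sigma> where p: "is_Sigma0 k p" "range \<rho> \<subseteq> C" "range \<sigma> \<subseteq> U"
    "\<And>e. range e \<subseteq> D \<Longrightarrow> Q e = sat D S (join e \<rho>) \<sigma> p"
    using assms(1) by (rule definableE) blast
  then show ?thesis using assms(2)
    by (intro definableI[where p = "AllN (subst_fml shift_vars (\<lambda>k. k) p)" and \<rho> = \<rho> and \<sigma> = \<sigma>])
      (simp_all add: sat_shift_vars is_Pi0_Suc_iff is_Sigma0_subst)
qed

lemma definable_if_Sigma1: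
  assumes "Sigma1 D C U P" "C \<noteq> {}" "U \<noteq> {}" shows "definable (is_Sigma0 1) D S C U P"
proof -
  obtain Q where Q: "Delta0 D C U Q" "\<And>e. range e \<subseteq> D \<Longrightarrow> P e \<longleftrightarrow> (\<exists>z\<in>D. Q (z ## e))"
    using assms(1) by (rule Sigma1E) blast
  have "definable (is_Pi0 0) D S C U Q"
    using definable_if_Delta0[OF Q(1) assms(2,3)] by (simp add: definable_def)
  then show ?thesis using definable_ExN[OF _ Q(2)] by simp
qed

lemma definable_if_Pi1:
  assumes "Pi1 D C U P" "C \<noteq> {}" "U \<noteq> {}" shows "definable (is_Pi0 1) D S C U P"
proof -
  obtain Q where Q: "Delta0 D C U Q" "\<And>e. range e \<subseteq> D \<Longrightarrow> P e \<longleftrightarrow> (\<forall>z\<in>D. \<not> Q (z ## e))"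
    using assms(1) by (rule Pi1E) blast
  have "definable (is_Sigma0 0) D S C U (\<lambda>e. \<not> Q e)"
    using definable_if_Delta0[OF Delta0_not[OF Q(1)] assms(2,3)] by (simp add: definable_def)
  then show ?thesis using definable_AllN[OF _ Q(2)] by simp
qed

lemma definable_if_Sigma2:
  assumes "Sigma2 D C U P" "C \<noteq> {}" "U \<noteq> {}" shows "definable (is_Sigma0 2) D S C U P"
proof -
  obtain Q where Q: "Pi1 D C U Q" "\<And>e. range e \<subseteq> D \<Longrightarrow> P e \<longleftrightarrow> (\<exists>z\<in>D. Q (z ## e))"
    using assms(1) by (rule Sigma2E) blast
  show ?thesis
    using definable_ExN[OF definable_if_Pi1[OF Q(1) assms(2,3)] Q(2)] by (simp add: numeral_2_eq_2)
qed

lemma definable_unaryE: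
  assumes "definable \<Phi> D S C U (\<lambda>e. P (e 0))" "\<And>p f g. \<Phi> p \<Longrightarrow> \<Phi> (subst_fml f g p)"
  obtains p \<rho> \<sigma> where "\<Phi> p" "range \<rho> \<subseteq> C" "range \<sigma> \<subseteq> U"
    "\<And>x. x \<in> D \<Longrightarrow> P x = sat D S (x ## \<rho>) \<sigma> p"
proof -
  obtain p \<rho> \<sigma> where p: "\<Phi> p" "range \<rho> \<subseteq> C" "range \<sigma> \<subseteq> U"
    "\<And>e. range e \<subseteq> D \<Longrightarrow> P (e 0) = sat D S (join e \<rho>) \<sigma> p"
    using assms(1) by (rule definableE) blast
  show ?thesis
  proof (rule that)
    show "P x = sat D S (x ## \<rho>) \<sigma> (subst_fml (join (\<lambda>_. Var 0) (\<lambda>i. Var (Suc i))) (\<lambda>k. k) p)"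
      if "x \<in> D" for x
      using p(4)[of "\<lambda>_. x"] that by (simp add: image_subset_iff sat_subst comp_join[of "val _"])
  qed (use p assms(2) in auto)
qed

lemma definable_binaryE:
  assumes "definable \<Phi> D S C U (\<lambda>e. P (e 0) (e 1))" "\<And>p f g. \<Phi> p \<Longrightarrow> \<Phi> (subst_fml f g p)"
  obtains p \<rho> \<sigma> where "\<Phi> p" "range \<rho> \<subseteq> C" "range \<sigma> \<subseteq> U"
    "\<And>x y. x \<in> D \<Longrightarrow> y \<in> D \<Longrightarrow> P x y = sat D S (x ## y ## \<rho>) \<sigma> p"
proof -
  obtain p \<rho> \<sigma> where p: "\<Phi> p" "range \<rho> \<subseteq> C" "range \<sigma> \<subseteq> U"
    "\<And>e. range e \<subseteq> D \<Longrightarrow> P (e 0) (e 1) = sat D S (join e \<rho>) \<sigma> p"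
    using assms(1) by (rule definableE) blast
  let ?f = "join (Var 0 ## (\<lambda>_. Var 1)) (\<lambda>i. Var (Suc (Suc i)))"
  show ?thesis
  proof (rule that)
    show "P x y = sat D S (x ## y ## \<rho>) \<sigma> (subst_fml ?f (\<lambda>k. k) p)" if "x \<in> D" "y \<in> D" for x y
      using p(4)[of "x ## (\<lambda>_. y)"] that
      by (simp add: image_subset_iff sat_subst comp_join[of "val _"] val_cons_trm)
  qed (use p assms(2) in auto)
qed

end

section \<open>Models of \<open>RCA\<^sub>0\<close>\<close>

locale RCA0_model = arith_structure +
  fixes D :: "'a set" and S :: "'a set set"
  assumes zero_in [simp]: "\<zero> \<in> D" and one_in [simp]: "\<one> \<in> D"
    and add_in [simp]: "x \<in> D \<Longrightarrow> y \<in> D \<Longrightarrow> x \<oplus> y \<in> D"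
    and mul_in [simp]: "x \<in> D \<Longrightarrow> y \<in> D \<Longrightarrow> x \<odot> y \<in> D"
    and S_nonempty: "S \<noteq> {}"
    and succ_not_zero: "x \<in> D \<Longrightarrow> x \<oplus> \<one> \<noteq> \<zero>"
    and succ_inj: "x \<in> D \<Longrightarrow> y \<in> D \<Longrightarrow> x \<oplus> \<one> = y \<oplus> \<one> \<Longrightarrow> x = y"
    and add_zero: "x \<in> D \<Longrightarrow> x \<oplus> \<zero> = x"
    and add_succ: "x \<in> D \<Longrightarrow> y \<in> D \<Longrightarrow> x \<oplus> (y \<oplus> \<one>) = x \<oplus> y \<oplus> \<one>"
    and mul_zero: "x \<in> D \<Longrightarrow> x \<odot> \<zero> = \<zero>"
    and mul_succ: "x \<in> D \<Longrightarrow> y \<in> D \<Longrightarrow> x \<odot> (y \<oplus> \<one>) = x \<odot> y \<oplus> x"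
    and not_less_zero: "x \<in> D \<Longrightarrow> \<not> x \<prec> \<zero>"
    and less_succ: "x \<in> D \<Longrightarrow> y \<in> D \<Longrightarrow> x \<prec> y \<oplus> \<one> \<longleftrightarrow> x \<prec> y \<or> x = y"
    and Sigma1_induct: "Sigma1 D D S (\<lambda>e. P (e 0)) \<Longrightarrow> P \<zero>
      \<Longrightarrow> (\<And>x. x \<in> D \<Longrightarrow> P x \<Longrightarrow> P (x \<oplus> \<one>)) \<Longrightarrow> x \<in> D \<Longrightarrow> P x"
    and Delta1_comprehension: "Sigma1 D D S (\<lambda>e. P (e 0)) \<Longrightarrow> Pi1 D D S (\<lambda>e. P (e 0))
      \<Longrightarrow> \<exists>X\<in>S. \<forall>x\<in>D. x \<in> X \<longleftrightarrow> P x"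

context arith_structure
begin

lemma models_image_univ_closure:
  "models D S (univ_closure ` T) \<longleftrightarrow> models D S T"
proof -
  have "(\<forall>e \<sigma>. range e \<subseteq> D \<longrightarrow> range \<sigma> \<subseteq> S \<longrightarrow> sat D S e \<sigma> (univ_closure p))
      \<longleftrightarrow> (\<forall>e \<sigma>. range e \<subseteq> D \<longrightarrow> range \<sigma> \<subseteq> S \<longrightarrow> sat D S e \<sigma> p)" for p
    by (simp add: sat_univ_closure) blast
  then show ?thesis by (simp add: models_def)
qed

lemma models_two_variables:
  assumes "closed_dom D" "S \<noteq> {}" "\<And>p. p \<in> T \<Longrightarrow> boundN p \<le> 2 \<and> boundS p = 0"
  shows "models D S T \<longleftrightarrow> (\<forall>x\<in>D. \<forall>y\<in>D. \<forall>p\<in>T. \<forall>\<sigma>. sat D S (x ## (\<lambda>_. y)) \<sigma> p)"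
proof -
  have cong: "sat D S e \<sigma> p = sat D S (e 0 ## (\<lambda>_. e 1)) \<sigma>' p" if "p \<in> T" for e \<sigma> \<sigma>' p
    by (rule sat_cong) (use assms(3)[OF that] in \<open>auto dest: less_le_trans split: nat.split\<close>)
  show ?thesis
  proof
    assume M: "models D S T"
    obtain X where "X \<in> S" using assms(2) by blast
    then have "sat D S (x ## (\<lambda>_. y)) (\<lambda>_. X) p" if "x \<in> D" "y \<in> D" "p \<in> T" for x y p
      using M[unfolded models_def, THEN conjunct2, THEN conjunct2, rule_format,
          of p "x ## (\<lambda>_. y)" "\<lambda>_. X"] that by auto
    then show "\<forall>x\<in>D. \<forall>y\<in>D. \<forall>p\<in>T. \<forall>\<sigma>. sat D S (x ## (\<lambda>_. y)) \<sigma> p"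
      using cong by fastforce
  next
    assume "\<forall>x\<in>D. \<forall>y\<in>D. \<forall>p\<in>T. \<forall>\<sigma>. sat D S (x ## (\<lambda>_. y)) \<sigma> p"
    then show "models D S T"
      using assms(1,2) cong unfolding models_def by (metis rangeI subsetD)
  qed
qed

lemma models_basic_axioms_iff:
  assumes "closed_dom D" "S \<noteq> {}"
  shows "models D S basic_axioms \<longleftrightarrow>
    (\<forall>x\<in>D. x \<oplus> \<one> \<noteq> \<zero>) \<and> (\<forall>x\<in>D. \<forall>y\<in>D. x \<oplus> \<one> = y \<oplus> \<one> \<longrightarrow> x = y) \<and>
    (\<forall>x\<in>D. x \<oplus> \<zero> = x) \<and> (\<forall>x\<in>D. \<forall>y\<in>D. x \<oplus> (y \<oplus> \<one>) = x \<oplus> y \<oplus> \<one>) \<and>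
    (\<forall>x\<in>D. x \<odot> \<zero> = \<zero>) \<and> (\<forall>x\<in>D. \<forall>y\<in>D. x \<odot> (y \<oplus> \<one>) = x \<odot> y \<oplus> x) \<and>
    (\<forall>x\<in>D. \<not> x \<prec> \<zero>) \<and> (\<forall>x\<in>D. \<forall>y\<in>D. x \<prec> y \<oplus> \<one> \<longleftrightarrow> x \<prec> y \<or> x = y)"
proof -
  obtain x0 where x0: "x0 \<in> D" using assms(1) by (auto simp: closed_dom_def)
  have "models D S basic_axioms \<longleftrightarrow>
      (\<forall>x\<in>D. \<forall>y\<in>D. x \<oplus> \<one> \<noteq> \<zero> \<and> (x \<oplus> \<one> = y \<oplus> \<one> \<longrightarrow> x = y) \<and> x \<oplus> \<zero> = x \<and>
        x \<oplus> (y \<oplus> \<one>) = x \<oplus> y \<oplus> \<one> \<and> x \<odot> \<zero> = \<zero> \<and> x \<odot> (y \<oplus> \<one>) = x \<odot> y \<oplus> x \<and>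
        \<not> x \<prec> \<zero> \<and> (x \<prec> y \<oplus> \<one> \<longleftrightarrow> x \<prec> y \<or> x = y))"
    unfolding basic_axioms_def models_image_univ_closure
    using assms by (subst models_two_variables) auto
  then show ?thesis using x0 by blast
qed

lemma sat_induction_fml:
  "sat D S e \<sigma> (induction_fml p) \<longleftrightarrow>
    (sat D S (\<zero> ## e) \<sigma> p \<longrightarrow>
     (\<forall>x\<in>D. sat D S (x ## e) \<sigma> p \<longrightarrow> sat D S ((x \<oplus> \<one>) ## e) \<sigma> p) \<longrightarrow>
     (\<forall>x\<in>D. sat D S (x ## e) \<sigma> p))"
  by (auto simp: induction_fml_def sat_instN sat_subst val_cons_trm)

lemma sat_comprehension_fml:
  "sat D S e \<sigma> (comprehension_fml p q) \<longleftrightarrow>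
    ((\<forall>x\<in>D. sat D S (x ## e) \<sigma> p \<longleftrightarrow> sat D S (x ## e) \<sigma> q) \<longrightarrow>
     (\<exists>X\<in>S. \<forall>x\<in>D. x \<in> X \<longleftrightarrow> sat D S (x ## e) \<sigma> p))"
  by (auto simp: comprehension_fml_def sat_liftS)

lemma Sigma1_induct_if_models:
  assumes M: "models D S {induction_fml p |p. is_Sigma0 1 p}" and P: "Sigma1 D D S (\<lambda>e. P (e 0))"
    and zero: "P \<zero>" and succ: "\<And>x. x \<in> D \<Longrightarrow> P x \<Longrightarrow> P (x \<oplus> \<one>)" and x: "x \<in> D"
  shows "P x"
proof -
  have dom: "closed_dom D" "S \<noteq> {}" using M by (simp_all add: models_def)
  then have "D \<noteq> {}" by (auto simp: closed_dom_def)
  with P dom(2) have "definable (is_Sigma0 1) D S D S (\<lambda>e. P (e 0))" by (intro definable_if_Sigma1)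
  then obtain p \<rho> \<sigma> where p: "is_Sigma0 1 p" "range \<rho> \<subseteq> D" "range \<sigma> \<subseteq> S"
    "\<And>x. x \<in> D \<Longrightarrow> P x = sat D S (x ## \<rho>) \<sigma> p"
    by (rule definable_unaryE) (erule is_Sigma0_subst, rule that)
  then have "sat D S \<rho> \<sigma> (induction_fml p)" using M unfolding models_def by blast
  then have "\<forall>x\<in>D. P x" using zero succ p(4) dom(1) by (simp add: sat_induction_fml closed_dom_def)
  then show ?thesis using x by blast
qed

lemma Delta1_comprehension_if_models:
  assumes M: "models D S {comprehension_fml p q |p q. is_Sigma0 1 p \<and> is_Pi0 1 q}"
    and P: "Sigma1 D D S (\<lambda>e. P (e 0))" "Pi1 D D S (\<lambda>e. P (e 0))"
  shows "\<exists>X\<in>S. \<forall>x\<in>D. x \<in> X \<longleftrightarrow> P x"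
proof -
  have ne: "D \<noteq> {}" "S \<noteq> {}" using M by (auto simp: models_def closed_dom_def)
  obtain p \<rho> \<sigma> where p: "is_Sigma0 1 p" "range \<rho> \<subseteq> D" "range \<sigma> \<subseteq> S"
    "\<And>x. x \<in> D \<Longrightarrow> P x = sat D S (x ## \<rho>) \<sigma> p"
    using definable_if_Sigma1[OF P(1) ne, of S]
    by (rule definable_unaryE) (erule is_Sigma0_subst, rule that)
  obtain q \<rho>' \<sigma>' where q: "is_Pi0 1 q" "range \<rho>' \<subseteq> D" "range \<sigma>' \<subseteq> S"
    "\<And>x. x \<in> D \<Longrightarrow> P x = sat D S (x ## \<rho>') \<sigma>' q"
    using definable_if_Pi1[OF P(2) ne, of S]
    by (rule definable_unaryE) (erule is_Pi0_subst, rule that)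
  let ?p = "subst_fml (Var 0 ## (\<lambda>i. Var (Suc (left i)))) left p"
  let ?q = "subst_fml (Var 0 ## (\<lambda>i. Var (Suc (right i)))) right q"
  have "comprehension_fml ?p ?q \<in> {comprehension_fml p q |p q. is_Sigma0 1 p \<and> is_Pi0 1 q}"
    using is_Sigma0_subst[OF p(1)] is_Pi0_subst[OF q(1)] by blast
  moreover have "range (join \<rho> \<rho>') \<subseteq> D" "range (join \<sigma> \<sigma>') \<subseteq> S" using p q by simp_all
  ultimately have "sat D S (join \<rho> \<rho>') (join \<sigma> \<sigma>') (comprehension_fml ?p ?q)"
    using M unfolding models_def by blast
  then show ?thesis using p(4) q(4) by (simp add: sat_comprehension_fml sat_subst val_cons_trm)
qed

lemma models_Un: "models D S (T \<union> T') \<longleftrightarrow> models D S T \<and> models D S T'"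
  unfolding models_def by blast

end

context RCA0_model
begin

lemma closed_dom: "closed_dom D"
  by (simp add: closed_dom_def)

lemma models_Sigma1_induction: "models D S {induction_fml p |p. is_Sigma0 1 p}"
proof -
  have "sat D S e \<sigma> (induction_fml p)" if "is_Sigma0 1 p" "range e \<subseteq> D" "range \<sigma> \<subseteq> S" for p e \<sigma>
    unfolding sat_induction_fml
  proof (intro impI ballI)
    have "Sigma1 D D S (\<lambda>e'. sat D S (e' 0 ## e) \<sigma> p)"
      using that by (intro Sigma1_subst[OF Sigma1_sat] closed_dom term_fun_cons term_fun_var
          term_fun_const) auto
    then show "sat D S (x ## e) \<sigma> p"
      if "sat D S (\<zero> ## e) \<sigma> p" "\<forall>x\<in>D. sat D S (x ## e) \<sigma> p \<longrightarrow> sat D S ((x \<oplus> \<one>) ## e) \<sigma> p" "x \<in> D"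
        for x
      by (rule Sigma1_induct[where P = "\<lambda>x. sat D S (x ## e) \<sigma> p"]) (use that in blast)+
  qed
  then show ?thesis using closed_dom S_nonempty by (auto simp: models_def)
qed

lemma models_Delta1_comprehension:
  "models D S {comprehension_fml p q |p q. is_Sigma0 1 p \<and> is_Pi0 1 q}"
proof -
  have "sat D S e \<sigma> (comprehension_fml p q)"
    if p: "is_Sigma0 1 p" and q: "is_Pi0 1 q" and e: "range e \<subseteq> D" "range \<sigma> \<subseteq> S" for p q e \<sigma>
    unfolding sat_comprehension_fml
  proof
    assume eq: "\<forall>x\<in>D. sat D S (x ## e) \<sigma> p \<longleftrightarrow> sat D S (x ## e) \<sigma> q"
    have Sigma1: "Sigma1 D D S (\<lambda>e'. sat D S (e' 0 ## e) \<sigma> p)"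
      using p e by (intro Sigma1_subst[OF Sigma1_sat] closed_dom term_fun_cons term_fun_var
          term_fun_const) auto
    have "Pi1 D D S (\<lambda>e'. sat D S (e' 0 ## e) \<sigma> q)"
      using q e by (intro Pi1_subst[OF Pi1_sat] closed_dom term_fun_cons term_fun_var
          term_fun_const) auto
    then have "Pi1 D D S (\<lambda>e'. sat D S (e' 0 ## e) \<sigma> p)" by (rule Pi1_cong) (use eq in auto)
    with Sigma1 show "\<exists>X\<in>S. \<forall>x\<in>D. x \<in> X \<longleftrightarrow> sat D S (x ## e) \<sigma> p"
      by (rule Delta1_comprehension)
  qed
  then show ?thesis using closed_dom S_nonempty by (auto simp: models_def)
qed

end

theorem (in arith_structure) models_RCA0_iff:
  "models D S RCA0 \<longleftrightarrow> RCA0_model zero one add mul less D S"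
proof -
  have "{univ_closure (induction_fml p) |p. is_Sigma0 1 p}
      = univ_closure ` {induction_fml p |p. is_Sigma0 1 p}"
    "{univ_closure (comprehension_fml p q) |p q. is_Sigma0 1 p \<and> is_Pi0 1 q}
      = univ_closure ` {comprehension_fml p q |p q. is_Sigma0 1 p \<and> is_Pi0 1 q}" by blast+
  then have RCA0_iff: "models D S RCA0 \<longleftrightarrow> models D S basic_axioms
      \<and> models D S {induction_fml p |p. is_Sigma0 1 p}
      \<and> models D S {comprehension_fml p q |p q. is_Sigma0 1 p \<and> is_Pi0 1 q}"
    unfolding RCA0_def models_Un by (simp only: models_image_univ_closure conj_assoc)
  show ?thesis
  proof
    assume "models D S RCA0"
    then have basic: "models D S basic_axioms"
      and ind: "models D S {induction_fml p |p. is_Sigma0 1 p}"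
      and compr: "models D S {comprehension_fml p q |p q. is_Sigma0 1 p \<and> is_Pi0 1 q}"
      unfolding RCA0_iff by blast+
    have dom: "closed_dom D" "S \<noteq> {}" using basic by (simp_all add: models_def)
    show "RCA0_model zero one add mul less D S"
    proof
      show "P x" if "Sigma1 D D S (\<lambda>e. P (e 0))" "P \<zero>" "\<And>x. x \<in> D \<Longrightarrow> P x \<Longrightarrow> P (x \<oplus> \<one>)"
        "x \<in> D" for P x
        using ind that by (rule Sigma1_induct_if_models)
      show "\<exists>X\<in>S. \<forall>x\<in>D. x \<in> X \<longleftrightarrow> P x"
        if "Sigma1 D D S (\<lambda>e. P (e 0))" "Pi1 D D S (\<lambda>e. P (e 0))" for P
        using compr that by (rule Delta1_comprehension_if_models)
    qed (use dom basic[unfolded models_basic_axioms_iff[OF dom]] in \<open>simp_all add: closed_dom_def\<close>)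
  next
    assume "RCA0_model zero one add mul less D S"
    then interpret RCA0_model zero one add mul less D S .
    have "models D S basic_axioms"
      using closed_dom S_nonempty
      by (auto simp: models_basic_axioms_iff succ_not_zero add_zero add_succ mul_zero mul_succ
          not_less_zero less_succ dest: succ_inj)
    then show "models D S RCA0"
      unfolding RCA0_iff using models_Sigma1_induction models_Delta1_comprehension by blast
  qed
qed

section \<open>Arithmetic in models of \<open>RCA\<^sub>0\<close>\<close>

context arith_structure
begin

abbreviation less_eq (infix \<open>\<preceq>\<close> 50) where "x \<preceq> y \<equiv> x \<prec> y \<oplus> \<one>"

lemma Sigma1_ex_Delta0:
  "Delta0 D C U (\<lambda>e. P (e 0) (\<lambda>i. e (Suc i))) \<Longrightarrow> Sigma1 D C U (\<lambda>e. \<exists>z\<in>D. P z e)"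
  by (erule Sigma1I) simp

end

context RCA0_model
begin

lemma Sigma1_if_Delta0: "Delta0 D C U P \<Longrightarrow> Sigma1 D C U P"
  by (rule Sigma1I[where Q = "\<lambda>e. P (\<lambda>i. e (Suc i))"])
    (auto intro: Delta0_subst term_fun_var zero_in)

lemma Delta0_induct:
  assumes "Delta0 D D S (\<lambda>e. P (e 0))" "P \<zero>" "\<And>x. x \<in> D \<Longrightarrow> P x \<Longrightarrow> P (x \<oplus> \<one>)" "x \<in> D"
  shows "P x"
  using Sigma1_induct[of P x] assms Sigma1_if_Delta0 by blast

subsection \<open>Semiring laws and order\<close>

lemma l_zero: assumes "x \<in> D" shows "\<zero> \<oplus> x = x"
proof (rule Delta0_induct[where P = "\<lambda>x. \<zero> \<oplus> x = x"])
  show "Delta0 D D S (\<lambda>e. \<zero> \<oplus> e 0 = e 0)" by (intro Delta0_intros)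
qed (use assms in \<open>simp_all add: add_zero add_succ\<close>)

lemma succ_add: assumes "x \<in> D" "y \<in> D" shows "x \<oplus> \<one> \<oplus> y = x \<oplus> y \<oplus> \<one>"
proof (rule Delta0_induct[where P = "\<lambda>y. x \<oplus> \<one> \<oplus> y = x \<oplus> y \<oplus> \<one>"])
  show "Delta0 D D S (\<lambda>e. x \<oplus> \<one> \<oplus> e 0 = x \<oplus> e 0 \<oplus> \<one>)" by (intro Delta0_intros assms)
qed (use assms in \<open>simp_all add: add_zero add_succ\<close>)

lemma a_comm: assumes "x \<in> D" "y \<in> D" shows "x \<oplus> y = y \<oplus> x"
proof (rule Delta0_induct[where P = "\<lambda>y. x \<oplus> y = y \<oplus> x"])
  show "Delta0 D D S (\<lambda>e. x \<oplus> e 0 = e 0 \<oplus> x)" by (intro Delta0_intros assms)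
qed (use assms in \<open>simp_all add: add_zero add_succ l_zero succ_add\<close>)

lemma a_assoc: assumes "x \<in> D" "y \<in> D" "z \<in> D" shows "x \<oplus> y \<oplus> z = x \<oplus> (y \<oplus> z)"
proof (rule Delta0_induct[where P = "\<lambda>z. x \<oplus> y \<oplus> z = x \<oplus> (y \<oplus> z)"])
  show "Delta0 D D S (\<lambda>e. x \<oplus> y \<oplus> e 0 = x \<oplus> (y \<oplus> e 0))" by (intro Delta0_intros assms)
qed (use assms in \<open>simp_all add: add_zero add_succ\<close>)

lemma a_lcomm: "x \<in> D \<Longrightarrow> y \<in> D \<Longrightarrow> z \<in> D \<Longrightarrow> x \<oplus> (y \<oplus> z) = y \<oplus> (x \<oplus> z)"
  by (metis a_assoc a_comm)

lemma l_null: assumes "x \<in> D" shows "\<zero> \<odot> x = \<zero>"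
proof (rule Delta0_induct[where P = "\<lambda>x. \<zero> \<odot> x = \<zero>"])
  show "Delta0 D D S (\<lambda>e. \<zero> \<odot> e 0 = \<zero>)" by (intro Delta0_intros)
qed (use assms in \<open>simp_all add: mul_zero mul_succ add_zero\<close>)

lemma succ_mul: assumes "x \<in> D" "y \<in> D" shows "(x \<oplus> \<one>) \<odot> y = x \<odot> y \<oplus> y"
proof (rule Delta0_induct[where P = "\<lambda>y. (x \<oplus> \<one>) \<odot> y = x \<odot> y \<oplus> y"])
  show "Delta0 D D S (\<lambda>e. (x \<oplus> \<one>) \<odot> e 0 = x \<odot> e 0 \<oplus> e 0)" by (intro Delta0_intros assms)
qed (use assms in \<open>simp_all add: mul_zero mul_succ add_zero a_assoc a_comm a_lcomm\<close>)

lemma m_comm: assumes "x \<in> D" "y \<in> D" shows "x \<odot> y = y \<odot> x"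
proof (rule Delta0_induct[where P = "\<lambda>y. x \<odot> y = y \<odot> x"])
  show "Delta0 D D S (\<lambda>e. x \<odot> e 0 = e 0 \<odot> x)" by (intro Delta0_intros assms)
qed (use assms in \<open>simp_all add: mul_zero mul_succ l_null succ_mul\<close>)

lemma r_one: "x \<in> D \<Longrightarrow> x \<odot> \<one> = x"
  using mul_succ[of x \<zero>] by (simp add: l_zero mul_zero)

lemma l_one: "x \<in> D \<Longrightarrow> \<one> \<odot> x = x"
  using r_one[of x] m_comm[of \<one> x] by simp

lemma r_distr: assumes "x \<in> D" "y \<in> D" "z \<in> D" shows "x \<odot> (y \<oplus> z) = x \<odot> y \<oplus> x \<odot> z"
proof (rule Delta0_induct[where P = "\<lambda>z. x \<odot> (y \<oplus> z) = x \<odot> y \<oplus> x \<odot> z"])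
  show "Delta0 D D S (\<lambda>e. x \<odot> (y \<oplus> e 0) = x \<odot> y \<oplus> x \<odot> e 0)" by (intro Delta0_intros assms)
qed (use assms in \<open>simp_all add: mul_zero mul_succ add_zero flip: a_assoc\<close>)

lemma l_distr: "x \<in> D \<Longrightarrow> y \<in> D \<Longrightarrow> z \<in> D \<Longrightarrow> (y \<oplus> z) \<odot> x = y \<odot> x \<oplus> z \<odot> x"
  using m_comm[of "y \<oplus> z" x] m_comm[of y x] m_comm[of z x] r_distr[of x y z] by simp

lemma m_assoc: assumes "x \<in> D" "y \<in> D" "z \<in> D" shows "x \<odot> y \<odot> z = x \<odot> (y \<odot> z)"
proof (rule Delta0_induct[where P = "\<lambda>z. x \<odot> y \<odot> z = x \<odot> (y \<odot> z)"])
  show "Delta0 D D S (\<lambda>e. x \<odot> y \<odot> e 0 = x \<odot> (y \<odot> e 0))" by (intro Delta0_intros assms)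
qed (use assms in \<open>simp_all add: mul_zero mul_succ r_distr r_one\<close>)

lemma m_lcomm: "x \<in> D \<Longrightarrow> y \<in> D \<Longrightarrow> z \<in> D \<Longrightarrow> x \<odot> (y \<odot> z) = y \<odot> (x \<odot> z)"
  by (metis m_assoc m_comm)

lemmas semiring_simps = a_assoc a_comm a_lcomm m_assoc m_comm m_lcomm l_distr r_distr r_one l_one
  l_null mul_zero l_zero add_zero

lemma a_cancel: assumes "x \<in> D" "y \<in> D" "z \<in> D" shows "x \<oplus> z = y \<oplus> z \<longleftrightarrow> x = y"
proof
  have "x \<oplus> z = y \<oplus> z \<longrightarrow> x = y"
  proof (rule Delta0_induct[where P = "\<lambda>z. x \<oplus> z = y \<oplus> z \<longrightarrow> x = y"])
    show "Delta0 D D S (\<lambda>e. x \<oplus> e 0 = y \<oplus> e 0 \<longrightarrow> x = y)" by (intro Delta0_intros assms)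
    show "x \<oplus> (z \<oplus> \<one>) = y \<oplus> (z \<oplus> \<one>) \<longrightarrow> x = y"
      if "z \<in> D" "x \<oplus> z = y \<oplus> z \<longrightarrow> x = y" for z
      using that assms succ_inj[of "x \<oplus> z" "y \<oplus> z"] by (simp add: add_succ)
  qed (use assms in \<open>simp_all add: add_zero\<close>)
  then show "x \<oplus> z = y \<oplus> z \<Longrightarrow> x = y" by blast
qed simp

lemma a_lcancel: "x \<in> D \<Longrightarrow> y \<in> D \<Longrightarrow> z \<in> D \<Longrightarrow> z \<oplus> x = z \<oplus> y \<longleftrightarrow> x = y"
  using a_cancel[of x y z] by (simp add: a_comm)

lemma less_add_succ: assumes "x \<in> D" "y \<in> D" shows "x \<prec> x \<oplus> (y \<oplus> \<one>)"
proof (rule Delta0_induct[where P = "\<lambda>y. x \<prec> x \<oplus> (y \<oplus> \<one>)"])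
  show "Delta0 D D S (\<lambda>e. x \<prec> x \<oplus> (e 0 \<oplus> \<one>))" by (intro Delta0_intros assms)
qed (use assms in \<open>simp_all add: l_zero add_succ less_succ\<close>)

lemma less_difference: assumes "x \<in> D" "y \<in> D" "x \<prec> y" obtains z where "z \<in> D" "y = x \<oplus> (z \<oplus> \<one>)"
proof -
  have "\<exists>z\<in>D. x \<prec> y \<longrightarrow> y = x \<oplus> (z \<oplus> \<one>)"
  proof (rule Sigma1_induct[where P = "\<lambda>y. \<exists>z\<in>D. x \<prec> y \<longrightarrow> y = x \<oplus> (z \<oplus> \<one>)"])
    show "Sigma1 D D S (\<lambda>e. \<exists>z\<in>D. x \<prec> e 0 \<longrightarrow> e 0 = x \<oplus> (z \<oplus> \<one>))"
      by (intro Sigma1_ex_Delta0 Delta0_intros assms)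
    show "\<exists>z\<in>D. x \<prec> \<zero> \<longrightarrow> \<zero> = x \<oplus> (z \<oplus> \<one>)" using not_less_zero assms zero_in by blast
    fix y assume y: "y \<in> D" "\<exists>z\<in>D. x \<prec> y \<longrightarrow> y = x \<oplus> (z \<oplus> \<one>)"
    show "\<exists>z\<in>D. x \<prec> y \<oplus> \<one> \<longrightarrow> y \<oplus> \<one> = x \<oplus> (z \<oplus> \<one>)"
    proof (cases "x = y")
      case True
      then show ?thesis by (intro bexI[of _ \<zero>]) (simp_all add: l_zero)
    next
      case False
      obtain z where "z \<in> D" "x \<prec> y \<longrightarrow> y = x \<oplus> (z \<oplus> \<one>)" using y by blast
      then show ?thesis using False y assms
        by (intro bexI[of _ "z \<oplus> \<one>"]) (auto simp: less_succ add_succ)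
    qed
  qed (use assms in auto)
  then show ?thesis using assms that by blast
qed

lemma less_irrefl: assumes "x \<in> D" shows "\<not> x \<prec> x"
proof
  assume "x \<prec> x"
  then obtain z where "z \<in> D" "x \<oplus> \<zero> = x \<oplus> (z \<oplus> \<one>)"
    using less_difference assms add_zero by metis
  then show False using a_lcancel[of \<zero> "z \<oplus> \<one>" x] assms succ_not_zero by auto
qed

lemma less_trans: assumes "x \<in> D" "y \<in> D" "z \<in> D" "x \<prec> y" "y \<prec> z" shows "x \<prec> z"
proof -
  obtain u v where "u \<in> D" "y = x \<oplus> (u \<oplus> \<one>)" "v \<in> D" "z = y \<oplus> (v \<oplus> \<one>)"
    using less_difference assms by metis
  then have "z = x \<oplus> ((u \<oplus> \<one> \<oplus> v) \<oplus> \<one>)" using assms by (simp add: a_assoc)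
  then show ?thesis using less_add_succ assms \<open>u \<in> D\<close> \<open>v \<in> D\<close> by simp
qed

lemma zero_or_succ: assumes "x \<in> D" obtains "x = \<zero>" | y where "y \<in> D" "x = y \<oplus> \<one>"
proof -
  have "x = \<zero> \<or> \<zero> \<prec> x"
  proof (rule Delta0_induct[where P = "\<lambda>x. x = \<zero> \<or> \<zero> \<prec> x"])
    show "Delta0 D D S (\<lambda>e. e 0 = \<zero> \<or> \<zero> \<prec> e 0)" by (intro Delta0_intros)
  qed (use assms less_succ in auto)
  then show ?thesis using that less_difference[of \<zero> x] assms l_zero by auto
qed

lemma less_linear: assumes "x \<in> D" "y \<in> D" shows "x \<prec> y \<or> x = y \<or> y \<prec> x"
proof (rule Delta0_induct[where P = "\<lambda>x. x \<prec> y \<or> x = y \<or> y \<prec> x"])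
  show "Delta0 D D S (\<lambda>e. e 0 \<prec> y \<or> e 0 = y \<or> y \<prec> e 0)" by (intro Delta0_intros assms)
  show "\<zero> \<prec> y \<or> \<zero> = y \<or> y \<prec> \<zero>"
    by (rule zero_or_succ[OF assms(2)]) (use less_add_succ[of \<zero>] in \<open>auto simp: l_zero\<close>)
  fix x assume x: "x \<in> D" "x \<prec> y \<or> x = y \<or> y \<prec> x"
  then consider "x \<prec> y" | "x = y \<or> y \<prec> x" by blast
  then show "x \<oplus> \<one> \<prec> y \<or> x \<oplus> \<one> = y \<or> y \<prec> x \<oplus> \<one>"
  proof cases
    case 1
    then obtain z where z: "z \<in> D" "y = x \<oplus> (z \<oplus> \<one>)" using less_difference x assms by blast
    then have y: "y = x \<oplus> \<one> \<oplus> z" using x by (simp add: a_assoc a_comm a_lcomm)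
    show ?thesis
      by (rule zero_or_succ[OF z(1)]) (use x y less_add_succ[of "x \<oplus> \<one>"] in \<open>auto simp: add_zero\<close>)
  next
    case 2
    then show ?thesis using x less_succ assms by auto
  qed
qed (use assms in auto)

lemma le_iff_add: assumes "x \<in> D" "y \<in> D" shows "x \<preceq> y \<longleftrightarrow> (\<exists>z\<in>D. y = x \<oplus> z)"
proof
  assume "x \<preceq> y"
  then show "\<exists>z\<in>D. y = x \<oplus> z"
    using less_succ[of x y] less_difference[of x y] add_zero[of x] assms zero_in one_in add_in
    by metis
next
  assume "\<exists>z\<in>D. y = x \<oplus> z"
  then show "x \<preceq> y" using less_add_succ[of x] assms by (auto simp: a_assoc)
qed

lemma le_add: "x \<in> D \<Longrightarrow> y \<in> D \<Longrightarrow> x \<preceq> x \<oplus> y" "x \<in> D \<Longrightarrow> y \<in> D \<Longrightarrow> x \<preceq> y \<oplus> x"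
  using le_iff_add[of x "x \<oplus> y"] le_iff_add[of x "y \<oplus> x"] a_comm by auto

lemma le_refl: "x \<in> D \<Longrightarrow> x \<preceq> x"
  using less_succ by simp

lemma less_imp_le: "x \<in> D \<Longrightarrow> y \<in> D \<Longrightarrow> x \<prec> y \<Longrightarrow> x \<preceq> y"
  using less_succ by simp

lemma le_trans: "x \<in> D \<Longrightarrow> y \<in> D \<Longrightarrow> z \<in> D \<Longrightarrow> x \<preceq> y \<Longrightarrow> y \<preceq> z \<Longrightarrow> x \<preceq> z"
  using less_succ less_trans by metis

lemma le_less_trans: "x \<in> D \<Longrightarrow> y \<in> D \<Longrightarrow> z \<in> D \<Longrightarrow> x \<preceq> y \<Longrightarrow> y \<prec> z \<Longrightarrow> x \<prec> z"
  using less_succ less_trans by metis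

lemma less_le_trans: "x \<in> D \<Longrightarrow> y \<in> D \<Longrightarrow> z \<in> D \<Longrightarrow> x \<prec> y \<Longrightarrow> y \<preceq> z \<Longrightarrow> x \<prec> z"
  using less_succ less_trans by metis

lemma not_less: "x \<in> D \<Longrightarrow> y \<in> D \<Longrightarrow> \<not> x \<prec> y \<longleftrightarrow> y \<preceq> x"
  using less_linear less_succ less_irrefl less_trans by metis

lemma zero_le: "x \<in> D \<Longrightarrow> \<zero> \<preceq> x"
  using le_add(1)[of \<zero> x] by (simp add: l_zero)

lemma add_mono:
  assumes "x \<in> D" "y \<in> D" "x' \<in> D" "y' \<in> D" "x \<preceq> x'" "y \<preceq> y'" shows "x \<oplus> y \<preceq> x' \<oplus> y'"
proof -
  obtain u v where "u \<in> D" "x' = x \<oplus> u" "v \<in> D" "y' = y \<oplus> v" using assms le_iff_add by metis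
  then have "x' \<oplus> y' = x \<oplus> y \<oplus> (u \<oplus> v)" using assms by (simp add: a_assoc a_lcomm)
  then show ?thesis using le_add(1)[of "x \<oplus> y" "u \<oplus> v"] assms \<open>u \<in> D\<close> \<open>v \<in> D\<close> by simp
qed

lemma mul_mono:
  assumes "x \<in> D" "y \<in> D" "x' \<in> D" "y' \<in> D" "x \<preceq> x'" "y \<preceq> y'" shows "x \<odot> y \<preceq> x' \<odot> y'"
proof -
  obtain u v where uv: "u \<in> D" "x' = x \<oplus> u" "v \<in> D" "y' = y \<oplus> v" using assms le_iff_add by metis
  then have "x' \<odot> y' = x \<odot> y \<oplus> (x \<odot> v \<oplus> u \<odot> y')"
    using assms by (simp add: l_distr r_distr a_assoc a_lcomm)
  then show ?thesis using le_add(1)[of "x \<odot> y" "x \<odot> v \<oplus> u \<odot> y'"] assms uv by simp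
qed

lemma mul_not_zero: assumes "x \<in> D" "y \<in> D" "x \<noteq> \<zero>" "y \<noteq> \<zero>" shows "x \<odot> y \<noteq> \<zero>"
proof -
  obtain u v where "u \<in> D" "x = u \<oplus> \<one>" "v \<in> D" "y = v \<oplus> \<one>" using zero_or_succ assms by metis
  then have "x \<odot> y = (x \<odot> v \<oplus> u) \<oplus> \<one>" using assms by (simp add: mul_succ a_assoc)
  then show ?thesis using succ_not_zero[of "x \<odot> v \<oplus> u"] \<open>u \<in> D\<close> \<open>v \<in> D\<close> assms by simp
qed

lemma add_eq_zero: assumes "x \<in> D" "y \<in> D" "x \<oplus> y = \<zero>" shows "y = \<zero>"
  using assms(2)
proof (cases y rule: zero_or_succ)
  case (2 z)
  then show ?thesis using succ_not_zero[of "x \<oplus> z"] assms by (simp add: add_succ)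
qed

lemma le_mul: assumes "x \<in> D" "y \<in> D" "y \<noteq> \<zero>" shows "x \<preceq> x \<odot> y"
proof -
  obtain v where "v \<in> D" "y = v \<oplus> \<one>" using zero_or_succ assms by metis
  then show ?thesis using le_add(2)[of x "x \<odot> v"] assms by (simp add: mul_succ)
qed

lemma common_strict_upper_bound:
  assumes "x \<in> D" "y \<in> D" obtains w where "w \<in> D" "x \<prec> w" "y \<prec> w"
  using le_add(1)[of x y] le_add(2)[of y x] assms by (intro that[of "x \<oplus> y \<oplus> \<one>"]) auto

lemma ex_common_bound_iff:
  "(\<exists>w\<in>D. \<exists>y\<in>D. y \<prec> w \<and> (\<exists>z\<in>D. z \<prec> w \<and> R y z)) \<longleftrightarrow> (\<exists>y\<in>D. \<exists>z\<in>D. R y z)"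
proof
  assume "\<exists>y\<in>D. \<exists>z\<in>D. R y z"
  then obtain y z where yz: "y \<in> D" "z \<in> D" "R y z" by blast
  then obtain w where "w \<in> D" "y \<prec> w" "z \<prec> w" using common_strict_upper_bound by blast
  then show "\<exists>w\<in>D. \<exists>y\<in>D. y \<prec> w \<and> (\<exists>z\<in>D. z \<prec> w \<and> R y z)" using yz by blast
qed blast

lemma ex_common_bound_conj_iff:
  "(\<exists>w\<in>D. (\<exists>y\<in>D. y \<prec> w \<and> P y) \<and> (\<exists>z\<in>D. z \<prec> w \<and> Q z)) \<longleftrightarrow> (\<exists>y\<in>D. P y) \<and> (\<exists>z\<in>D. Q z)"
  using ex_common_bound_iff[of "\<lambda>y z. P y \<and> Q z"] by blast

subsection \<open>Closure properties of \<open>\<Sigma>\<^sup>0\<^sub>1\<close> and \<open>\<Sigma>\<^sup>0\<^sub>2\<close> predicates\<close>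

lemma Delta0_bounding:
  assumes P: "Delta0 D D S (\<lambda>e. P (e 0) (e 1))" and m: "m \<in> D"
    and ex: "\<And>i. i \<in> D \<Longrightarrow> i \<prec> m \<Longrightarrow> \<exists>j\<in>D. P j i"
  shows "\<exists>n\<in>D. \<forall>i\<in>D. i \<prec> m \<longrightarrow> (\<exists>j\<in>D. j \<prec> n \<and> P j i)"
proof -
  let ?B = "\<lambda>n k. \<forall>i\<in>D. i \<prec> k \<longrightarrow> i \<prec> m \<longrightarrow> (\<exists>j\<in>D. j \<prec> n \<and> P j i)"
  have "\<exists>n\<in>D. ?B n m"
  proof (rule Sigma1_induct[where P = "\<lambda>k. \<exists>n\<in>D. ?B n k"])
    show "Sigma1 D D S (\<lambda>e. \<exists>n\<in>D. ?B n (e 0))"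
      by (intro Sigma1_ex_Delta0 Delta0_intros Delta0_comp2[OF P] m)
    show "\<exists>n\<in>D. ?B n \<zero>" using zero_in not_less_zero by blast
    fix k assume k: "k \<in> D" "\<exists>n\<in>D. ?B n k"
    then obtain n where n: "n \<in> D" "?B n k" by blast
    show "\<exists>n\<in>D. ?B n (k \<oplus> \<one>)"
    proof (cases "k \<prec> m")
      case True
      then obtain j where j: "j \<in> D" "P j k" using ex k by blast
      obtain w where w: "w \<in> D" "n \<prec> w" "j \<prec> w" using common_strict_upper_bound n(1) j(1) by blast
      have "\<exists>j\<in>D. j \<prec> w \<and> P j i" if i: "i \<in> D" "i \<preceq> k" "i \<prec> m" for i
      proof (cases "i = k")
        case True
        then show ?thesis using j w(3) by blast
      next
        case False
        then obtain j' where "j' \<in> D" "j' \<prec> n" "P j' i" using n(2) i k less_succ by blast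
        then show ?thesis using less_trans[OF _ n(1) w(1) _ w(2)] by blast
      qed
      then show ?thesis using w(1) by blast
    next
      case False
      then have "?B n (k \<oplus> \<one>)" using n k less_succ by metis
      then show ?thesis using n by blast
    qed
  qed (rule m)
  then show ?thesis by blast
qed

lemma Sigma1_disj:
  assumes "Sigma1 D C U P" "Sigma1 D C U Q" shows "Sigma1 D C U (\<lambda>e. P e \<or> Q e)"
proof -
  obtain P' where P': "Delta0 D C U P'" "\<And>e. range e \<subseteq> D \<Longrightarrow> P e \<longleftrightarrow> (\<exists>z\<in>D. P' (z ## e))"
    using assms(1) by (rule Sigma1E) blast
  obtain Q' where Q': "Delta0 D C U Q'" "\<And>e. range e \<subseteq> D \<Longrightarrow> Q e \<longleftrightarrow> (\<exists>z\<in>D. Q' (z ## e))"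
    using assms(2) by (rule Sigma1E) blast
  show ?thesis
    by (rule Sigma1I[OF Delta0_disj[OF P'(1) Q'(1)]]) (use P'(2) Q'(2) in blast)
qed

lemma Sigma1_conj:
  assumes "Sigma1 D C U P" "Sigma1 D C U Q" shows "Sigma1 D C U (\<lambda>e. P e \<and> Q e)"
proof -
  obtain P' where P': "Delta0 D C U P'" "\<And>e. range e \<subseteq> D \<Longrightarrow> P e \<longleftrightarrow> (\<exists>z\<in>D. P' (z ## e))"
    using assms(1) by (rule Sigma1E) blast
  obtain Q' where Q': "Delta0 D C U Q'" "\<And>e. range e \<subseteq> D \<Longrightarrow> Q e \<longleftrightarrow> (\<exists>z\<in>D. Q' (z ## e))"
    using assms(2) by (rule Sigma1E) blast
  have "Sigma1 D C U (\<lambda>e. \<exists>w\<in>D. (\<exists>z\<in>D. z \<prec> w \<and> P' (z ## e)) \<and> (\<exists>z\<in>D. z \<prec> w \<and> Q' (z ## e)))"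
    by (intro Sigma1_ex_Delta0 Delta0_conj Delta0_bex Delta0_subst[OF P'(1)] Delta0_subst[OF Q'(1)]
        term_fun_cons term_fun_var)
  then show ?thesis
    by (rule Sigma1_cong) (simp add: ex_common_bound_conj_iff P'(2) Q'(2))
qed

lemma Sigma1_ex:
  assumes "Sigma1 D C U (\<lambda>e. P (e 0) (\<lambda>i. e (Suc i)))" shows "Sigma1 D C U (\<lambda>e. \<exists>y\<in>D. P y e)"
proof -
  obtain Q where Q: "Delta0 D C U Q"
    "\<And>e. range e \<subseteq> D \<Longrightarrow> P (e 0) (\<lambda>i. e (Suc i)) \<longleftrightarrow> (\<exists>z\<in>D. Q (z ## e))"
    using assms by (rule Sigma1E) blast
  have "P y e \<longleftrightarrow> (\<exists>z\<in>D. Q (z ## y ## e))" if "range e \<subseteq> D" "y \<in> D" for y e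
    using Q(2)[of "y ## e"] that by simp
  moreover have "Sigma1 D C U (\<lambda>e. \<exists>w\<in>D. \<exists>y\<in>D. y \<prec> w \<and> (\<exists>z\<in>D. z \<prec> w \<and> Q (z ## y ## e)))"
    by (intro Sigma1_ex_Delta0 Delta0_bex Delta0_subst[OF Q(1)] term_fun_cons term_fun_var)
  ultimately show ?thesis
    by (elim Sigma1_cong) (simp add: ex_common_bound_iff)
qed

lemma Sigma1_ball:
  assumes C: "C \<subseteq> D" and U: "U \<subseteq> S" and t: "term_fun C t"
    and P: "Sigma1 D C U (\<lambda>e. P (e 0) (\<lambda>i. e (Suc i)))"
  shows "Sigma1 D C U (\<lambda>e. \<forall>y\<in>D. y \<prec> t e \<longrightarrow> P y e)"
proof -
  obtain Q where Q: "Delta0 D C U Q"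
    "\<And>e. range e \<subseteq> D \<Longrightarrow> P (e 0) (\<lambda>i. e (Suc i)) \<longleftrightarrow> (\<exists>z\<in>D. Q (z ## e))"
    using P by (rule Sigma1E) blast
  have "Sigma1 D C U (\<lambda>e. \<exists>w\<in>D. \<forall>y\<in>D. y \<prec> t e \<longrightarrow> (\<exists>z\<in>D. z \<prec> w \<and> Q (z ## y ## e)))"
    by (intro Sigma1_ex_Delta0 Delta0_ball Delta0_bex Delta0_subst[OF Q(1)] term_fun_cons
        term_fun_var term_fun_shift[OF t])
  then show ?thesis
  proof (rule Sigma1_cong)
    fix e :: "nat \<Rightarrow> 'a" assume e: "range e \<subseteq> D"
    have P_iff: "P y e \<longleftrightarrow> (\<exists>z\<in>D. Q (z ## y ## e))" if "y \<in> D" for y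
      using Q(2)[of "y ## e"] e that by simp
    have "Delta0 D D S (\<lambda>e'. Q (e' 0 ## e' 1 ## e))"
      by (intro Delta0_subst[OF Delta0_mono[OF Q(1) C U]] term_fun_cons term_fun_var term_fun_const)
        (use e in auto)
    from Delta0_bounding[where P = "\<lambda>z y. Q (z ## y ## e)",
        OF this term_fun_in_dom[OF t closed_dom C e]]
    show "(\<exists>w\<in>D. \<forall>y\<in>D. y \<prec> t e \<longrightarrow> (\<exists>z\<in>D. z \<prec> w \<and> Q (z ## y ## e)))
        \<longleftrightarrow> (\<forall>y\<in>D. y \<prec> t e \<longrightarrow> P y e)"
      using P_iff by blast
  qed
qed

lemma Pi1_if_Delta0: "Delta0 D C U P \<Longrightarrow> Pi1 D C U P"
  unfolding Pi1_def by (intro Sigma1_if_Delta0 Delta0_not)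

lemma Sigma1_not: "Pi1 D C U P \<Longrightarrow> Sigma1 D C U (\<lambda>e. \<not> P e)"
  by (simp add: Pi1_def)

lemma Pi1_not: "Sigma1 D C U P \<Longrightarrow> Pi1 D C U (\<lambda>e. \<not> P e)"
  by (simp add: Pi1_def)

lemma Pi1_conj: "Pi1 D C U P \<Longrightarrow> Pi1 D C U Q \<Longrightarrow> Pi1 D C U (\<lambda>e. P e \<and> Q e)"
  unfolding Pi1_def using Sigma1_disj[of C U "\<lambda>e. \<not> P e" "\<lambda>e. \<not> Q e"] by simp

lemma Pi1_imp: "Sigma1 D C U P \<Longrightarrow> Pi1 D C U Q \<Longrightarrow> Pi1 D C U (\<lambda>e. P e \<longrightarrow> Q e)"
  unfolding Pi1_def using Sigma1_conj[of C U P "\<lambda>e. \<not> Q e"] by simp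

lemma Sigma1_imp: "Pi1 D C U P \<Longrightarrow> Sigma1 D C U Q \<Longrightarrow> Sigma1 D C U (\<lambda>e. P e \<longrightarrow> Q e)"
  unfolding imp_conv_disj by (intro Sigma1_disj Sigma1_not)

lemma Pi1_all:
  "Pi1 D C U (\<lambda>e. P (e 0) (\<lambda>i. e (Suc i))) \<Longrightarrow> Pi1 D C U (\<lambda>e. \<forall>y\<in>D. P y e)"
  unfolding Pi1_def using Sigma1_ex[of C U "\<lambda>y e. \<not> P y e"] by simp

lemma Pi1_bex:
  "C \<subseteq> D \<Longrightarrow> U \<subseteq> S \<Longrightarrow> term_fun C t \<Longrightarrow> Pi1 D C U (\<lambda>e. P (e 0) (\<lambda>i. e (Suc i)))
   \<Longrightarrow> Pi1 D C U (\<lambda>e. \<exists>y\<in>D. y \<prec> t e \<and> P y e)"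
  unfolding Pi1_def using Sigma1_ball[of C U t "\<lambda>y e. \<not> P y e"] by simp

lemma Sigma2_if_Pi1:
  assumes "Pi1 D C U P" "C \<subseteq> D" shows "Sigma2 D C U P"
proof -
  have "Pi1 D C U (\<lambda>e. P (\<lambda>i. e (Suc i)))"
    by (rule Pi1_subst[OF assms(1) term_fun_var closed_dom assms(2)])
  moreover have "P e \<longleftrightarrow> (\<exists>z\<in>D. P (\<lambda>i. (z ## e) (Suc i)))" for e
    by (auto intro: zero_in)
  ultimately show ?thesis by (rule Sigma2I)
qed

lemma Sigma2_if_Sigma1: "Sigma1 D C U P \<Longrightarrow> Sigma2 D C U P"
  using Pi1_if_Delta0 by (elim Sigma1E) (rule Sigma2I, blast+)

lemma Sigma2_if_Delta0: "Delta0 D C U P \<Longrightarrow> Sigma2 D C U P"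
  by (intro Sigma2_if_Sigma1 Sigma1_if_Delta0)

lemma Sigma2_conj:
  assumes C: "C \<subseteq> D" and U: "U \<subseteq> S" and P: "Sigma2 D C U P" and Q: "Sigma2 D C U Q"
  shows "Sigma2 D C U (\<lambda>e. P e \<and> Q e)"
proof -
  obtain P' where P': "Pi1 D C U P'" "\<And>e. range e \<subseteq> D \<Longrightarrow> P e \<longleftrightarrow> (\<exists>z\<in>D. P' (z ## e))"
    using P by (rule Sigma2E) blast
  obtain Q' where Q': "Pi1 D C U Q'" "\<And>e. range e \<subseteq> D \<Longrightarrow> Q e \<longleftrightarrow> (\<exists>z\<in>D. Q' (z ## e))"
    using Q by (rule Sigma2E) blast
  let ?R = "\<lambda>w e. (\<exists>z\<in>D. z \<prec> w \<and> P' (z ## e)) \<and> (\<exists>z\<in>D. z \<prec> w \<and> Q' (z ## e))"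
  have "Pi1 D C U (\<lambda>e. ?R (e 0) (\<lambda>i. e (Suc i)))"
    by (intro Pi1_conj Pi1_bex Pi1_subst[OF P'(1)] Pi1_subst[OF Q'(1)] C U closed_dom
        term_fun_cons term_fun_var)
  moreover have "P e \<and> Q e \<longleftrightarrow> (\<exists>w\<in>D. ?R w e)" if "range e \<subseteq> D" for e
    using that by (simp add: ex_common_bound_conj_iff P'(2) Q'(2))
  ultimately show ?thesis by (intro Sigma2I[where Q = "\<lambda>e. ?R (e 0) (\<lambda>i. e (Suc i))"]) simp_all
qed

lemma Sigma2_ex:
  assumes C: "C \<subseteq> D" and U: "U \<subseteq> S" and P: "Sigma2 D C U (\<lambda>e. P (e 0) (\<lambda>i. e (Suc i)))"
  shows "Sigma2 D C U (\<lambda>e. \<exists>y\<in>D. P y e)"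
proof -
  obtain Q where Q: "Pi1 D C U Q"
    "\<And>e. range e \<subseteq> D \<Longrightarrow> P (e 0) (\<lambda>i. e (Suc i)) \<longleftrightarrow> (\<exists>z\<in>D. Q (z ## e))"
    using P by (rule Sigma2E) blast
  have P_iff: "P y e \<longleftrightarrow> (\<exists>z\<in>D. Q (z ## y ## e))" if "range e \<subseteq> D" "y \<in> D" for y e
    using Q(2)[of "y ## e"] that by simp
  let ?R = "\<lambda>w e. \<exists>y\<in>D. y \<prec> w \<and> (\<exists>z\<in>D. z \<prec> w \<and> Q (z ## y ## e))"
  have "Pi1 D C U (\<lambda>e. ?R (e 0) (\<lambda>i. e (Suc i)))"
    by (intro Pi1_bex Pi1_subst[OF Q(1)] C U closed_dom term_fun_cons term_fun_var)
  moreover have "(\<exists>y\<in>D. P y e) \<longleftrightarrow> (\<exists>w\<in>D. ?R w e)" if "range e \<subseteq> D" for e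
    using that by (simp add: ex_common_bound_iff P_iff)
  ultimately show ?thesis by (intro Sigma2I[where Q = "\<lambda>e. ?R (e 0) (\<lambda>i. e (Suc i))"]) simp_all
qed

lemma least_Pi1:
  assumes P: "Pi1 D D S (\<lambda>e. P (e 0))" and t: "t \<in> D" "P t"
  obtains u where "u \<in> D" "P u" "\<And>v. v \<in> D \<Longrightarrow> v \<prec> u \<Longrightarrow> \<not> P v"
proof (rule ccontr)
  assume "\<not> thesis"
  then have step: "\<forall>u\<in>D. P u \<longrightarrow> (\<exists>v\<in>D. v \<prec> u \<and> P v)" using that by blast
  have "\<forall>v\<in>D. v \<prec> t \<oplus> \<one> \<longrightarrow> \<not> P v"
  proof (rule Sigma1_induct[where P = "\<lambda>u. \<forall>v\<in>D. v \<prec> u \<longrightarrow> \<not> P v"])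
    show "Sigma1 D D S (\<lambda>e. \<forall>v\<in>D. v \<prec> e 0 \<longrightarrow> \<not> P v)"
      by (intro Sigma1_ball subset_refl term_fun_var Sigma1_not P)
    show "\<forall>v\<in>D. v \<prec> u \<oplus> \<one> \<longrightarrow> \<not> P v" if "u \<in> D" "\<forall>v\<in>D. v \<prec> u \<longrightarrow> \<not> P v" for u
      using that step less_succ by metis
  qed (use t not_less_zero in auto)
  then show False using t le_refl by blast
qed

end

section \<open>Codes of finite sets and recursion\<close>

context arith_structure
begin

definition divides :: "'m set \<Rightarrow> 'm \<Rightarrow> 'm \<Rightarrow> bool" where
  "divides D d x \<longleftrightarrow> (\<exists>q\<in>D. q \<preceq> x \<and> x = q \<odot> d)"

text \<open>As for the beta function, the moduli are pairwise coprime for small \<open>i\<close> if \<open>m\<close> has enough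
  divisors.\<close>

abbreviation modulus :: "'m \<Rightarrow> 'm \<Rightarrow> 'm" where
  "modulus m i \<equiv> (i \<oplus> \<one>) \<odot> m \<oplus> \<one>"

definition decode :: "'m set \<Rightarrow> 'm \<Rightarrow> 'm \<Rightarrow> 'm set" where
  "decode D x m = {i. divides D (modulus m i) x}"

lemma Delta0_divides:
  "term_fun C s \<Longrightarrow> term_fun C t \<Longrightarrow> Delta0 D C U (\<lambda>e. divides D (s e) (t e))"
  unfolding divides_def
  by (intro Delta0_bex Delta0_eq term_fun.intros) (simp_all add: term_fun_shift term_fun_var)

lemma Delta0_decode:
  "term_fun C s \<Longrightarrow> term_fun C t \<Longrightarrow> term_fun C u \<Longrightarrow> Delta0 D C U (\<lambda>e. s e \<in> decode D (t e) (u e))"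
  unfolding decode_def mem_Collect_eq by (intro Delta0_divides term_fun.intros)

end

context RCA0_model
begin

lemma divides_iff: assumes "d \<in> D" "x \<in> D" shows "divides D d x \<longleftrightarrow> (\<exists>q\<in>D. x = q \<odot> d)"
proof
  assume "\<exists>q\<in>D. x = q \<odot> d"
  then obtain q where q: "q \<in> D" "x = q \<odot> d" by blast
  show "divides D d x"
  proof (cases "d = \<zero>")
    case True
    then show ?thesis using q zero_le[of \<zero>] by (auto simp: divides_def mul_zero)
  next
    case False
    then show ?thesis using q assms le_mul[of q d] by (auto simp: divides_def)
  qed
qed (auto simp: divides_def)

lemma divides_self: "d \<in> D \<Longrightarrow> divides D d d"
  using divides_iff l_one one_in by metis

lemma divides_mul:
  assumes "d \<in> D" "x \<in> D" "y \<in> D" "divides D d x" shows "divides D d (y \<odot> x)"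
proof -
  obtain q where q: "q \<in> D" "x = q \<odot> d" using divides_iff assms by blast
  then have "y \<odot> x = (y \<odot> q) \<odot> d" using assms by (simp add: m_assoc)
  then show ?thesis using divides_iff[of d "y \<odot> x"] q(1) assms mul_in by blast
qed

lemma divides_add_cancel:
  assumes D: "d \<in> D" "x \<in> D" "y \<in> D" and div: "divides D d x" "divides D d (x \<oplus> y)"
  shows "divides D d y"
proof -
  obtain r q where r: "r \<in> D" "x = r \<odot> d" and q: "q \<in> D" "x \<oplus> y = q \<odot> d"
    using divides_iff D div by (metis add_in)
  show ?thesis
  proof (cases "q \<prec> r")
    case True
    then obtain s where s: "s \<in> D" "r = q \<oplus> (s \<oplus> \<one>)" using less_difference q r by blast
    have "x = (x \<oplus> y) \<oplus> (s \<oplus> \<one>) \<odot> d" using q r s D by (simp add: semiring_simps)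
    then have "x \<oplus> \<zero> = x \<oplus> ((s \<oplus> \<one>) \<odot> d \<oplus> y)"
      using D s by (simp add: add_zero a_assoc a_comm a_lcomm)
    then have "(s \<oplus> \<one>) \<odot> d \<oplus> y = \<zero>" using D s by (simp add: a_lcancel)
    then have "y = \<zero>" using add_eq_zero[of "(s \<oplus> \<one>) \<odot> d" y] D s by simp
    then show ?thesis using D divides_iff[of d y] l_null[of d] zero_in by metis
  next
    case False
    then obtain s where s: "s \<in> D" "q = r \<oplus> s" using not_less le_iff_add q r by blast
    then have "x \<oplus> y = x \<oplus> s \<odot> d" using q r D by (simp add: l_distr)
    then show ?thesis using D s divides_iff[of d y] by (auto simp: a_lcancel)
  qed
qed

text \<open>A divisor \<open>d\<close> of \<open>y ((i + 1) m + 1)\<close> with \<open>d = (j + 1) m + 1\<close> also divides \<open>y |i - j|\<close>, hence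
  \<open>y m\<close>, hence \<open>y\<close>.\<close>

lemma modulus_divides_cancel:
  assumes D: "i \<in> D" "j \<in> D" "m \<in> D" "y \<in> D" and "i \<noteq> j"
    and m: "\<And>z. z \<in> D \<Longrightarrow> z \<prec> i \<or> z \<prec> j \<Longrightarrow> divides D (z \<oplus> \<one>) m"
    and div: "divides D (modulus m j) (y \<odot> modulus m i)"
  shows "divides D (modulus m j) y"
proof -
  let ?d = "modulus m j"
  have div_i: "divides D ?d ((j \<oplus> \<one>) \<odot> (y \<odot> modulus m i))" using D div by (simp add: divides_mul)
  have div_j: "divides D ?d (y \<odot> (i \<oplus> \<one>) \<odot> ?d)" using D by (simp add: divides_mul divides_self)
  have "\<exists>z\<in>D. (z \<prec> i \<or> z \<prec> j) \<and> divides D ?d (y \<odot> (z \<oplus> \<one>))"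
  proof (cases "j \<prec> i")
    case True
    then obtain z where z: "z \<in> D" "i = j \<oplus> (z \<oplus> \<one>)" using less_difference D by blast
    have "(j \<oplus> \<one>) \<odot> (y \<odot> modulus m i) \<oplus> y \<odot> (z \<oplus> \<one>) = y \<odot> (i \<oplus> \<one>) \<odot> ?d"
      using z(1) D unfolding z(2) by (simp add: semiring_simps)
    then have "divides D ?d (y \<odot> (z \<oplus> \<one>))"
      using divides_add_cancel[OF _ _ _ div_i, of "y \<odot> (z \<oplus> \<one>)"] div_j z(1) D by simp
    moreover have "z \<prec> i" using less_add_succ[of z j] z D by (simp add: semiring_simps)
    ultimately show ?thesis using z(1) by blast
  next
    case False
    then obtain z where z: "z \<in> D" "j = i \<oplus> (z \<oplus> \<one>)"
      using less_difference less_linear D \<open>i \<noteq> j\<close> by metis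
    have "y \<odot> (i \<oplus> \<one>) \<odot> ?d \<oplus> y \<odot> (z \<oplus> \<one>) = (j \<oplus> \<one>) \<odot> (y \<odot> modulus m i)"
      using z(1) D unfolding z(2) by (simp add: semiring_simps)
    then have "divides D ?d (y \<odot> (z \<oplus> \<one>))"
      using divides_add_cancel[OF _ _ _ div_j, of "y \<odot> (z \<oplus> \<one>)"] div_i z(1) D by simp
    moreover have "z \<prec> j" using less_add_succ[of z i] z D by (simp add: semiring_simps)
    ultimately show ?thesis using z(1) by blast
  qed
  then obtain z where z: "z \<in> D" "z \<prec> i \<or> z \<prec> j" "divides D ?d (y \<odot> (z \<oplus> \<one>))" by blast
  then obtain r where r: "r \<in> D" "m = r \<odot> (z \<oplus> \<one>)" using m divides_iff D by (metis add_in one_in)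
  have "(j \<oplus> \<one>) \<odot> (y \<odot> m) = (j \<oplus> \<one>) \<odot> r \<odot> (y \<odot> (z \<oplus> \<one>))"
    using D r(1) z(1) unfolding r(2) by (simp add: m_assoc m_lcomm)
  then have "divides D ?d ((j \<oplus> \<one>) \<odot> (y \<odot> m))"
    using D r(1) z by (simp add: divides_mul)
  moreover have "(j \<oplus> \<one>) \<odot> (y \<odot> m) \<oplus> y = y \<odot> ?d" using D by (simp add: semiring_simps)
  ultimately show ?thesis
    using divides_add_cancel[of ?d "(j \<oplus> \<one>) \<odot> (y \<odot> m)" y] D by (simp add: divides_mul divides_self)
qed

lemma common_multiple:
  assumes f: "term_fun D (\<lambda>e. f (e 0))" "\<And>k. k \<in> D \<Longrightarrow> f k \<in> D \<and> f k \<noteq> \<zero>" and N: "N \<in> D"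
  obtains m where "m \<in> D" "m \<noteq> \<zero>" "\<And>z. z \<in> D \<Longrightarrow> z \<prec> N \<Longrightarrow> divides D (f z) m"
proof -
  let ?P = "\<lambda>k. \<exists>m\<in>D. m \<noteq> \<zero> \<and> (\<forall>z\<in>D. z \<prec> k \<longrightarrow> divides D (f z) m)"
  have "?P N"
  proof (rule Sigma1_induct[where P = ?P])
    show "Sigma1 D D S (\<lambda>e. ?P (e 0))"
      by (intro Sigma1_ex_Delta0 Delta0_conj Delta0_not Delta0_eq Delta0_ball Delta0_divides
          term_fun_var term_fun_zero f(1))
    show "?P \<zero>"
      using not_less_zero succ_not_zero[OF zero_in] by (intro bexI[of _ "\<zero> \<oplus> \<one>"]) auto
    fix k assume k: "k \<in> D" "?P k"
    then obtain m where m: "m \<in> D" "m \<noteq> \<zero>" "\<And>z. z \<in> D \<Longrightarrow> z \<prec> k \<Longrightarrow> divides D (f z) m" by blast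
    have "divides D (f z) (m \<odot> f k)" if z: "z \<in> D" "z \<preceq> k" for z
    proof (cases "z = k")
      case True
      then show ?thesis using f(2) m(1) k(1) by (simp add: divides_mul divides_self)
    next
      case False
      then have "divides D (f z) (f k \<odot> m)" using z k(1) less_succ m f(2) by (simp add: divides_mul)
      then show ?thesis using m_comm[OF m(1)] f(2)[OF k(1)] by simp
    qed
    moreover have "m \<odot> f k \<noteq> \<zero>" using m k(1) f(2) by (simp add: mul_not_zero)
    ultimately show "?P (k \<oplus> \<one>)" using m(1) k(1) f(2) mul_in by blast
  qed (rule N)
  then show ?thesis using that by blast
qed

lemma quotient_less:
  assumes "d \<in> D" "d \<noteq> \<zero>" "q \<in> D" "q \<noteq> \<zero>" shows "q \<prec> q \<odot> (d \<oplus> \<one>)"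
proof -
  obtain w where "w \<in> D" "q \<odot> d = w \<oplus> \<one>"
    using zero_or_succ[of "q \<odot> d"] mul_not_zero assms by (metis mul_in)
  then show ?thesis using assms less_add_succ[of q w] by (simp add: mul_succ a_comm)
qed

text \<open>The code of a set is the least common multiple of its moduli, hence is bounded by a common
  multiple of all of them, independently of the set.\<close>

lemma Sigma1_least_code:
  assumes N: "N \<in> D" and m: "m \<in> D" "m \<noteq> \<zero>" "\<And>z. z \<in> D \<Longrightarrow> z \<prec> N \<Longrightarrow> divides D (z \<oplus> \<one>) m"
    and B: "B \<in> D" "B \<noteq> \<zero>" "\<And>i. i \<in> D \<Longrightarrow> i \<prec> N \<Longrightarrow> divides D (modulus m i) B"
    and X: "Sigma1 D D S (\<lambda>e. X (e 0))"
  shows "\<exists>x\<in>D. x \<preceq> B \<and> (\<forall>i\<in>D. i \<prec> N \<longrightarrow> (i \<in> decode D x m \<longleftrightarrow> X i))"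
proof -
  let ?P = "\<lambda>x. x \<noteq> \<zero> \<and> (\<forall>i\<in>D. i \<prec> N \<longrightarrow> X i \<longrightarrow> i \<in> decode D x m)"
  have modulus: "modulus m i \<in> D" if "i \<in> D" for i using that m by simp
  have "Pi1 D D S (\<lambda>e. ?P (e 0))"
    by (intro Pi1_conj Pi1_all Pi1_imp Sigma1_comp1[OF X _ closed_dom subset_refl] Pi1_if_Delta0
        Sigma1_if_Delta0 Delta0_not Delta0_eq Delta0_less Delta0_decode term_fun.intros N m(1))
  moreover have PB: "?P B" using B by (simp add: decode_def)
  ultimately obtain x where x: "x \<in> D" "?P x" and least: "\<And>y. y \<in> D \<Longrightarrow> y \<prec> x \<Longrightarrow> \<not> ?P y"
    using least_Pi1[of ?P B] B(1) by blast
  have "X i" if i: "i \<in> D" "i \<prec> N" "i \<in> decode D x m" for i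
  proof (rule ccontr)
    assume "\<not> X i"
    obtain y where y: "y \<in> D" "x = y \<odot> modulus m i"
      using i x modulus divides_iff[of "modulus m i" x] by (auto simp: decode_def)
    then have "y \<noteq> \<zero>" using x modulus[OF i(1)] l_null by auto
    have "j \<in> decode D y m" if j: "j \<in> D" "j \<prec> N" "X j" for j
      unfolding decode_def mem_Collect_eq
    proof (rule modulus_divides_cancel[OF i(1) j(1) m(1) y(1)])
      show "i \<noteq> j" using j(3) \<open>\<not> X i\<close> by blast
      show "divides D (modulus m j) (y \<odot> modulus m i)" using x(2) j y(2) by (auto simp: decode_def)
      show "divides D (z \<oplus> \<one>) m" if "z \<in> D" "z \<prec> i \<or> z \<prec> j" for z
        using that m(3) less_trans N i(1,2) j(1,2) by blast
    qed
    moreover have "y \<prec> x"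
      using quotient_less[of "(i \<oplus> \<one>) \<odot> m" y] mul_not_zero[of "i \<oplus> \<one>" m] succ_not_zero
        \<open>y \<noteq> \<zero>\<close> y m i(1) by simp
    ultimately show False using least[OF y(1)] \<open>y \<noteq> \<zero>\<close> by blast
  qed
  moreover have "x \<preceq> B" using least[OF B(1)] PB not_less[OF B(1) x(1)] by blast
  ultimately show ?thesis using x by blast
qed

lemma Sigma1_codes:
  assumes N: "N \<in> D"
  obtains m B where "m \<in> D" "B \<in> D" "\<And>X. Sigma1 D D S (\<lambda>e. X (e 0)) \<Longrightarrow>
    \<exists>x\<in>D. x \<preceq> B \<and> (\<forall>i\<in>D. i \<prec> N \<longrightarrow> (i \<in> decode D x m \<longleftrightarrow> X i))"
proof -
  obtain m where m: "m \<in> D" "m \<noteq> \<zero>" "\<And>z. z \<in> D \<Longrightarrow> z \<prec> N \<Longrightarrow> divides D (z \<oplus> \<one>) m"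
    using common_multiple[of "\<lambda>k. k \<oplus> \<one>" N] N succ_not_zero
      term_fun_add[OF term_fun_var term_fun_one]
    by auto
  have "term_fun D (\<lambda>e. modulus m (e 0))" by (intro term_fun.intros m(1))
  then obtain B where "B \<in> D" "B \<noteq> \<zero>" "\<And>i. i \<in> D \<Longrightarrow> i \<prec> N \<Longrightarrow> divides D (modulus m i) B"
    using common_multiple[of "modulus m" N] N m(1) succ_not_zero by (metis add_in mul_in one_in)
  then show ?thesis using that Sigma1_least_code[OF N m] m(1) by blast
qed

context
  fixes G :: "'a \<Rightarrow> 'a set \<Rightarrow> bool"
  assumes G_local: "\<And>t X X'. t \<in> D \<Longrightarrow> (\<And>u. u \<in> D \<Longrightarrow> u \<prec> t \<Longrightarrow> u \<in> X \<longleftrightarrow> u \<in> X') \<Longrightarrow> G t X = G t X'"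
    and Delta0_G: "Delta0 D D S (\<lambda>e. G (e 0) (decode D (e 1) (e 2)))"
begin

definition approximates :: "'a \<Rightarrow> 'a \<Rightarrow> 'a \<Rightarrow> bool" where
  "approximates x m t \<longleftrightarrow> (\<forall>i\<in>D. i \<prec> t \<longrightarrow> (i \<in> decode D x m \<longleftrightarrow> G i (decode D x m)))"

lemmas Delta0_G_decode = Delta0_comp3[where P = "\<lambda>i x m. G i (decode D x m)", OF Delta0_G]

lemma Delta0_approximates:
  "term_fun D s \<Longrightarrow> term_fun D t \<Longrightarrow> term_fun D u \<Longrightarrow> Delta0 D D S (\<lambda>e. approximates (s e) (t e) (u e))"
proof (rule Delta0_comp3[where P = approximates])
  show "Delta0 D D S (\<lambda>e. approximates (e 0) (e 1) (e 2))"
    unfolding approximates_def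
    by (intro Delta0_ball Delta0_iff Delta0_decode Delta0_G_decode term_fun_var)
qed

lemma approximates_mono:
  "approximates x m t \<Longrightarrow> t' \<in> D \<Longrightarrow> t \<in> D \<Longrightarrow> t' \<preceq> t \<Longrightarrow> approximates x m t'"
  unfolding approximates_def using less_le_trans by blast

lemma approximates_agree:
  assumes D: "x \<in> D" "m \<in> D" "x' \<in> D" "m' \<in> D" "t \<in> D"
    and approx: "approximates x m t" "approximates x' m' t" and i: "i \<in> D" "i \<prec> t"
  shows "i \<in> decode D x m \<longleftrightarrow> i \<in> decode D x' m'"
proof (rule ccontr)
  let ?P = "\<lambda>i. i \<prec> t \<and> \<not> (i \<in> decode D x m \<longleftrightarrow> i \<in> decode D x' m')"
  have "Pi1 D D S (\<lambda>e. ?P (e 0))" by (intro Pi1_if_Delta0 Delta0_intros Delta0_decode D)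
  moreover assume "\<not> ?thesis"
  ultimately obtain j where j: "j \<in> D" "?P j" "\<And>i. i \<in> D \<Longrightarrow> i \<prec> j \<Longrightarrow> \<not> ?P i"
    using least_Pi1[of ?P i] i by blast
  have "G j (decode D x m) = G j (decode D x' m')"
    by (rule G_local) (use j less_trans[of _ j t] D in blast)+
  then show False using j approx unfolding approximates_def by blast
qed

lemma approximates_succ:
  assumes D: "t \<in> D" and approx: "approximates x m t"
    and below: "\<And>i. i \<in> D \<Longrightarrow> i \<prec> t \<Longrightarrow> i \<in> decode D x' m \<longleftrightarrow> i \<in> decode D x m"
    and at: "t \<in> decode D x' m \<longleftrightarrow> G t (decode D x m)"
  shows "approximates x' m (t \<oplus> \<one>)"
  unfolding approximates_def
proof (intro ballI impI)
  fix i assume i: "i \<in> D" "i \<preceq> t"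
  have G_eq: "G i (decode D x' m) = G i (decode D x m)"
    by (rule G_local) (use i below less_le_trans[of _ i t] D in blast)+
  show "i \<in> decode D x' m \<longleftrightarrow> G i (decode D x' m)"
  proof (cases "i = t")
    case True
    then show ?thesis using at G_eq by blast
  next
    case False
    then show ?thesis using i D less_succ below G_eq approx unfolding approximates_def by blast
  qed
qed

lemma approximation_exists:
  assumes N: "N \<in> D" obtains x m where "x \<in> D" "m \<in> D" "approximates x m N"
proof -
  obtain m B where m: "m \<in> D" "B \<in> D" and code: "\<And>X. Sigma1 D D S (\<lambda>e. X (e 0)) \<Longrightarrow>
      \<exists>x\<in>D. x \<preceq> B \<and> (\<forall>i\<in>D. i \<prec> N \<longrightarrow> (i \<in> decode D x m \<longleftrightarrow> X i))"
    using Sigma1_codes[OF N] by blast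
  let ?P = "\<lambda>t. t \<preceq> N \<longrightarrow> (\<exists>x\<in>D. x \<preceq> B \<and> approximates x m t)"
  have "?P N"
  proof (rule Delta0_induct[where P = ?P])
    show "Delta0 D D S (\<lambda>e. ?P (e 0))" by (intro Delta0_intros Delta0_approximates N m)
    show "?P \<zero>" using zero_le[OF m(2)] not_less_zero by (auto simp: approximates_def)
    fix t assume t: "t \<in> D" "?P t"
    show "?P (t \<oplus> \<one>)"
    proof
      assume "t \<oplus> \<one> \<preceq> N"
      then have tN: "t \<prec> N" using le_refl[of t] less_le_trans[of t "t \<oplus> \<one>" N] t N by simp
      then obtain x where x: "x \<in> D" "approximates x m t" using t N less_imp_le by blast
      let ?X = "\<lambda>i. (i \<prec> t \<and> i \<in> decode D x m) \<or> (i = t \<and> G t (decode D x m))"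
      have "Sigma1 D D S (\<lambda>e. ?X (e 0))"
        by (intro Sigma1_if_Delta0 Delta0_intros Delta0_decode Delta0_G_decode t m x)
      from code[OF this] obtain x' where x': "x' \<in> D" "x' \<preceq> B"
        "\<And>i. i \<in> D \<Longrightarrow> i \<prec> N \<Longrightarrow> i \<in> decode D x' m \<longleftrightarrow> ?X i" by blast
      have "approximates x' m (t \<oplus> \<one>)"
        by (rule approximates_succ[OF t(1) x(2)])
          (use x'(3) t(1) N tN less_trans[of _ t N] less_irrefl in blast)+
      then show "\<exists>x\<in>D. x \<preceq> B \<and> approximates x m (t \<oplus> \<one>)" using x' by blast
    qed
  qed (rule N)
  then show ?thesis using m that N le_refl by blast
qed

lemma union_of_approximations:
  obtains T where "T \<in> S"
    "\<And>t x m. t \<in> D \<Longrightarrow> x \<in> D \<Longrightarrow> m \<in> D \<Longrightarrow> approximates x m (t \<oplus> \<one>) \<Longrightarrow> t \<in> T \<longleftrightarrow> t \<in> decode D x m"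
proof -
  define P where "P t \<longleftrightarrow> (\<exists>x\<in>D. \<exists>m\<in>D. approximates x m (t \<oplus> \<one>) \<and> t \<in> decode D x m)" for t
  have P_iff: "P t \<longleftrightarrow> t \<in> decode D x m"
    if t: "t \<in> D" and x: "x \<in> D" "m \<in> D" "approximates x m (t \<oplus> \<one>)" for t x m
  proof -
    have "t \<in> decode D x m \<longleftrightarrow> t \<in> decode D x' m'"
      if "x' \<in> D" "m' \<in> D" "approximates x' m' (t \<oplus> \<one>)" for x' m'
      by (rule approximates_agree) (use that t x le_refl in auto)
    then show ?thesis unfolding P_def using x by blast
  qed
  have not_P_iff: "\<not> P t \<longleftrightarrow> (\<exists>x\<in>D. \<exists>m\<in>D. approximates x m (t \<oplus> \<one>) \<and> t \<notin> decode D x m)"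
    if t: "t \<in> D" for t
  proof -
    obtain x m where "x \<in> D" "m \<in> D" "approximates x m (t \<oplus> \<one>)"
      using approximation_exists[of "t \<oplus> \<one>"] t by auto
    then show ?thesis using P_iff[OF t] by blast
  qed
  have P: "Sigma1 D D S (\<lambda>e. P (e 0))"
    unfolding P_def
    by (intro Sigma1_ex Sigma1_if_Delta0 Delta0_conj Delta0_approximates Delta0_decode
        term_fun.intros)
  have "Sigma1 D D S (\<lambda>e. \<exists>x\<in>D. \<exists>m\<in>D. approximates x m (e 0 \<oplus> \<one>) \<and> e 0 \<notin> decode D x m)"
    by (intro Sigma1_ex Sigma1_if_Delta0 Delta0_conj Delta0_approximates Delta0_not Delta0_decode
        term_fun.intros)
  then have "Pi1 D D S (\<lambda>e. P (e 0))"
    unfolding Pi1_def by (rule Sigma1_cong) (simp add: not_P_iff image_subset_iff)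
  then obtain T where T: "T \<in> S" "\<forall>t\<in>D. t \<in> T \<longleftrightarrow> P t" using Delta1_comprehension[OF P] by blast
  then show ?thesis using that P_iff by blast
qed

lemma set_recursion: "\<exists>T\<in>S. \<forall>t\<in>D. t \<in> T \<longleftrightarrow> G t T"
proof -
  obtain T where T: "T \<in> S"
    "\<And>t x m. t \<in> D \<Longrightarrow> x \<in> D \<Longrightarrow> m \<in> D \<Longrightarrow> approximates x m (t \<oplus> \<one>) \<Longrightarrow> t \<in> T \<longleftrightarrow> t \<in> decode D x m"
    using union_of_approximations by blast
  have "t \<in> T \<longleftrightarrow> G t T" if t: "t \<in> D" for t
  proof -
    obtain x m where x: "x \<in> D" "m \<in> D" "approximates x m (t \<oplus> \<one>)"
      using approximation_exists[of "t \<oplus> \<one>"] t by auto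
    have T_iff: "i \<in> T \<longleftrightarrow> i \<in> decode D x m" if "i \<in> D" "i \<preceq> t" for i
    proof -
      have "i \<oplus> \<one> \<preceq> t \<oplus> \<one>" using that t add_mono le_refl by simp
      then show ?thesis
        using T(2)[of i x m] approximates_mono[OF x(3)] x t that by simp
    qed
    then have "G t T = G t (decode D x m)" by (intro G_local[OF t]) (use t less_imp_le in blast)
    then show ?thesis
      using x(3) T_iff[OF t le_refl[OF t]] t le_refl[OF t] unfolding approximates_def by blast
  qed
  then show ?thesis using T(1) by blast
qed

end

end

section \<open>Models with a universal set\<close>

primrec num :: "nat \<Rightarrow> trm" where
  "num 0 = Zero"
| "num (Suc n) = Add (num n) One"

abbreviation pair_trm :: "trm \<Rightarrow> trm \<Rightarrow> trm" where
  "pair_trm s t \<equiv> Add (Mul (Add s t) (Add s t)) s"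

abbreviation triple_trm :: "trm \<Rightarrow> trm \<Rightarrow> trm \<Rightarrow> trm" where
  "triple_trm r s t \<equiv> Add (pair_trm r (pair_trm s t)) One"

text \<open>With number variable 0 for \<open>c\<close> and set variables 0 and 1 for \<open>A\<close> and \<open>T\<close>, this says that for
  all \<open>t\<close>, \<open>\<forall>s \<langle>p,t,s\<rangle> \<in> T\<close> iff \<open>\<forall>z p(z,t,c,\<dots>,c;A,T,\<dots>,T)\<close>.\<close>

definition universality_fml :: "fml \<Rightarrow> fml" where
  "universality_fml p = AllN (Iff (AllN (Mem (triple_trm (num (to_nat p)) (Var 1) (Var 0)) 1))
     (AllN (subst_fml (\<lambda>i. Var (min i 2)) (\<lambda>k. min k 1) p)))"

lemma boundN_trm_subst: "(\<And>i. boundN_trm (f i) \<le> N) \<Longrightarrow> boundN_trm (subst_trm f t) \<le> N"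
  by (induction t) auto

lemma boundN_subst: "(\<And>i. boundN_trm (f i) \<le> N) \<Longrightarrow> boundN (subst_fml f g p) \<le> N"
proof (induction p arbitrary: f g N)
  case (AllN p)
  have lift: "boundN_trm (lift_trm t) \<le> Suc (boundN_trm t)" for t
    by (induction t) auto
  have "boundN_trm ((Var 0 ## (\<lambda>i. lift_trm (f i))) i) \<le> Suc N" for i
    using AllN.prems[of "i - 1"] lift[of "f (i - 1)"] by (cases i) auto
  from AllN.IH[where f = "Var 0 ## (\<lambda>i. lift_trm (f i))" and g = g, OF this] show ?case by simp
qed (auto intro: boundN_trm_subst)

lemma boundS_subst: "(\<And>k. g k < N) \<Longrightarrow> boundS (subst_fml f g p) \<le> N"
proof (induction p arbitrary: f g N)
  case (AllS p)
  have "(0 ## (\<lambda>k. Suc (g k))) k < Suc N" for k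
    using AllS.prems by (cases k) auto
  from AllS.IH[where g = "0 ## (\<lambda>k. Suc (g k))" and f = f, OF this] show ?case by simp
next
  case (Mem t k)
  then show ?case by (simp add: Suc_leI)
qed auto

lemma boundN_num [simp]: "boundN_trm (num n) = 0"
  by (induction n) auto

lemma bound_universality_fml: "boundN (universality_fml p) \<le> 1" "boundS (universality_fml p) \<le> 2"
  using boundN_subst[of "\<lambda>i. Var (min i 2)" 3 "\<lambda>k. min k 1" p]
    boundS_subst[of "\<lambda>k. min k 1" 2 "\<lambda>i. Var (min i 2)" p]
  by (auto simp: universality_fml_def)

context arith_structure
begin

primrec std :: "nat \<Rightarrow> 'm" where
  "std 0 = \<zero>"
| "std (Suc n) = std n \<oplus> \<one>"

definition pair :: "'m \<Rightarrow> 'm \<Rightarrow> 'm" where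
  "pair x y = (x \<oplus> y) \<odot> (x \<oplus> y) \<oplus> x"

definition triple :: "'m \<Rightarrow> 'm \<Rightarrow> 'm \<Rightarrow> 'm" where
  "triple x y z = pair x (pair y z) \<oplus> \<one>"

lemma val_num: "val e (num n) = std n"
  by (induction n) auto

lemma term_fun_std: "term_fun C (\<lambda>e. std n)"
  by (induction n) (auto intro: term_fun.intros)

lemma term_fun_pair: "term_fun C s \<Longrightarrow> term_fun C t \<Longrightarrow> term_fun C (\<lambda>e. pair (s e) (t e))"
  unfolding pair_def by (intro term_fun.intros)

lemma term_fun_triple:
  "term_fun C s \<Longrightarrow> term_fun C t \<Longrightarrow> term_fun C u \<Longrightarrow> term_fun C (\<lambda>e. triple (s e) (t e) (u e))"
  unfolding triple_def by (intro term_fun_add term_fun_pair term_fun_one)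

lemma sat_universality_fml:
  "sat D S e \<sigma> (universality_fml p) \<longleftrightarrow> (\<forall>t\<in>D. (\<forall>s\<in>D. triple (std (to_nat p)) t s \<in> \<sigma> 1)
     \<longleftrightarrow> (\<forall>z\<in>D. sat D S (z ## t ## (\<lambda>_. e 0)) (\<sigma> 0 ## (\<lambda>_. \<sigma> 1)) p))"
proof -
  have "(\<lambda>i. val (z ## t ## e) (Var (min i 2))) = z ## t ## (\<lambda>_. e 0)" for z t
    by (auto simp: fun_eq_iff min_def numeral_2_eq_2 split: nat.split)
  moreover have "(\<lambda>k. \<sigma> (min k 1)) = \<sigma> 0 ## (\<lambda>_. \<sigma> 1)"
    by (auto simp: fun_eq_iff min_def split: nat.split)
  ultimately show ?thesis
    by (auto simp: universality_fml_def sat_subst val_num triple_def pair_def)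
qed

lemma Delta0_sat_decode:
  "is_Delta00 p \<Longrightarrow> (\<And>i. term_fun C (\<lambda>e. f e i)) \<Longrightarrow> term_fun C g \<Longrightarrow> term_fun C h \<Longrightarrow> A \<in> U
   \<Longrightarrow> Delta0 D C U (\<lambda>e. sat D S (f e) (A ## (\<lambda>_. decode D (g e) (h e))) p)"
proof (induction arbitrary: f g h rule: is_Delta00_induct)
  case (Mem t k)
  then show ?case by (cases k) (simp_all add: Delta0_mem Delta0_decode term_fun_val)
next
  case (BAll p t)
  have "Delta0 D C U (\<lambda>e. \<forall>y\<in>D. y \<prec> val (f e) t \<longrightarrow>
      sat D S (y ## f e) (A ## (\<lambda>_. decode D (g e) (h e))) p)"
    by (intro Delta0_ball term_fun_val BAll.prems(1) BAll.IH term_fun_cons term_fun_var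
        term_fun_shift[OF BAll.prems(1)] term_fun_shift[OF BAll.prems(2)]
        term_fun_shift[OF BAll.prems(3)] BAll.prems(4))
  then show ?case by simp
next
  case (BEx p t)
  have "Delta0 D C U (\<lambda>e. \<exists>y\<in>D. y \<prec> val (f e) t \<and>
      sat D S (y ## f e) (A ## (\<lambda>_. decode D (g e) (h e))) p)"
    by (intro Delta0_bex term_fun_val BEx.prems(1) BEx.IH term_fun_cons term_fun_var
        term_fun_shift[OF BEx.prems(1)] term_fun_shift[OF BEx.prems(2)]
        term_fun_shift[OF BEx.prems(3)] BEx.prems(4))
  then show ?case by simp
qed (simp_all add: Delta0_eq Delta0_less Delta0_False Delta0_imp term_fun_val)

end

context RCA0_model
begin

lemma std_in [simp]: "std n \<in> D"
  by (induction n) auto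

lemma std_less: "m < n \<Longrightarrow> std m \<prec> std n"
  by (induction n) (auto simp: less_Suc_eq less_succ)

lemma std_inject: "std m = std n \<longleftrightarrow> m = n"
  using std_less[of m n] std_less[of n m] less_irrefl[OF std_in, of m]
  by (cases m n rule: linorder_cases) auto

lemma pair_in [simp]: "x \<in> D \<Longrightarrow> y \<in> D \<Longrightarrow> pair x y \<in> D"
  by (simp add: pair_def)

lemma pair_less:
  assumes D: "x \<in> D" "y \<in> D" "x' \<in> D" "y' \<in> D" and less: "x \<oplus> y \<prec> x' \<oplus> y'"
  shows "pair x y \<prec> pair x' y'"
proof -
  obtain z where z: "z \<in> D" "x' \<oplus> y' = x \<oplus> y \<oplus> (z \<oplus> \<one>)" using less_difference[OF _ _ less] D by auto
  define w where "w = (x \<oplus> y) \<odot> (z \<oplus> \<one>) \<oplus> (z \<odot> (x \<oplus> y) \<oplus> (y \<oplus> (z \<odot> (z \<oplus> \<one>) \<oplus> (z \<oplus> x'))))"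
  have "w \<in> D" using z D by (simp add: w_def)
  moreover have "pair x' y' = pair x y \<oplus> (w \<oplus> \<one>)"
    using z(1) D unfolding pair_def z(2) w_def by (simp add: semiring_simps)
  ultimately show ?thesis using less_add_succ D by simp
qed

lemma pair_inject:
  assumes D: "x \<in> D" "y \<in> D" "x' \<in> D" "y' \<in> D"
  shows "pair x y = pair x' y' \<longleftrightarrow> x = x' \<and> y = y'"
proof
  assume eq: "pair x y = pair x' y'"
  then have sum: "x \<oplus> y = x' \<oplus> y'"
    using less_linear[of "x \<oplus> y" "x' \<oplus> y'"] pair_less[of x y x' y'] pair_less[of x' y' x y] D
      less_irrefl[of "pair x y"] by auto
  then have "x = x'" using eq D a_lcancel[of x x' "(x \<oplus> y) \<odot> (x \<oplus> y)"] by (simp add: pair_def)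
  then show "x = x' \<and> y = y'" using sum D a_lcancel[of y y' x] by simp
qed simp

lemma fst_le_pair: "x \<in> D \<Longrightarrow> y \<in> D \<Longrightarrow> x \<preceq> pair x y"
  unfolding pair_def using le_add by simp

lemma snd_le_pair: assumes "x \<in> D" "y \<in> D" shows "y \<preceq> pair x y"
proof (cases "x \<oplus> y = \<zero>")
  case True
  then have "y = \<zero>" using add_eq_zero assms by blast
  then show ?thesis using assms zero_le by simp
next
  case False
  have "y \<preceq> x \<oplus> y" using assms by (simp add: le_add)
  moreover have "x \<oplus> y \<preceq> (x \<oplus> y) \<odot> (x \<oplus> y)" using assms False by (simp add: le_mul)
  moreover have "(x \<oplus> y) \<odot> (x \<oplus> y) \<preceq> pair x y" unfolding pair_def using assms by (simp add: le_add)
  ultimately show ?thesis using assms le_trans[of y "x \<oplus> y" "(x \<oplus> y) \<odot> (x \<oplus> y)"]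
      le_trans[of y "(x \<oplus> y) \<odot> (x \<oplus> y)" "pair x y"] by simp
qed

lemma triple_in [simp]: "x \<in> D \<Longrightarrow> y \<in> D \<Longrightarrow> z \<in> D \<Longrightarrow> triple x y z \<in> D"
  by (simp add: triple_def)

lemma triple_inject:
  assumes "x \<in> D" "y \<in> D" "z \<in> D" "x' \<in> D" "y' \<in> D" "z' \<in> D"
  shows "triple x y z = triple x' y' z' \<longleftrightarrow> x = x' \<and> y = y' \<and> z = z'"
  using assms succ_inj[of "pair x (pair y z)" "pair x' (pair y' z')"]
  by (auto simp: triple_def pair_inject)

lemma less_triple: assumes "x \<in> D" "y \<in> D" "z \<in> D" shows "y \<prec> triple x y z" "z \<prec> triple x y z"
  using assms le_trans[of y "pair y z" "pair x (pair y z)"]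
    le_trans[of z "pair y z" "pair x (pair y z)"]
  by (simp_all add: triple_def fst_le_pair snd_le_pair)

lemma val_mono:
  assumes "range e \<subseteq> D" "range e' \<subseteq> D" "\<And>i. e i \<preceq> e' i" shows "val e t \<preceq> val e' t"
  using assms by (induction t) (auto intro: add_mono mul_mono val_in_dom[OF closed_dom] le_refl)

subsection \<open>The use of bounded formulas\<close>

text \<open>The truth of a \<open>\<Delta>\<^sup>0\<^sub>0\<close> formula depends only on the elements of its sets up to the value of
  some term; this makes the following recursion for a universal set well-founded.\<close>

definition agree_upto :: "'a \<Rightarrow> (nat \<Rightarrow> 'a set) \<Rightarrow> (nat \<Rightarrow> 'a set) \<Rightarrow> bool" where
  "agree_upto x \<sigma> \<sigma>' \<longleftrightarrow> (\<forall>k. \<forall>u\<in>D. u \<preceq> x \<longrightarrow> (u \<in> \<sigma> k \<longleftrightarrow> u \<in> \<sigma>' k))"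

definition use_bounded :: "fml \<Rightarrow> trm \<Rightarrow> bool" where
  "use_bounded p b \<longleftrightarrow> (\<forall>e \<sigma> \<sigma>'. range e \<subseteq> D \<longrightarrow> agree_upto (val e b) \<sigma> \<sigma>' \<longrightarrow>
     sat D S e \<sigma> p = sat D S e \<sigma>' p)"

lemma agree_upto_mono:
  "agree_upto y \<sigma> \<sigma>' \<Longrightarrow> x \<preceq> y \<Longrightarrow> x \<in> D \<Longrightarrow> y \<in> D \<Longrightarrow> agree_upto x \<sigma> \<sigma>'"
  unfolding agree_upto_def using le_trans by blast

lemma use_boundedD:
  "use_bounded p b \<Longrightarrow> range e \<subseteq> D \<Longrightarrow> agree_upto (val e b) \<sigma> \<sigma>'
   \<Longrightarrow> sat D S e \<sigma> p = sat D S e \<sigma>' p"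
  unfolding use_bounded_def by blast

lemma use_bounded_mono:
  assumes "use_bounded p b" "\<And>e. range e \<subseteq> D \<Longrightarrow> val e b \<preceq> val e b'" shows "use_bounded p b'"
  unfolding use_bounded_def
proof (intro allI impI)
  fix e and \<sigma> \<sigma>' :: "nat \<Rightarrow> 'a set"
  assume e: "range e \<subseteq> D" and agree: "agree_upto (val e b') \<sigma> \<sigma>'"
  have "agree_upto (val e b) \<sigma> \<sigma>'"
    using agree_upto_mono[OF agree] assms(2) e val_in_dom[OF closed_dom] by blast
  then show "sat D S e \<sigma> p = sat D S e \<sigma>' p" using use_boundedD[OF assms(1) e] by blast
qed

lemma use_bounded_below:
  assumes b: "use_bounded p b" and e: "range e \<subseteq> D" and y: "y \<in> D" "y \<prec> val e t"
    and agree: "agree_upto (val e (subst_trm (t ## Var) b)) \<sigma> \<sigma>'"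
  shows "sat D S (y ## e) \<sigma> p = sat D S (y ## e) \<sigma>' p"
proof (rule use_boundedD[OF b])
  have val_t: "val e t \<in> D" using e by (rule val_in_dom[OF closed_dom])
  have "val (y ## e) b \<preceq> val (val e t ## e) b"
    by (rule val_mono) (use e y val_t in
      \<open>auto simp: le_refl less_imp_le image_subset_iff split: nat.split\<close>)
  moreover have "val (y ## e) b \<in> D" "val (val e t ## e) b \<in> D"
    using e y val_t by (simp_all add: val_in_dom[OF closed_dom])
  moreover have "agree_upto (val (val e t ## e) b) \<sigma> \<sigma>'"
    using agree by (simp add: val_subst val_cons_trm)
  ultimately show "agree_upto (val (y ## e) b) \<sigma> \<sigma>'" using agree_upto_mono by blast
qed (use e y in simp)

lemma use_bounded_BAll: "use_bounded p b \<Longrightarrow> use_bounded (BAll t p) (subst_trm (t ## Var) b)"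
  and use_bounded_BEx: "use_bounded p b \<Longrightarrow> use_bounded (BEx t p) (subst_trm (t ## Var) b)"
  using use_bounded_below[of p b]
  by (simp_all add: use_bounded_def[of "AllN _"] use_bounded_def[of "Neg _"])

lemma is_Delta00_use_bounded: "is_Delta00 p \<Longrightarrow> \<exists>b. use_bounded p b"
proof (induction rule: is_Delta00_induct)
  case (Mem t k)
  show ?case
    by (rule exI[of _ t]) (simp add: use_bounded_def agree_upto_def val_in_dom[OF closed_dom]
      le_refl)
next
  case (Imp p q)
  then obtain b b' where "use_bounded p b" "use_bounded q b'" by blast
  then have "use_bounded p (Add b b')" "use_bounded q (Add b b')"
    by (auto elim!: use_bounded_mono simp: le_add val_in_dom[OF closed_dom])
  then show ?case by (intro exI[of _ "Add b b'"]) (simp add: use_bounded_def)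
next
  case (BAll p t)
  then show ?case using use_bounded_BAll by blast
next
  case (BEx p t)
  then show ?case using use_bounded_BEx by blast
qed (auto simp: use_bounded_def)

subsection \<open>Universal sets for finitely many formulas\<close>

text \<open>Here \<open>b\<close> bounds the use of \<open>p\<close>, so only the part of \<open>X\<close> up to \<open>s\<close> matters.\<close>

definition instances_upto :: "trm \<Rightarrow> fml \<Rightarrow> 'a \<Rightarrow> 'a set \<Rightarrow> 'a \<Rightarrow> 'a \<Rightarrow> 'a set \<Rightarrow> bool" where
  "instances_upto b p c A x s X \<longleftrightarrow> (\<forall>z\<in>D. z \<preceq> s \<longrightarrow> val (z ## x ## (\<lambda>_. c)) b \<preceq> s \<longrightarrow>
     sat D S (z ## x ## (\<lambda>_. c)) (A ## (\<lambda>_. X)) p)"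

lemma Delta0_instances_upto:
  assumes "is_Delta00 p" "c \<in> D" "A \<in> S" "term_fun D x" "term_fun D s" "term_fun D g" "term_fun D h"
  shows "Delta0 D D S (\<lambda>e. instances_upto b p c A (x e) (s e) (decode D (g e) (h e)))"
  unfolding instances_upto_def
  by (intro Delta0_ball Delta0_imp Delta0_less Delta0_sat_decode term_fun_val term_fun_cons
      term_fun_add term_fun_one term_fun_var term_fun_const assms term_fun_shift[OF assms(4)]
      term_fun_shift[OF assms(5)] term_fun_shift[OF assms(6)] term_fun_shift[OF assms(7)])

lemma instances_upto_cong:
  assumes b: "use_bounded p b" and D: "c \<in> D" "x \<in> D" "s \<in> D"
    and agree: "\<And>u. u \<in> D \<Longrightarrow> u \<preceq> s \<Longrightarrow> u \<in> X \<longleftrightarrow> u \<in> X'"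
  shows "instances_upto b p c A x s X = instances_upto b p c A x s X'"
proof -
  have "sat D S (z ## x ## (\<lambda>_. c)) (A ## (\<lambda>_. X)) p
    = sat D S (z ## x ## (\<lambda>_. c)) (A ## (\<lambda>_. X')) p"
    if z: "z \<in> D" "val (z ## x ## (\<lambda>_. c)) b \<preceq> s" for z
  proof (rule use_boundedD[OF b])
    have "val (z ## x ## (\<lambda>_. c)) b \<in> D" using z D by (simp add: val_in_dom[OF closed_dom])
    moreover have "agree_upto s (A ## (\<lambda>_. X)) (A ## (\<lambda>_. X'))"
      using agree by (auto simp: agree_upto_def split: nat.split)
    ultimately show "agree_upto (val (z ## x ## (\<lambda>_. c)) b) (A ## (\<lambda>_. X)) (A ## (\<lambda>_. X'))"
      using agree_upto_mono z D by blast
  qed (use z D in simp)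
  then show ?thesis unfolding instances_upto_def by blast
qed

lemma all_instances_upto_iff:
  assumes "c \<in> D" "x \<in> D"
  shows "(\<forall>s\<in>D. instances_upto b p c A x s X)
    \<longleftrightarrow> (\<forall>z\<in>D. sat D S (z ## x ## (\<lambda>_. c)) (A ## (\<lambda>_. X)) p)"
proof
  assume all: "\<forall>s\<in>D. instances_upto b p c A x s X"
  show "\<forall>z\<in>D. sat D S (z ## x ## (\<lambda>_. c)) (A ## (\<lambda>_. X)) p"
  proof
    fix z assume z: "z \<in> D"
    then have v: "val (z ## x ## (\<lambda>_. c)) b \<in> D"
      using assms by (simp add: val_in_dom[OF closed_dom])
    then have "instances_upto b p c A x (z \<oplus> val (z ## x ## (\<lambda>_. c)) b) X" using all z by simp
    then show "sat D S (z ## x ## (\<lambda>_. c)) (A ## (\<lambda>_. X)) p"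
      using z v le_add unfolding instances_upto_def by simp
  qed
qed (auto simp: instances_upto_def)

lemma universal_set_exists:
  assumes F: "finite F" "\<And>p. p \<in> F \<Longrightarrow> is_Delta00 p" and A: "A \<in> S" and c: "c \<in> D"
  obtains T where "T \<in> S" "\<And>p t. p \<in> F \<Longrightarrow> t \<in> D \<Longrightarrow> (\<forall>s\<in>D. triple (std (to_nat p)) t s \<in> T)
    \<longleftrightarrow> (\<forall>z\<in>D. sat D S (z ## t ## (\<lambda>_. c)) (A ## (\<lambda>_. T)) p)"
proof -
  obtain b where b: "\<And>p. p \<in> F \<Longrightarrow> use_bounded p (b p)"
    using is_Delta00_use_bounded[OF F(2)] by metis
  define G where "G t X \<longleftrightarrow> (\<exists>p\<in>F. \<exists>x\<in>D. x \<prec> t \<and> (\<exists>s\<in>D. s \<prec> t \<and>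
    t = triple (std (to_nat p)) x s \<and> instances_upto (b p) p c A x s X))" for t X
  have "\<exists>T\<in>S. \<forall>t\<in>D. t \<in> T \<longleftrightarrow> G t T"
  proof (rule set_recursion)
    show "Delta0 D D S (\<lambda>e. G (e 0) (decode D (e 1) (e 2)))"
      unfolding G_def by (intro Delta0_finite_bex F Delta0_bex Delta0_conj Delta0_eq
          Delta0_instances_upto term_fun_triple term_fun_std term_fun_var c A)
    fix t X X' assume t: "t \<in> D" and agree: "\<And>u. u \<in> D \<Longrightarrow> u \<prec> t \<Longrightarrow> u \<in> X \<longleftrightarrow> u \<in> X'"
    have "instances_upto (b p) p c A x s X = instances_upto (b p) p c A x s X'"
      if "p \<in> F" "x \<in> D" "s \<in> D" "s \<prec> t" for p x s
      by (rule instances_upto_cong[OF b]) (use that t c agree le_less_trans in blast)+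
    then show "G t X = G t X'" unfolding G_def by blast
  qed
  then obtain T where T: "T \<in> S" "\<And>t. t \<in> D \<Longrightarrow> t \<in> T \<longleftrightarrow> G t T" by blast
  have T_iff: "triple (std (to_nat p)) t s \<in> T \<longleftrightarrow> instances_upto (b p) p c A t s T"
    if p: "p \<in> F" and D: "t \<in> D" "s \<in> D" for p t s
  proof -
    have "G (triple (std (to_nat p)) t s) T \<longleftrightarrow> instances_upto (b p) p c A t s T"
      unfolding G_def using p D less_triple[of "std (to_nat p)" t s]
      by (auto simp: triple_inject std_inject)
    then show ?thesis using T(2) D by simp
  qed
  have "(\<forall>s\<in>D. triple (std (to_nat p)) t s \<in> T)
      \<longleftrightarrow> (\<forall>z\<in>D. sat D S (z ## t ## (\<lambda>_. c)) (A ## (\<lambda>_. T)) p)" if "p \<in> F" "t \<in> D" for p t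
    using T_iff[OF that] all_instances_upto_iff[OF c that(2), of "b p" p A T] by simp
  then show ?thesis using that T(1) by blast
qed

end

subsection \<open>Existence of a model with a universal set\<close>

locale universal_model = RCA0_model +
  fixes A T c
  assumes A_in: "A \<in> S" and T_in: "T \<in> S" and c_in: "c \<in> D" and std_less_c: "std n \<prec> c"
    and universal: "is_Delta00 p \<Longrightarrow> t \<in> D \<Longrightarrow> (\<forall>s\<in>D. triple (std (to_nat p)) t s \<in> T)
         \<longleftrightarrow> (\<forall>z\<in>D. sat D S (z ## t ## (\<lambda>_. c)) (A ## (\<lambda>_. T)) p)"

definition universal_axioms :: "fml \<Rightarrow> nat \<Rightarrow> fml set" where
  "universal_axioms \<Psi> k = RCA0 \<union> {AllS \<Psi>} \<union> {Lt (num n) (Var 0) |n. n < k}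
     \<union> {universality_fml p |p. is_Delta00 p \<and> to_nat p < k}"

lemma RCA0_is_sentence: "p \<in> RCA0 \<Longrightarrow> is_sentence p"
  by (auto simp: RCA0_def basic_axioms_def is_sentence_univ_closure)

lemma few_free_vars_sentences: "(\<And>p. p \<in> T \<Longrightarrow> is_sentence p) \<Longrightarrow> few_free_vars T"
  unfolding few_free_vars_def is_sentence_def by (intro exI[of _ 0]) simp

lemma few_free_vars_universal_axioms:
  assumes "is_sentence (ExS (AllS \<Psi>))" shows "few_free_vars (\<Union>k. universal_axioms \<Psi> k)"
proof -
  have "boundN p \<le> 2 \<and> boundS p \<le> 2" if p: "p \<in> universal_axioms \<Psi> k" for p k
  proof -
    consider "p \<in> RCA0" | "p = AllS \<Psi>" | n where "p = Lt (num n) (Var 0)"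
      | q where "p = universality_fml q"
      using p by (auto simp: universal_axioms_def)
    then show ?thesis
    proof cases
      case 1
      then show ?thesis using RCA0_is_sentence by (simp add: is_sentence_def)
    next
      case 4
      then show ?thesis using bound_universality_fml[of q] by simp
    qed (use assms in \<open>auto simp: is_sentence_def\<close>)
  qed
  then show ?thesis unfolding few_free_vars_def by blast
qed

lemma (in RCA0_model) satisfies_universal_axioms:
  assumes sen: "is_sentence (ExS (AllS \<Psi>))" and A: "A \<in> S" "sat D S e (A ## \<sigma>) (AllS \<Psi>)"
  shows "\<exists>e \<sigma>. satisfies D S e \<sigma> (universal_axioms \<Psi> k)"
proof -
  let ?F = "{p. is_Delta00 p \<and> to_nat p < k}"
  have "finite (to_nat -` {..<k} :: fml set)" by (intro finite_vimageI) auto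
  then have "finite ?F" by (rule rev_finite_subset) auto
  then obtain T where T: "T \<in> S" "\<And>p t. p \<in> ?F \<Longrightarrow> t \<in> D \<Longrightarrow> (\<forall>s\<in>D. triple (std (to_nat p)) t s \<in> T)
      \<longleftrightarrow> (\<forall>z\<in>D. sat D S (z ## t ## (\<lambda>_. std k)) (A ## (\<lambda>_. T)) p)"
    using universal_set_exists[OF _ _ A(1) std_in, of ?F k] by blast
  let ?e = "\<lambda>_::nat. std k" and ?\<sigma> = "A ## (\<lambda>_. T)"
  have "satisfies D S ?e ?\<sigma> RCA0"
    using models_RCA0_iff RCA0_model_axioms A(1) T(1) by (intro satisfies_if_models) auto
  moreover have "sat D S ?e ?\<sigma> (AllS \<Psi>)"
  proof -
    have "sat D S e (A ## \<sigma>) (AllS \<Psi>) = sat D S ?e ?\<sigma> (AllS \<Psi>)"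
      by (rule sat_cong) (use sen in \<open>auto simp: is_sentence_def split: nat.split\<close>)
    then show ?thesis using A(2) by simp
  qed
  ultimately have "satisfies D S ?e ?\<sigma> (universal_axioms \<Psi> k)"
    using T(2) std_less
    by (auto simp: satisfies_def universal_axioms_def val_num sat_universality_fml
      simp del: sat.simps(6))
  then show ?thesis by blast
qed

lemma is_consistent_universal_axioms:
  assumes sen: "is_sentence (ExS (AllS \<Psi>))" and con: "is_consistent (RCA0 \<union> {ExS (AllS \<Psi>)})"
  shows "is_consistent (\<Union>k. universal_axioms \<Psi> k)"
proof (rule is_consistent_UN_chain)
  show "universal_axioms \<Psi> k \<subseteq> universal_axioms \<Psi> (Suc k)" for k
    by (auto simp: universal_axioms_def)
  have sentences: "\<And>p. p \<in> RCA0 \<union> {ExS (AllS \<Psi>)} \<Longrightarrow> is_sentence p"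
    using sen RCA0_is_sentence by auto
  obtain z :: trm and u a m l D S e \<sigma> where
    sat: "arith_structure.satisfies z u a m l D S e \<sigma> (RCA0 \<union> {ExS (AllS \<Psi>)})"
    using completeness[OF con few_free_vars_sentences[OF sentences]] by blast
  interpret arith_structure z u a m l .
  have "models D S RCA0" using models_if_satisfies[OF sat sentences] by (auto simp: models_def)
  then interpret RCA0_model z u a m l D S by (simp add: models_RCA0_iff)
  obtain A where "A \<in> S" "sat D S e (A ## \<sigma>) (AllS \<Psi>)" using sat by (auto simp: satisfies_def)
  then show "is_consistent (universal_axioms \<Psi> k)" for k
    using satisfies_universal_axioms[OF sen] is_consistent_if_satisfies by blast
qed

lemma (in arith_structure) universal_model_if_satisfies:
  assumes "satisfies D S e \<sigma> (\<Union>k. universal_axioms \<Psi> k)"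
  shows "universal_model zero one add mul less D S (\<sigma> 0) (\<sigma> 1) (e 0)"
proof -
  have sat: "sat D S e \<sigma> p" if "p \<in> universal_axioms \<Psi> k" for p k
    using assms that unfolding satisfies_def by blast
  have "satisfies D S e \<sigma> RCA0" using assms by (auto simp: satisfies_def universal_axioms_def)
  then have "models D S RCA0" using RCA0_is_sentence by (rule models_if_satisfies)
  then interpret RCA0_model zero one add mul less D S by (simp add: models_RCA0_iff)
  show ?thesis
  proof
    show "\<sigma> 0 \<in> S" "\<sigma> 1 \<in> S" "e 0 \<in> D" using assms by (auto simp: satisfies_def)
    show "std n \<prec> e 0" for n
      using sat[of "Lt (num n) (Var 0)" "Suc n"] by (auto simp: universal_axioms_def val_num)
    show "(\<forall>s\<in>D. triple (std (to_nat p)) t s \<in> \<sigma> 1)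
        \<longleftrightarrow> (\<forall>z\<in>D. sat D S (z ## t ## (\<lambda>_. e 0)) (\<sigma> 0 ## (\<lambda>_. \<sigma> 1)) p)"
      if "is_Delta00 p" "t \<in> D" for p t
    proof -
      have "sat D S e \<sigma> (universality_fml p)"
        using that(1) by (intro sat[of _ "Suc (to_nat p)"]) (auto simp: universal_axioms_def)
      then show ?thesis using that(2) by (simp add: sat_universality_fml)
    qed
  qed
qed

theorem universal_model_exists:
  assumes sen: "is_sentence (ExS (AllS \<Psi>))" and con: "is_consistent (RCA0 \<union> {ExS (AllS \<Psi>)})"
  obtains z :: trm and u a m l D S A T c where "universal_model z u a m l D S A T c"
    "\<And>e Y \<sigma>. Y \<in> S \<Longrightarrow> arith_structure.sat z u a m l D S e (Y ## A ## \<sigma>) \<Psi>"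
proof -
  obtain z :: trm and u a m l D S e \<sigma> where
    sat: "arith_structure.satisfies z u a m l D S e \<sigma> (\<Union>k. universal_axioms \<Psi> k)"
    using completeness is_consistent_universal_axioms[OF sen con]
      few_free_vars_universal_axioms[OF sen]
    by blast
  interpret arith_structure z u a m l .
  show ?thesis
  proof (rule that[OF universal_model_if_satisfies[OF sat]])
    fix e' Y \<sigma>' assume "Y \<in> S"
    moreover have "sat D S e \<sigma> (AllS \<Psi>)"
      using sat unfolding satisfies_def by (auto simp: universal_axioms_def simp del: sat.simps)
    moreover have "sat D S e (Y ## \<sigma>) \<Psi> = sat D S e' (Y ## \<sigma> 0 ## \<sigma>') \<Psi>"
      by (rule sat_cong) (use sen in \<open>auto simp: is_sentence_def split: nat.split\<close>)
    ultimately show "sat D S e' (Y ## \<sigma> 0 ## \<sigma>') \<Psi>" by simp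
  qed
qed

section \<open>The Skolem hull\<close>

context universal_model
begin

definition has_index :: "'a \<Rightarrow> 'a \<Rightarrow> bool" where
  "has_index i x \<longleftrightarrow> (\<exists>y\<in>D. (\<forall>s\<in>D. triple i (pair x y) s \<in> T)
     \<and> (\<forall>t\<in>D. t \<prec> pair x y \<longrightarrow> (\<exists>s\<in>D. triple i t s \<notin> T)))"

definition hull :: "'a set" where
  "hull = {x \<in> D. \<exists>n. has_index (std n) x}"

lemma hull_subset: "hull \<subseteq> D"
  by (auto simp: hull_def)

lemma AT_subset: "{A, T} \<subseteq> S"
  using A_in T_in by simp

lemma has_index_unique:
  assumes D: "x \<in> D" "x' \<in> D" and index: "has_index i x" "has_index i x'" shows "x = x'"
proof -
  obtain y where y: "y \<in> D" "\<forall>s\<in>D. triple i (pair x y) s \<in> T"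
    "\<forall>t\<in>D. t \<prec> pair x y \<longrightarrow> (\<exists>s\<in>D. triple i t s \<notin> T)"
    using index(1) unfolding has_index_def by blast
  obtain y' where y': "y' \<in> D" "\<forall>s\<in>D. triple i (pair x' y') s \<in> T"
    "\<forall>t\<in>D. t \<prec> pair x' y' \<longrightarrow> (\<exists>s\<in>D. triple i t s \<notin> T)"
    using index(2) unfolding has_index_def by blast
  have "pair x y = pair x' y'"
    using less_linear[of "pair x y" "pair x' y'"] y y' D pair_in by blast
  then show ?thesis using D y(1) y'(1) by (simp add: pair_inject)
qed

lemma Sigma2_has_index:
  assumes C: "C \<subseteq> D" and U: "U \<subseteq> S" "T \<in> U" and t: "term_fun C i" "term_fun C x"
  shows "Sigma2 D C U (\<lambda>e. has_index (i e) (x e))"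
proof -
  have "Sigma2 D C U (\<lambda>e. has_index (e 0) (e 1))"
    unfolding has_index_def
    by (intro Sigma2_ex[OF C U(1)] Sigma2_conj[OF C U(1)] Sigma2_if_Pi1[OF _ C] Sigma2_if_Sigma1
        Sigma1_ball[OF C U(1)] Sigma1_ex_Delta0 Pi1_all Pi1_if_Delta0 Delta0_not Delta0_mem U(2)
        term_fun_triple term_fun_pair term_fun_var)
  from Sigma2_subst[OF this _ closed_dom C, of "\<lambda>e. i e ## (\<lambda>_. x e)"] show ?thesis
    using t by (simp add: term_fun_cons)
qed

lemma Pi1_has_index:
  assumes "Pi1 D {c} {A, T} (\<lambda>e. P (e 0))"
  obtains n where "\<And>t. t \<in> D \<Longrightarrow> (\<forall>s\<in>D. triple (std n) t s \<in> T) \<longleftrightarrow> P t"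
proof -
  have "definable (is_Pi0 1) D S {c} {A, T} (\<lambda>e. P (e 0))"
    by (rule definable_if_Pi1[OF assms]) simp_all
  then obtain p \<rho> \<sigma> where p: "is_Pi0 1 p" "range \<rho> \<subseteq> {c}" "range \<sigma> \<subseteq> {A, T}"
    "\<And>t. t \<in> D \<Longrightarrow> P t = sat D S (t ## \<rho>) \<sigma> p"
    by (rule definable_unaryE) (erule is_Pi0_subst, rule that)
  obtain q where q: "p = AllN q" "is_Delta00 q" using p(1) by (auto simp: is_Pi0_Suc_iff)
  define q' where "q' = subst_fml Var (\<lambda>k. if \<sigma> k = A then 0 else 1) q"
  have "\<rho> = (\<lambda>_. c)" "(\<lambda>k. (A ## (\<lambda>_. T)) (if \<sigma> k = A then 0 else 1)) = \<sigma>"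
    using p(2,3) by (auto simp: fun_eq_iff image_subset_iff)
  then have "P t \<longleftrightarrow> (\<forall>z\<in>D. sat D S (z ## t ## (\<lambda>_. c)) (A ## (\<lambda>_. T)) q')" if "t \<in> D" for t
    using p(4)[OF that] q(1) by (simp add: q'_def sat_subst)
  moreover have "is_Delta00 q'" using q(2) by (simp add: q'_def is_Delta00_subst)
  ultimately show ?thesis using universal that by blast
qed

lemma hull_witness_no_parameters:
  assumes P: "Sigma2 D {c} {A, T} (\<lambda>e. P (e 0))" and u: "u \<in> D" "P u"
  shows "\<exists>u\<in>hull. P u"
proof -
  obtain Q where Q: "Pi1 D {c} {A, T} Q" "\<And>e. range e \<subseteq> D \<Longrightarrow> P (e 0) \<longleftrightarrow> (\<exists>r\<in>D. Q (r ## e))"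
    using P by (rule Sigma2E) blast
  have P_iff: "P u \<longleftrightarrow> (\<exists>r\<in>D. Q (r ## (\<lambda>_. u)))" if "u \<in> D" for u
    using Q(2)[of "\<lambda>_. u"] that by (simp add: image_subset_iff)
  let ?R = "\<lambda>t. \<exists>u\<in>D. u \<preceq> t \<and> (\<exists>r\<in>D. r \<preceq> t \<and> t = pair u r \<and> Q (r ## (\<lambda>_. u)))"
  have R: "Pi1 D {c} {A, T} (\<lambda>e. ?R (e 0))"
    by (intro Pi1_bex Pi1_conj Pi1_if_Delta0 Delta0_eq Pi1_subst[OF Q(1)] closed_dom AT_subset
        term_fun_cons term_fun_pair term_fun_add term_fun_one term_fun_var) (use c_in in auto)
  obtain r where r: "r \<in> D" "Q (r ## (\<lambda>_. u))" using u P_iff by blast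
  have "Pi1 D D S (\<lambda>e. ?R (e 0))" by (rule Pi1_mono[OF R]) (use c_in AT_subset in auto)
  moreover have "?R (pair u r)" using u(1) r fst_le_pair snd_le_pair by blast
  ultimately obtain t where t: "t \<in> D" "?R t" and least: "\<And>t'. t' \<in> D \<Longrightarrow> t' \<prec> t \<Longrightarrow> \<not> ?R t'"
    using least_Pi1[of ?R "pair u r"] u(1) r(1) pair_in by blast
  obtain n where n: "\<And>t. t \<in> D \<Longrightarrow> (\<forall>s\<in>D. triple (std n) t s \<in> T) \<longleftrightarrow> ?R t"
    using Pi1_has_index[OF R] by blast
  obtain u' r' where u': "u' \<in> D" "r' \<in> D" "t = pair u' r'" "Q (r' ## (\<lambda>_. u'))" using t(2) by blast
  have "\<forall>s\<in>D. triple (std n) t s \<in> T" using n[OF t(1)] t(2) by blast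
  moreover have "\<exists>s\<in>D. triple (std n) t' s \<notin> T" if "t' \<in> D" "t' \<prec> t" for t'
    using n[OF that(1)] least[OF that] by blast
  ultimately have "has_index (std n) u'" using u'(2) unfolding has_index_def u'(3) by blast
  then have "u' \<in> hull" using u'(1) unfolding hull_def by blast
  then show ?thesis using P_iff u' by blast
qed

lemma c_in_hull: "c \<in> hull"
proof -
  have "Delta0 D {c} {A, T} (\<lambda>e. e 0 = c)" by (intro Delta0_eq term_fun_var term_fun_const) simp
  then show ?thesis using hull_witness_no_parameters[of "\<lambda>u. u = c"] Sigma2_if_Delta0 c_in by blast
qed

text \<open>A parameter from the hull can be replaced by its definition, since that is \<open>\<Sigma>\<^sup>0\<^sub>2\<close>.\<close>

lemma hull_witness_parameters:
  assumes "Sigma2 D {c} {A, T} P" "range \<rho> \<subseteq> hull" "\<And>i. N \<le> i \<Longrightarrow> \<rho> i = c" "u \<in> D" "P (u ## \<rho>)"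
  shows "\<exists>u\<in>hull. P (u ## \<rho>)"
  using assms
proof (induction N arbitrary: P \<rho> u)
  case 0
  then have "\<rho> = (\<lambda>_. c)" by auto
  moreover have "Sigma2 D {c} {A, T} (\<lambda>e. P (e 0 ## (\<lambda>_. c)))"
    by (intro Sigma2_subst[OF 0(1)] closed_dom term_fun_cons term_fun_var term_fun_const)
      (use c_in in auto)
  ultimately show ?case
    using hull_witness_no_parameters[of "\<lambda>u. P (u ## (\<lambda>_. c))" u] 0(4,5) by blast
next
  case (Suc N)
  define \<rho>' where "\<rho>' i = \<rho> (Suc i)" for i
  have \<rho>: "\<rho> = \<rho> 0 ## \<rho>'" unfolding \<rho>'_def by simp
  obtain n where n: "\<rho> 0 \<in> D" "has_index (std n) (\<rho> 0)" using Suc.prems(2) by (auto simp: hull_def)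
  let ?P = "\<lambda>e. \<exists>x\<in>D. P (e 0 ## x ## (\<lambda>i. e (Suc i))) \<and> has_index (std n) x"
  have "Sigma2 D {c} {A, T} ?P"
    by (intro Sigma2_ex Sigma2_conj Sigma2_subst[OF Suc.prems(1)] Sigma2_has_index closed_dom
        AT_subset term_fun_cons term_fun_var term_fun_std) (use c_in in auto)
  moreover have "range \<rho>' \<subseteq> hull" "\<And>i. N \<le> i \<Longrightarrow> \<rho>' i = c" using Suc.prems(2,3) by (auto simp: \<rho>'_def)
  moreover have "?P (u ## \<rho>')" using Suc.prems(5) n by (intro bexI[of _ "\<rho> 0"]) (simp_all flip: \<rho>)
  ultimately obtain u' where u': "u' \<in> hull" "?P (u' ## \<rho>')" using Suc.IH Suc.prems(4) by blast
  then obtain x where "x \<in> D" "P (u' ## x ## \<rho>')" "has_index (std n) x" by auto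
  then have "P (u' ## \<rho> 0 ## \<rho>')" using has_index_unique n by blast
  then show ?case using u'(1) by (simp flip: \<rho>) blast
qed

lemma hull_witness_AT:
  assumes P: "Sigma2 D hull {A, T} (\<lambda>e. P (e 0))" and u: "u \<in> D" "P u"
  shows "\<exists>u\<in>hull. P u"
proof -
  have "hull \<noteq> {}" using c_in_hull by blast
  then have "definable (is_Sigma0 2) D S hull {A, T} (\<lambda>e. P (e 0))"
    using definable_if_Sigma2[OF P] by simp
  then obtain p \<rho> \<sigma> where p: "is_Sigma0 2 p" "range \<rho> \<subseteq> hull" "range \<sigma> \<subseteq> {A, T}"
    "\<And>x. x \<in> D \<Longrightarrow> P x = sat D S (x ## \<rho>) \<sigma> p"
    by (rule definable_unaryE) (erule is_Sigma0_subst, rule that)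
  define \<rho>' where "\<rho>' i = (if i < boundN p then \<rho> i else c)" for i
  have P_iff: "P x \<longleftrightarrow> sat D S (x ## \<rho>') \<sigma> p" if "x \<in> D" for x
    unfolding p(4)[OF that] by (rule sat_cong) (auto simp: \<rho>'_def split: nat.split)
  have "\<exists>x\<in>hull. sat D S (x ## \<rho>') \<sigma> p"
  proof (rule hull_witness_parameters[OF Sigma2_sat[OF p(1,3)]])
    show "range \<rho>' \<subseteq> hull" using p(2) c_in_hull by (auto simp: \<rho>'_def)
    show "\<rho>' i = c" if "boundN p \<le> i" for i using that by (simp add: \<rho>'_def)
  qed (use u P_iff in auto)
  then show ?thesis using P_iff hull_subset by blast
qed

subsection \<open>Elementarity of the hull\<close>

definition hull_sets :: "'a set set" where
  "hull_sets = {Y \<in> S. Sigma1 D hull {A, T} (\<lambda>e. e 0 \<in> Y) \<and> Pi1 D hull {A, T} (\<lambda>e. e 0 \<in> Y)}"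

lemma hull_sets_subset: "hull_sets \<subseteq> S"
  by (auto simp: hull_sets_def)

lemma AT_in_hull_sets: "A \<in> hull_sets" "T \<in> hull_sets"
proof -
  have "X \<in> hull_sets" if X: "X \<in> {A, T}" for X
  proof -
    have "Delta0 D hull {A, T} (\<lambda>e. e 0 \<in> X)" using X by (intro Delta0_mem term_fun_var)
    then show ?thesis
      using X AT_subset Sigma1_if_Delta0 Pi1_if_Delta0 by (auto simp: hull_sets_def)
  qed
  then show "A \<in> hull_sets" "T \<in> hull_sets" by simp_all
qed

lemma Delta1_if_Delta0_hull_sets:
  "Delta0 D hull hull_sets P \<Longrightarrow> Sigma1 D hull {A, T} P \<and> Pi1 D hull {A, T} P"
proof (induction rule: Delta0.induct)
  case (Delta0_mem t Y)
  then show ?case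
    using Sigma1_comp1[of D hull "{A, T}" "\<lambda>x. x \<in> Y" t]
      Sigma1_comp1[of D hull "{A, T}" "\<lambda>x. x \<notin> Y" t]
      closed_dom hull_subset by (simp add: hull_sets_def Pi1_def)
next
  case (Delta0_imp P Q)
  then show ?case by (simp add: Sigma1_imp Pi1_imp)
next
  case (Delta0_ball_env t P)
  have "Sigma1 D hull {A, T} (\<lambda>e. e 0 \<prec> t (\<lambda>i. e (Suc i)))"
    by (intro Sigma1_if_Delta0 Delta0_less term_fun_var term_fun_shift Delta0_ball_env)
  then show ?case
    using Delta0_ball_env
    by (intro conjI Sigma1_ball Pi1_all Pi1_imp hull_subset AT_subset) simp_all
qed (simp_all add: Sigma1_if_Delta0 Pi1_if_Delta0 Delta0.intros)

lemma Sigma1_hull_sets: assumes "Sigma1 D hull hull_sets P" shows "Sigma1 D hull {A, T} P"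
proof -
  obtain Q where Q: "Delta0 D hull hull_sets Q" "\<And>e. range e \<subseteq> D \<Longrightarrow> P e \<longleftrightarrow> (\<exists>z\<in>D. Q (z ## e))"
    using assms by (rule Sigma1E) blast
  have "Sigma1 D hull {A, T} (\<lambda>e. \<exists>z\<in>D. Q (z ## e))"
    by (rule Sigma1_ex) (simp add: Delta1_if_Delta0_hull_sets Q(1))
  then show ?thesis by (rule Sigma1_cong) (simp add: Q(2))
qed

lemma hull_witness:
  assumes P: "Sigma2 D hull hull_sets (\<lambda>e. P (e 0))" and u: "u \<in> D" "P u"
  shows "\<exists>u\<in>hull. P u"
proof (rule hull_witness_AT[of P, OF _ u])
  show "Sigma2 D hull {A, T} (\<lambda>e. P (e 0))"
    using P by (elim Sigma2E) (rule Sigma2I, simp_all add: Pi1_def Sigma1_hull_sets)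
qed

lemma hull_ex_iff:
  assumes P: "Sigma2 D hull hull_sets P" and e: "range e \<subseteq> hull"
  shows "(\<exists>x\<in>hull. P (x ## e)) \<longleftrightarrow> (\<exists>x\<in>D. P (x ## e))"
proof -
  have "Sigma2 D hull hull_sets (\<lambda>e'. P (e' 0 ## e))"
    by (intro Sigma2_subst[OF P] closed_dom hull_subset term_fun_cons term_fun_var term_fun_const)
      (use e in auto)
  then show ?thesis using hull_witness[of "\<lambda>x. P (x ## e)"] hull_subset by blast
qed

lemma closed_hull: "closed_dom hull"
proof -
  have "f (\<lambda>_. \<zero>) \<in> hull" if f: "term_fun hull f" for f
  proof -
    have "Delta0 D hull hull_sets (\<lambda>e. e 0 = f (\<lambda>_. \<zero>))"
      by (intro Delta0_eq term_fun_var term_fun_subst[OF f, of "\<lambda>_ _. \<zero>"] term_fun_zero)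
    moreover have "f (\<lambda>_. \<zero>) \<in> D"
      by (rule term_fun_in_dom[OF f closed_dom hull_subset]) auto
    ultimately show ?thesis using hull_witness[of "\<lambda>u. u = f (\<lambda>_. \<zero>)"] Sigma2_if_Delta0 by blast
  qed
  from this[of "\<lambda>_. \<zero>"] this[of "\<lambda>_. \<one>"] this[of "\<lambda>_. x \<oplus> y" for x y] this[of "\<lambda>_. x \<odot> y" for x y]
  show ?thesis by (simp add: closed_dom_def term_fun.intros)
qed

lemma elementary_Delta00:
  "is_Delta00 p \<Longrightarrow> range e \<subseteq> hull \<Longrightarrow> range \<sigma> \<subseteq> hull_sets \<Longrightarrow> sat hull hull_sets e \<sigma> p = sat D S e \<sigma> p"
proof (induction arbitrary: e rule: is_Delta00_induct)
  case (BAll p t)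
  have "Sigma2 D hull hull_sets (\<lambda>e. \<not> (e 0 \<prec> val (\<lambda>i. e (Suc i)) t \<longrightarrow> sat D S e \<sigma> p))"
    by (intro Sigma2_if_Delta0 Delta0_not Delta0_imp Delta0_less Delta0_sat BAll term_fun_val
        term_fun_var)
  from hull_ex_iff[OF this BAll.prems(1)] show ?case using BAll by auto
next
  case (BEx p t)
  have "Sigma2 D hull hull_sets (\<lambda>e. e 0 \<prec> val (\<lambda>i. e (Suc i)) t \<and> sat D S e \<sigma> p)"
    by (intro Sigma2_if_Delta0 Delta0_conj Delta0_less Delta0_sat BEx term_fun_val term_fun_var)
  from hull_ex_iff[OF this BEx.prems(1)] show ?case using BEx by auto
qed auto

lemma elementary_Sigma1:
  assumes "is_Sigma0 1 p" "range e \<subseteq> hull" "range \<sigma> \<subseteq> hull_sets"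
  shows "sat hull hull_sets e \<sigma> p = sat D S e \<sigma> p"
proof -
  obtain q where "p = ExN q" "is_Delta00 q" using assms(1) by (auto simp: is_Sigma0_Suc_iff)
  then show ?thesis
    using hull_ex_iff[OF Sigma2_if_Delta0[OF Delta0_sat[of q]]] elementary_Delta00 assms by simp
qed

lemma elementary_Pi1:
  assumes "is_Pi0 1 p" "range e \<subseteq> hull" "range \<sigma> \<subseteq> hull_sets"
  shows "sat hull hull_sets e \<sigma> p = sat D S e \<sigma> p"
proof -
  obtain q where "p = AllN q" "is_Delta00 q" using assms(1) by (auto simp: is_Pi0_Suc_iff)
  moreover from this have "(\<exists>x\<in>hull. \<not> sat D S (x ## e) \<sigma> q) \<longleftrightarrow> (\<exists>x\<in>D. \<not> sat D S (x ## e) \<sigma> q)"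
    using assms by (intro hull_ex_iff Sigma2_if_Delta0 Delta0_not Delta0_sat)
  ultimately show ?thesis using elementary_Delta00 assms by auto
qed

lemma elementary_Sigma2:
  assumes "is_Sigma0 2 p" "range e \<subseteq> hull" "range \<sigma> \<subseteq> hull_sets"
  shows "sat hull hull_sets e \<sigma> p = sat D S e \<sigma> p"
proof -
  obtain q where "p = ExN q" "is_Pi0 1 q"
    using assms(1) by (auto simp: is_Sigma0_Suc_iff numeral_2_eq_2)
  then show ?thesis
    using hull_ex_iff[OF Sigma2_if_Pi1[OF Pi1_sat[of q] hull_subset]] elementary_Pi1 assms by simp
qed

lemma hull_sat_Pi3:
  assumes "is_Pi0 3 p" "range e \<subseteq> hull" "range \<sigma> \<subseteq> hull_sets" "sat D S e \<sigma> p"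
  shows "sat hull hull_sets e \<sigma> p"
proof -
  obtain q where "p = AllN q" "is_Sigma0 2 q"
    using assms(1) by (auto simp: is_Pi0_Suc_iff numeral_3_eq_3 numeral_2_eq_2)
  then show ?thesis using assms hull_subset elementary_Sigma2 by auto
qed

subsection \<open>The hull is a model of \<open>RCA\<^sub>0\<close>\<close>

lemma Sigma1_hull_extends:
  assumes "Sigma1 hull hull hull_sets (\<lambda>e. P (e 0))"
  obtains P' where "Sigma1 D hull hull_sets (\<lambda>e. P' (e 0))" "\<And>x. x \<in> hull \<Longrightarrow> P x \<longleftrightarrow> P' x"
proof -
  have "hull \<noteq> {}" "hull_sets \<noteq> {}" using c_in_hull AT_in_hull_sets by blast+
  then have "definable (is_Sigma0 1) hull hull_sets hull hull_sets (\<lambda>e. P (e 0))"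
    using definable_if_Sigma1[OF assms] by simp
  then obtain p \<rho> \<sigma> where p: "is_Sigma0 1 p" "range \<rho> \<subseteq> hull" "range \<sigma> \<subseteq> hull_sets"
    "\<And>x. x \<in> hull \<Longrightarrow> P x = sat hull hull_sets (x ## \<rho>) \<sigma> p"
    by (rule definable_unaryE) (erule is_Sigma0_subst, rule that)
  show ?thesis
  proof (rule that)
    show "Sigma1 D hull hull_sets (\<lambda>e. sat D S (e 0 ## \<rho>) \<sigma> p)"
      by (intro Sigma1_subst[OF Sigma1_sat[OF p(1,3)]] closed_dom hull_subset term_fun_cons
          term_fun_var term_fun_const) (use p(2) in auto)
    show "P x \<longleftrightarrow> sat D S (x ## \<rho>) \<sigma> p" if "x \<in> hull" for x
      using p that elementary_Sigma1[of p "x ## \<rho>" \<sigma>] by simp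
  qed
qed

lemma hull_Sigma1_induct:
  assumes P: "Sigma1 hull hull hull_sets (\<lambda>e. P (e 0))"
    and zero: "P \<zero>" and succ: "\<And>x. x \<in> hull \<Longrightarrow> P x \<Longrightarrow> P (x \<oplus> \<one>)" and x: "x \<in> hull"
  shows "P x"
proof -
  obtain P' where P': "Sigma1 D hull hull_sets (\<lambda>e. P' (e 0))"
    and P_iff: "\<And>x. x \<in> hull \<Longrightarrow> P x \<longleftrightarrow> P' x"
    using Sigma1_hull_extends[OF P] by blast
  have succ_in: "y \<oplus> \<one> \<in> hull" if "y \<in> hull" for y
    using that closed_hull by (simp add: closed_dom_def)
  have "P' x"
  proof (rule Sigma1_induct[where P = P'])
    show "Sigma1 D D S (\<lambda>e. P' (e 0))" by (rule Sigma1_mono[OF P' hull_subset hull_sets_subset])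
    show "P' \<zero>" using zero P_iff closed_hull by (simp add: closed_dom_def)
    show "P' (y \<oplus> \<one>)" if y: "y \<in> D" "P' y" for y
    proof (rule ccontr)
      assume "\<not> P' (y \<oplus> \<one>)"
      moreover have "Sigma2 D hull hull_sets (\<lambda>e. P' (e 0) \<and> \<not> P' (e 0 \<oplus> \<one>))"
        by (intro Sigma2_conj hull_subset hull_sets_subset Sigma2_if_Sigma1[OF P'] Sigma2_if_Pi1
            Pi1_not Sigma1_comp1[OF P'] closed_dom term_fun.intros)
      ultimately obtain y' where "y' \<in> hull" "P' y'" "\<not> P' (y' \<oplus> \<one>)"
        using hull_witness[of "\<lambda>x. P' x \<and> \<not> P' (x \<oplus> \<one>)" y] y by blast
      then show False using succ P_iff succ_in by blast
    qed
  qed (use x hull_subset in blast)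
  then show ?thesis using P_iff[OF x] by simp
qed

lemma hull_Delta1_comprehension:
  assumes P: "Sigma1 hull hull hull_sets (\<lambda>e. P (e 0))"
    and not_P: "Pi1 hull hull hull_sets (\<lambda>e. P (e 0))"
  shows "\<exists>X\<in>hull_sets. \<forall>x\<in>hull. x \<in> X \<longleftrightarrow> P x"
proof -
  obtain P' where P': "Sigma1 D hull hull_sets (\<lambda>e. P' (e 0))"
    and P_iff: "\<And>x. x \<in> hull \<Longrightarrow> P x \<longleftrightarrow> P' x"
    using Sigma1_hull_extends[OF P] by blast
  obtain N where N: "Sigma1 D hull hull_sets (\<lambda>e. N (e 0))" and N_iff: "\<And>x. x \<in> hull \<Longrightarrow> \<not> P x \<longleftrightarrow> N x"
    using Sigma1_hull_extends[OF not_P[unfolded Pi1_def]] by blast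
  note Sigma2 = Sigma2_conj[OF hull_subset hull_sets_subset]
  have "Sigma2 D hull hull_sets (\<lambda>e. P' (e 0) \<and> N (e 0))"
    by (intro Sigma2 Sigma2_if_Sigma1 P' N)
  then have disjoint: "\<not> (P' x \<and> N x)" if "x \<in> D" for x
    using hull_witness[of "\<lambda>x. P' x \<and> N x" x] that P_iff N_iff by blast
  have "Sigma2 D hull hull_sets (\<lambda>e. \<not> P' (e 0) \<and> \<not> N (e 0))"
    by (intro Sigma2 Sigma2_if_Pi1 Pi1_not P' N hull_subset)
  then have "P' x \<or> N x" if "x \<in> D" for x
    using hull_witness[of "\<lambda>x. \<not> P' x \<and> \<not> N x" x] that P_iff N_iff by blast
  then have N_iff': "N x \<longleftrightarrow> \<not> P' x" if "x \<in> D" for x using that disjoint by blast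
  have "Sigma1 D hull hull_sets (\<lambda>e. \<not> P' (e 0))"
    using N by (rule Sigma1_cong) (simp add: N_iff' image_subset_iff)
  then have "Pi1 D hull hull_sets (\<lambda>e. P' (e 0))" by (simp add: Pi1_def)
  note P'_Delta1 = P' this
  obtain X where X: "X \<in> S" "\<forall>x\<in>D. x \<in> X \<longleftrightarrow> P' x"
    using Delta1_comprehension[of P'] Sigma1_mono[OF P'_Delta1(1) hull_subset hull_sets_subset]
      Pi1_mono[OF P'_Delta1(2) hull_subset hull_sets_subset] by blast
  have "Sigma1 D hull {A, T} (\<lambda>e. e 0 \<in> X)"
    using Sigma1_hull_sets[OF P'_Delta1(1)] by (rule Sigma1_cong) (use X(2) in auto)
  moreover have "Pi1 D hull {A, T} (\<lambda>e. e 0 \<in> X)"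
    using Sigma1_hull_sets[OF P'_Delta1(2)[unfolded Pi1_def]] unfolding Pi1_def
    by (rule Sigma1_cong) (use X(2) in auto)
  ultimately have "X \<in> hull_sets" using X(1) by (simp add: hull_sets_def)
  then show ?thesis using X(2) P_iff hull_subset by blast
qed

lemma hull_RCA0_model: "RCA0_model zero one add mul less hull hull_sets"
proof
  note inD = hull_subset[THEN subsetD]
  show "hull_sets \<noteq> {}" using AT_in_hull_sets by blast
  show "x \<oplus> \<one> \<noteq> \<zero>" if "x \<in> hull" for x using that inD succ_not_zero by blast
  show "x = y" if "x \<in> hull" "y \<in> hull" "x \<oplus> \<one> = y \<oplus> \<one>" for x y using that inD succ_inj by blast
  show "x \<prec> y \<oplus> \<one> \<longleftrightarrow> x \<prec> y \<or> x = y" if "x \<in> hull" "y \<in> hull" for x y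
    using that inD less_succ by blast
  show "P x" if "Sigma1 hull hull hull_sets (\<lambda>e. P (e 0))" "P \<zero>"
    "\<And>x. x \<in> hull \<Longrightarrow> P x \<Longrightarrow> P (x \<oplus> \<one>)" "x \<in> hull" for P x
    using that by (rule hull_Sigma1_induct)
  show "\<exists>X\<in>hull_sets. \<forall>x\<in>hull. x \<in> X \<longleftrightarrow> P x"
    if "Sigma1 hull hull hull_sets (\<lambda>e. P (e 0))" "Pi1 hull hull hull_sets (\<lambda>e. P (e 0))" for P
    using that by (rule hull_Delta1_comprehension)
qed (use closed_hull hull_subset in
    \<open>auto simp: closed_dom_def add_zero add_succ mul_zero mul_succ not_less_zero subset_iff\<close>)

end

section \<open>Failure of \<open>\<Sigma>\<^sup>0\<^sub>2\<close> bounding\<close>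

context arith_structure
begin

definition Sigma2_bounding :: "'m set \<Rightarrow> 'm set set \<Rightarrow> bool" where
  "Sigma2_bounding D S \<longleftrightarrow> (\<forall>P. Sigma2 D D S (\<lambda>e. P (e 0) (e 1)) \<longrightarrow> (\<forall>i\<in>D. \<exists>j\<in>D. P j i) \<longrightarrow>
     (\<forall>m\<in>D. \<exists>n\<in>D. \<forall>i\<in>D. i \<prec> m \<longrightarrow> (\<exists>j\<in>D. j \<prec> n \<and> P j i)))"

lemma sat_bounding_fml:
  "sat D S e \<sigma> (bounding_fml p) \<longleftrightarrow>
    ((\<forall>i\<in>D. \<exists>j\<in>D. sat D S (j ## i ## e) \<sigma> p) \<longrightarrow>
     (\<forall>m\<in>D. \<exists>n\<in>D. \<forall>i\<in>D. i \<prec> m \<longrightarrow> (\<exists>j\<in>D. j \<prec> n \<and> sat D S (j ## i ## e) \<sigma> p)))"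
proof -
  have "(\<lambda>k. val (j ## i ## n ## m ## e) (Var (if k < 2 then k else k + 2))) = j ## i ## e"
    for i j m n
    by (auto simp: fun_eq_iff numeral_2_eq_2 split: nat.split)
  then show ?thesis by (auto simp: bounding_fml_def sat_subst)
qed

lemma Sigma2_bounding_if_models:
  assumes M: "models D S (BSigma0 2)" shows "Sigma2_bounding D S"
  unfolding Sigma2_bounding_def
proof (intro allI impI)
  fix P assume "Sigma2 D D S (\<lambda>e. P (e 0) (e 1))" and ex: "\<forall>i\<in>D. \<exists>j\<in>D. P j i"
  then have "definable (is_Sigma0 2) D S D S (\<lambda>e. P (e 0) (e 1))"
    using M by (intro definable_if_Sigma2) (auto simp: models_def closed_dom_def)
  then obtain p \<rho> \<sigma> where p: "is_Sigma0 2 p" "range \<rho> \<subseteq> D" "range \<sigma> \<subseteq> S"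
    "\<And>j i. j \<in> D \<Longrightarrow> i \<in> D \<Longrightarrow> P j i = sat D S (j ## i ## \<rho>) \<sigma> p"
    by (rule definable_binaryE) (erule is_Sigma0_subst, rule that)
  have "sat D S \<rho> \<sigma> (bounding_fml p)"
    by (rule models_univ_closure[OF M _ p(2,3)]) (use p(1) in \<open>auto simp: BSigma0_def\<close>)
  then show "\<forall>m\<in>D. \<exists>n\<in>D. \<forall>i\<in>D. i \<prec> m \<longrightarrow> (\<exists>j\<in>D. j \<prec> n \<and> P j i)"
    using ex p(4) unfolding sat_bounding_fml by simp
qed

end

lemma (in RCA0_model) Sigma2_bounding_Pi1_witnesses:
  assumes bounding: "Sigma2_bounding D S" and c: "c \<in> D" and B: "B \<in> D"
    and W: "Pi1 D D S (\<lambda>e. W (e 0) (e 1) (e 2))"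
    and total: "\<And>x. x \<in> D \<Longrightarrow> \<exists>i\<in>D. i \<prec> c \<and> (\<exists>r\<in>D. W r i x)"
  obtains n where "n \<in> D"
    "\<And>x. x \<in> D \<Longrightarrow> x \<preceq> B \<Longrightarrow> \<exists>i\<in>D. i \<prec> c \<and> (\<exists>r\<in>D. r \<prec> n \<and> W r i x)"
proof -
  let ?P = "\<lambda>j x. \<exists>i\<in>D. i \<prec> c \<and> (\<exists>r\<in>D. r \<prec> j \<and> W r i x)"
  have "Sigma2 D D S (\<lambda>e. ?P (e 0) (e 1))"
    by (intro Sigma2_if_Pi1 Pi1_bex Pi1_comp3[OF W] closed_dom subset_refl term_fun_var
        term_fun_const c)
  moreover have "\<forall>x\<in>D. \<exists>j\<in>D. ?P j x"
  proof
    fix x assume "x \<in> D"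
    then obtain i r where r: "i \<in> D" "i \<prec> c" "r \<in> D" "W r i x" using total by blast
    then have "?P (r \<oplus> \<one>) x" using le_refl by blast
    then show "\<exists>j\<in>D. ?P j x" by (rule bexI) (use r(3) in simp)
  qed
  ultimately have "\<forall>b\<in>D. \<exists>n\<in>D. \<forall>x\<in>D. x \<prec> b \<longrightarrow> (\<exists>j\<in>D. j \<prec> n \<and> ?P j x)"
    using bounding[unfolded Sigma2_bounding_def, THEN spec, of ?P] by (elim impE)
  from bspec[OF this add_in[OF B one_in]]
  obtain n where n: "n \<in> D" "\<And>x. x \<in> D \<Longrightarrow> x \<preceq> B \<Longrightarrow> \<exists>j\<in>D. j \<prec> n \<and> ?P j x" by blast
  then have "?P n x" if "x \<in> D" "x \<preceq> B" for x using that less_trans by blast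
  then show ?thesis using that n(1) by blast
qed

text \<open>A partial \<open>\<Sigma>\<^sup>0\<^sub>2\<close> function from the numbers below \<open>c\<close> misses a value: otherwise bounding
  bounds the witnesses for all codes of subsets of \<open>{i. i \<prec> c}\<close>, and then the set of the \<open>i\<close> that
  are not in the set coded by the value at \<open>i\<close> has a code.\<close>

lemma (in RCA0_model) Sigma2_partial_function_not_surjective:
  assumes bounding: "Sigma2_bounding D S" and c: "c \<in> D"
    and F: "Sigma2 D D S (\<lambda>e. F (e 0) (e 1))"
    and F_unique: "\<And>i x x'. x \<in> D \<Longrightarrow> x' \<in> D \<Longrightarrow> F i x \<Longrightarrow> F i x' \<Longrightarrow> x = x'"
  shows "\<exists>x\<in>D. \<forall>i\<in>D. i \<prec> c \<longrightarrow> \<not> F i x"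
proof (rule ccontr)
  assume no: "\<not> ?thesis"
  obtain Q where Q: "Pi1 D D S Q" "\<And>e. range e \<subseteq> D \<Longrightarrow> F (e 0) (e 1) \<longleftrightarrow> (\<exists>r\<in>D. Q (r ## e))"
    using F by (rule Sigma2E) blast
  define W where "W r i x \<longleftrightarrow> Q (r ## i ## (\<lambda>_. x))" for r i x
  have F_iff: "F i x \<longleftrightarrow> (\<exists>r\<in>D. W r i x)" if "i \<in> D" "x \<in> D" for i x
    using Q(2)[of "i ## (\<lambda>_. x)"] that by (simp add: W_def image_subset_iff)
  have W: "Pi1 D D S (\<lambda>e. W (e 0) (e 1) (e 2))"
    unfolding W_def by (intro Pi1_subst[OF Q(1)] closed_dom subset_refl term_fun_cons term_fun_var)
  obtain m B where mB: "m \<in> D" "B \<in> D" and code: "\<And>X. Sigma1 D D S (\<lambda>e. X (e 0)) \<Longrightarrow>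
      \<exists>x\<in>D. x \<preceq> B \<and> (\<forall>i\<in>D. i \<prec> c \<longrightarrow> (i \<in> decode D x m \<longleftrightarrow> X i))"
    using Sigma1_codes[OF c] by blast
  have "\<exists>i\<in>D. i \<prec> c \<and> (\<exists>r\<in>D. W r i x)" if "x \<in> D" for x using no F_iff that by blast
  then obtain n where n: "n \<in> D"
    "\<And>x. x \<in> D \<Longrightarrow> x \<preceq> B \<Longrightarrow> \<exists>i\<in>D. i \<prec> c \<and> (\<exists>r\<in>D. r \<prec> n \<and> W r i x)"
    using Sigma2_bounding_Pi1_witnesses[OF bounding c mB(2) W] by blast
  define Y where "Y i \<longleftrightarrow> (\<exists>x\<in>D. x \<preceq> B \<and> (\<exists>r\<in>D. r \<prec> n \<and> W r i x \<and> i \<in> decode D x m))" for i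
  have "Pi1 D D S (\<lambda>e. Y (e 0))"
    unfolding Y_def
    by (intro Pi1_bex Pi1_conj Pi1_comp3[OF W] Pi1_if_Delta0 Delta0_decode closed_dom
        subset_refl term_fun.intros mB n(1))
  from code[OF Sigma1_not[OF this]] obtain x where
    x: "x \<in> D" "x \<preceq> B" "\<And>i. i \<in> D \<Longrightarrow> i \<prec> c \<Longrightarrow> i \<in> decode D x m \<longleftrightarrow> \<not> Y i" by blast
  obtain i r where i: "i \<in> D" "i \<prec> c" "r \<in> D" "r \<prec> n" "W r i x" using n(2)[OF x(1,2)] by blast
  have "Y i \<longleftrightarrow> i \<in> decode D x m"
  proof
    assume "Y i"
    then obtain x' r' where "x' \<in> D" "r' \<in> D" "W r' i x'" "i \<in> decode D x' m"
      unfolding Y_def by blast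
    then show "i \<in> decode D x m" using F_unique[of x x' i] F_iff i x(1) by blast
  next
    assume "i \<in> decode D x m"
    then show "Y i" using x(1,2) i unfolding Y_def by blast
  qed
  then show False using x(3) i by blast
qed

context universal_model
begin

lemma Sigma2_has_index_hull: "Sigma2 hull hull hull_sets (\<lambda>e. has_index (e 0) (e 1))"
proof -
  have ne: "hull \<noteq> {}" "hull_sets \<noteq> {}" using c_in_hull AT_in_hull_sets by blast+
  have "Sigma2 D hull hull_sets (\<lambda>e. has_index (e 0) (e 1))"
    by (intro Sigma2_has_index hull_subset hull_sets_subset AT_in_hull_sets term_fun_var)
  then have "definable (is_Sigma0 2) D S hull hull_sets (\<lambda>e. has_index (e 0) (e 1))"
    using definable_if_Sigma2 ne by blast
  then obtain p \<rho> \<sigma> where p: "is_Sigma0 2 p" "range \<rho> \<subseteq> hull" "range \<sigma> \<subseteq> hull_sets"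
    "\<And>e. range e \<subseteq> D \<Longrightarrow> has_index (e 0) (e 1) = sat D S (join e \<rho>) \<sigma> p"
    by (rule definableE) (rule that)
  have "Sigma2 hull hull hull_sets (\<lambda>e. sat hull hull_sets (join e \<rho>) \<sigma> p)"
    by (intro Sigma2_subst[OF Sigma2_sat[OF p(1,3)]] closed_hull subset_refl term_fun_join
        term_fun_var term_fun_const) (use p(2) in auto)
  moreover have "sat hull hull_sets (join e \<rho>) \<sigma> p = has_index (e 0) (e 1)"
    if "range e \<subseteq> hull" for e
    using elementary_Sigma2[OF p(1) _ p(3), of "join e \<rho>"] p(2,4) that hull_subset by auto
  ultimately show ?thesis
    by (elim Sigma2E) (rule Sigma2I, assumption, simp)
qed

lemma hull_not_Sigma2_bounding: "\<not> Sigma2_bounding hull hull_sets"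
proof
  interpret hull: RCA0_model zero one add mul less hull hull_sets by (rule hull_RCA0_model)
  assume "Sigma2_bounding hull hull_sets"
  then obtain x where x: "x \<in> hull" "\<And>i. i \<in> hull \<Longrightarrow> i \<prec> c \<Longrightarrow> \<not> has_index i x"
    using hull.Sigma2_partial_function_not_surjective[OF _ c_in_hull Sigma2_has_index_hull]
      has_index_unique hull_subset by blast
  then show False using std_less_c hull.std_in unfolding hull_def by blast
qed

lemma hull_models_RCA0: "models hull hull_sets RCA0"
  using hull_RCA0_model by (simp add: models_RCA0_iff)

end

theorem theorem3p4:
  fixes \<Psi> :: fml
  assumes "is_Pi0 3 \<Psi>"
    and "is_sentence (ExS (AllS \<Psi>))"
    and "is_consistent (RCA0 \<union> {ExS (AllS \<Psi>)})"
  shows "\<not> proves_scheme (RCA0 \<union> {ExS (AllS \<Psi>)}) (BSigma0 2)"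
proof
  assume proves: "proves_scheme (RCA0 \<union> {ExS (AllS \<Psi>)}) (BSigma0 2)"
  obtain z :: trm and u a m l D S A T c where "universal_model z u a m l D S A T c"
    and \<Psi>: "\<And>e Y \<sigma>. Y \<in> S \<Longrightarrow> arith_structure.sat z u a m l D S e (Y ## A ## \<sigma>) \<Psi>"
    using universal_model_exists[OF assms(2,3)] by blast
  then interpret universal_model z u a m l D S A T c by simp
  have "sat hull hull_sets e \<sigma> (ExS (AllS \<Psi>))" if "range e \<subseteq> hull" "range \<sigma> \<subseteq> hull_sets" for e \<sigma>
  proof -
    have "sat hull hull_sets e (Y ## A ## \<sigma>) \<Psi>" if "Y \<in> hull_sets" for Y
      using hull_sat_Pi3[OF assms(1)] \<Psi> that \<open>range e \<subseteq> hull\<close> \<open>range \<sigma> \<subseteq> hull_sets\<close>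
        AT_in_hull_sets hull_sets_subset by (simp add: subset_iff)
    then show ?thesis using AT_in_hull_sets by auto
  qed
  then have "models hull hull_sets (RCA0 \<union> {ExS (AllS \<Psi>)})"
    using hull_models_RCA0 unfolding models_def by blast
  then have "models hull hull_sets (BSigma0 2)" using proves by (rule models_if_proves_scheme)
  then show False using Sigma2_bounding_if_models hull_not_Sigma2_bounding by blast
qed

end
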